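(* Let $\alpha,c,s$ be complex numbers with $c\notin[0,\infty)$ and $s=a+ib$, $a>0$, $b\in\mathbb{R}$; let $m>0$, $k\in[0,1)$ and $f,g\in\mathcal{A}$. Suppose there exists a function $h$, analytic in $\mathcal{U}$, with $h(0)=h_0$, $h_0\in\mathbb{C}$, $h_0\notin(-\infty,0]$, such that the inequalities $$\left|\alpha-\frac{m}{2a}\right|<\frac{m}{2a},$$ $$\left|\frac{c\alpha}{h(z)}+\frac{m}{2}\right|<k\frac{m}{2}$$ and $$\left|\frac{-c\alpha}{ah(z)}|z|^{m/a}+\left(1-|z|^{m/a}\right)\left[(\alpha-1)\frac{zg'(z)}{g(z)}+1+\frac{zf''(z)}{f'(z)}+\frac{zh'(z)}{h(z)}\right]-\frac{m}{2a}\right|\le k\frac{m}{2a}$$ hold for all $z\in\mathcal{U}$. Then the function $$G_\alpha(z)=\left[\alpha\int_0^z g^{\alpha-1}(u)f'(u)\,du\right]^{1/\alpha}$$ (principal branch) has a $K$-quasiconformal extension to $\mathbb{C}$, where $$K=\begin{cases}k & \text{for } s=1,\\[4pt] \dfrac{|s-1|^2+k|\bar{s}^2-1|}{|\bar{s}^2-1|+k|s-1|^2} & \text{for } s\neq1.\end{cases}$$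
   Context: $\mathcal{U}=\{z\in\mathbb{C}:|z|<1\}$. $\mathcal{A}$ is the class of functions $f$ analytic in $\mathcal{U}$ with $f(0)=0$, $f'(0)=1$. $\bar s$ is the complex conjugate of $s$. The quotient $zg'(z)/g(z)$ is taken to be $1$ at $z=0$. The inequalities presuppose that the quotients in them are defined, i.e. for all $z\in\mathcal{U}$: $h(z)\neq0$, $f'(z)\neq0$, and (when $\alpha\ne1$) $g(z)\neq0$ for $z\neq0$. Quasiconformality: for a real constant $k$ with $0\le k<1$, a sense-preserving homeomorphism $F$ of a plane domain $G\subset\mathbb{C}$ is $k$-quasiconformal if $F$ is absolutely continuous on almost all lines parallel to the coordinate axes and $|F_{\bar z}|\le k|F_z|$ almost everywhere in $G$, where $F_{\bar z}=\partial F/\partial\bar z$, $F_z=\partial F/\partial z$. (So the constant bounds the complex dilatation, and $K$ in the claim is used in this sense, with $K<1$.) A $K$-quasiconformal extension of $G_\alpha$ to $\mathbb{C}$ is a $K$-quasiconformal map of $\mathbb{C}$ whose restriction to $\mathcal{U}$ is $G_\alpha$. Meaning of $G_\alpha$ and its branch: write $g^{\alpha-1}(u)=u^{\alpha-1}(g(u)/u)^{\alpha-1}$, where $g(u)/u$ has value $1$ at $u=0$ and $(g(u)/u)^{\alpha-1}$ is the branch equal to $1$ at $u=0$. Then $\alpha\int_0^z g^{\alpha-1}(u)f'(u)\,du=z^\alpha\phi(z)$ with $\phi(z)=\alpha\int_0^1 t^{\alpha-1}\left(\frac{g(tz)}{tz}\right)^{\alpha-1}f'(tz)\,dt$ analytic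 near $0$, $\phi(0)=1$, and $G_\alpha(z)=z\,\phi(z)^{1/\alpha}$ with the branch of $\phi^{1/\alpha}$ equal to $1$ at $0$; $G_\alpha$ on $\mathcal{U}$ denotes the analytic extension to $\mathcal{U}$ of the function so defined near the origin (its existence is part of the assertion). *)

theory Defs
  imports "HOL-Complex_Analysis.Complex_Analysis"
begin

section \<open>Normalised analytic functions on the unit disc\<close>

abbreviation unit_disc :: "complex set"  (\<open>\<U>\<close>)
  where "\<U> \<equiv> ball 0 1"

definition class_A :: "(complex \<Rightarrow> complex) set"  (\<open>\<A>\<close>) where
  "\<A> = {f. f holomorphic_on \<U> \<and> f 0 = 0 \<and> deriv f 0 = 1}"

definition log_deriv_quot :: "(complex \<Rightarrow> complex) \<Rightarrow> complex \<Rightarrow> complex" where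
  "log_deriv_quot g z = (if z = 0 then 1 else z * deriv g z / g z)"

definition div_id :: "(complex \<Rightarrow> complex) \<Rightarrow> complex \<Rightarrow> complex" where
  "div_id g u = (if u = 0 then 1 else g u / u)"


section \<open>The integral operator\<close>

text \<open>
  The substitution \<open>u = t z\<close> gives
  \<open>\<alpha> \<integral>\<^sub>0\<^sup>z g\<^sup>\<alpha>\<^sup>-\<^sup>1(u) f'(u) du = z\<^sup>\<alpha> \<phi>(z)\<close> with the following \<open>\<phi>\<close>.
  The principal power of \<open>g(u)/u\<close> is the branch with value \<open>1\<close> at \<open>u = 0\<close> only as long as
  \<open>g(u)/u\<close> avoids the non-positive reals, so \<open>G_phi\<close> is meaningful only for \<open>z\<close> near \<open>0\<close>.
\<close>

definition G_phi ::
  "complex \<Rightarrow> (complex \<Rightarrow> complex) \<Rightarrow> (complex \<Rightarrow> complex) \<Rightarrow> complex \<Rightarrow> complex" where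
  "G_phi \<alpha> f g z =
     \<alpha> * integral {0..1::real}
           (\<lambda>t. of_real t powr (\<alpha> - 1) * div_id g (of_real t * z) powr (\<alpha> - 1)
                  * deriv f (of_real t * z))"

text \<open>
  \<open>G\<close> is the analytic extension to the disc of the germ \<open>z \<phi>(z)\<^sup>1\<^sup>/\<^sup>\<alpha>\<close> at \<open>0\<close>. Since \<open>\<phi>(0) = 1\<close>,
  the principal power is the required branch near \<open>0\<close>. By the identity theorem \<open>G\<close> is
  determined on the disc.
\<close>

definition is_G_alpha ::
  "complex \<Rightarrow> (complex \<Rightarrow> complex) \<Rightarrow> (complex \<Rightarrow> complex) \<Rightarrow> (complex \<Rightarrow> complex) \<Rightarrow> bool" where
  "is_G_alpha \<alpha> f g G \<longleftrightarrow>
     G holomorphic_on \<U> \<and> (\<forall>\<^sub>F z in nhds 0. G z = z * G_phi \<alpha> f g z powr (1 / \<alpha>))"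


section \<open>Quasiconformal maps\<close>

text \<open>
  Classical absolute continuity of a function on an interval. The finite set \<open>I\<close> lists the end
  points of non-overlapping subintervals.
\<close>

definition abs_continuous_on_interval :: "real \<Rightarrow> real \<Rightarrow> (real \<Rightarrow> complex) \<Rightarrow> bool" where
  "abs_continuous_on_interval a b \<phi> \<longleftrightarrow>
     (\<forall>\<epsilon>>0. \<exists>\<delta>>0. \<forall>I :: (real \<times> real) set.
        finite I \<and> (\<forall>(x, y)\<in>I. a \<le> x \<and> x \<le> y \<and> y \<le> b) \<and>
        pairwise (\<lambda>p q. disjnt {fst p<..<snd p} {fst q<..<snd q}) I \<and>
        (\<Sum>(x, y)\<in>I. y - x) < \<delta>
        \<longrightarrow> (\<Sum>(x, y)\<in>I. norm (\<phi> y - \<phi> x)) < \<epsilon>)"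

text \<open>
  Absolute continuity on almost all lines: in every closed rectangle contained in \<open>S\<close>, on almost
  every horizontal and almost every vertical cross-section.
\<close>

definition ACL_on :: "complex set \<Rightarrow> (complex \<Rightarrow> complex) \<Rightarrow> bool" where
  "ACL_on S F \<longleftrightarrow>
     (\<forall>x1 x2 y1 y2. x1 \<le> x2 \<and> y1 \<le> y2 \<and> cbox (Complex x1 y1) (Complex x2 y2) \<subseteq> S \<longrightarrow>
        (AE y\<in>{y1..y2} in lborel. abs_continuous_on_interval x1 x2 (\<lambda>x. F (Complex x y))) \<and>
        (AE x\<in>{x1..x2} in lborel. abs_continuous_on_interval y1 y2 (\<lambda>y. F (Complex x y))))"

definition has_partials_at :: "(complex \<Rightarrow> complex) \<Rightarrow> complex \<Rightarrow> bool" where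
  "has_partials_at F z \<longleftrightarrow>
     (\<lambda>t::real. F (z + of_real t)) differentiable at 0 \<and>
     (\<lambda>t::real. F (z + \<i> * of_real t)) differentiable at 0"

definition partial_x :: "(complex \<Rightarrow> complex) \<Rightarrow> complex \<Rightarrow> complex" where
  "partial_x F z = vector_derivative (\<lambda>t::real. F (z + of_real t)) (at 0)"

definition partial_y :: "(complex \<Rightarrow> complex) \<Rightarrow> complex \<Rightarrow> complex" where
  "partial_y F z = vector_derivative (\<lambda>t::real. F (z + \<i> * of_real t)) (at 0)"

definition partial_z :: "(complex \<Rightarrow> complex) \<Rightarrow> complex \<Rightarrow> complex" where
  "partial_z F z = (partial_x F z - \<i> * partial_y F z) / 2"

definition partial_zbar :: "(complex \<Rightarrow> complex) \<Rightarrow> complex \<Rightarrow> complex" where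
  "partial_zbar F z = (partial_x F z + \<i> * partial_y F z) / 2"

text \<open>
  For a homeomorphism, sense-preserving means local degree \<open>+1\<close>: the image of every small
  positively oriented circle around a point winds once, positively, around the image of that point.
\<close>

definition sense_preserving_on :: "complex set \<Rightarrow> (complex \<Rightarrow> complex) \<Rightarrow> bool" where
  "sense_preserving_on S F \<longleftrightarrow>
     (\<forall>z r. r > 0 \<and> cball z r \<subseteq> S \<longrightarrow> winding_number (F \<circ> circlepath z r) (F z) = 1)"

text \<open>
  The constant \<open>k\<close> bounds the complex dilatation. The existence of the partial derivatives almost
  everywhere follows from the ACL property; it is included because \<open>partial_z\<close> and
  \<open>partial_zbar\<close> have no meaning where they do not exist.
\<close>

definition quasiconformal_on :: "real \<Rightarrow> complex set \<Rightarrow> (complex \<Rightarrow> complex) \<Rightarrow> bool" where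
  "quasiconformal_on k S F \<longleftrightarrow>
     0 \<le> k \<and> k < 1 \<and> open S \<and> connected S \<and> S \<noteq> {} \<and>
     (\<exists>F'. homeomorphism S (F ` S) F F') \<and> sense_preserving_on S F \<and>
     ACL_on S F \<and>
     (AE z\<in>S in lebesgue. has_partials_at F z \<and>
        norm (partial_zbar F z) \<le> k * norm (partial_z F z))"

definition has_quasiconformal_extension :: "real \<Rightarrow> (complex \<Rightarrow> complex) \<Rightarrow> bool" where
  "has_quasiconformal_extension k G \<longleftrightarrow>
     (\<exists>F. quasiconformal_on k UNIV F \<and> (\<forall>z\<in>\<U>. F z = G z))"

end

theory Submission
  imports Defs "HOL-Real_Asymp.Real_Asymp"
begin

text \<open>
  Put \<open>\<mu> = m / a\<close>, let \<open>z \<phi>(z)\<^sup>1\<^sup>/\<^sup>\<alpha>\<close> be the function \<open>G\<^sub>\<alpha>\<close>, and let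
  \<open>\<Psi>(w) = -(a/c) (g(w)/w)\<^sup>\<alpha>\<^sup>-\<^sup>1 f'(w) h(w)\<close>. The proof studies the family
  \<open>A(w,t) = \<phi>(w) + (exp(\<mu>t) - 1) \<Psi>(w)\<close> and \<open>V(w,t) = w A(w,t)\<^sup>1\<^sup>/\<^sup>\<alpha>\<close> on the wedge \<open>t \<ge> 0\<close>,
  \<open>|w| \<le> exp(-t)\<close>. At time 0 this is \<open>G\<^sub>\<alpha>\<close>; in the variable \<open>exp(t) w\<close> it is a Loewner chain. The
  extension is the function \<open>F\<close> which equals \<open>G\<^sub>\<alpha>\<close> on the disc and \<open>V(1/cnj z, log |z|)\<close> outside.

  With \<open>B = (\<alpha>\<phi> + w\<phi>')/\<Psi>\<close> and \<open>Q = (\<alpha>\<Psi> + w\<Psi>')/\<Psi>\<close>, the function \<open>B\<close> is \<open>-c\<alpha>/(a h)\<close> and \<open>Q\<close> is the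
  bracket in the third inequality. That inequality, and the second one for \<open>t = 0\<close>, put
  \<open>D = exp(-\<mu>t) B + (1 - exp(-\<mu>t)) Q\<close> into the disc about \<open>\<mu>/2\<close> of radius \<open>k\<mu>/2\<close> when \<open>|w| = exp(-t)\<close>, and by the maximum principle also
  when \<open>|w| < exp(-t)\<close>. The chain satisfies \<open>V\<^sub>t = q w V\<^sub>w\<close> with \<open>q = \<mu>/D\<close>, and at a point outside the
  unit circle the complex dilatation of \<open>F\<close> has modulus \<open>|1 - 2/q| = |1 - 2D/\<mu>| \<le> k\<close>. So \<open>F\<close> is
  \<open>k\<close>-quasiconformal once it is known to be a homeomorphism which is absolutely continuous on
  lines, and \<open>k \<le> K < 1\<close>.

  Everything topological comes from one transport principle (\<open>transport\<close>): along \<open>w' = -q w\<close> the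
  value of \<open>V\<close> is constant, and since \<open>Re q > 1\<close> the point \<open>w\<close> shrinks faster than the wedge, so a
  value taken at some time is taken at all later times, at a point that has moved by at most a
  constant times the elapsed time. A zero of \<open>A\<close> would survive to times at which \<open>A\<close> is visibly
  nonzero (\<open>A_nz\<close>), so the root in \<open>V\<close> makes sense. Since \<open>V(\<cdot>,t)\<close> is injective for large \<open>t\<close>,
  transporting two points with equal values a little forward carries injectivity back to all
  \<open>t > 0\<close> (\<open>V_injective\<close>). The same argument with arbitrarily short transport times gives
  injectivity of \<open>F\<close> on the whole plane, unit circle included (\<open>V_boundary_injective\<close>).

  At the unit circle the inequalities give \<open>(1 - |w|\<^sup>\<mu>) |Q| \<le> k\<mu> + O(1 - |w|)\<close>, hence
  \<open>|\<Psi>| = O((1 - |w|)\<^sup>-\<^sup>k)\<close>. As \<open>k < 1\<close> this is integrable along radii. Therefore \<open>\<phi>\<close> extends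
  continuously to the closed disc, \<open>F\<close> is continuous, and on bounded sets the derivative of \<open>F\<close> is dominated
  by a multiple of \<open>||z| - 1|\<^sup>-\<^sup>k\<close>, which is locally integrable on every horizontal and vertical line that is not tangent to the
  circle. This yields absolute continuity on lines. Finally \<open>F\<close> preserves the orientation because
  any circle can be moved, through the injective map \<open>F\<close>, to a small circle about 0.
\<close>

section \<open>Transporting values along a flow\<close>

text \<open>
  If \<open>H(x,t)\<close> has the differential \<open>a (dx + q dt)\<close> at a point, the level set through that point
  leaves it in the direction \<open>x' = -q\<close>. Differentiability at the single point suffices: for small
  \<open>h\<close> the Newton map \<open>y \<mapsto> y - (H(y,t+h) - H(x,t))/a\<close> sends the disc of radius \<open>\<epsilon>h\<close> about \<open>x - hq\<close>
  into itself, and Brouwer's theorem gives a fixed point, which lies on the level set.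
\<close>

lemma transport_step:
  fixes H :: "complex \<times> real \<Rightarrow> complex"
  assumes der: "(H has_derivative (\<lambda>(y, s). a * (y + of_real s * q))) (at (x, t) within X)"
    and cont: "continuous_on X H" and a: "a \<noteq> 0" and e: "0 < \<epsilon>" and d: "0 < \<delta>"
    and sub: "\<And>h. \<lbrakk>0 < h; h < \<delta>\<rbrakk> \<Longrightarrow> cball (x - of_real h * q) (\<epsilon> * h) \<times> {t + h} \<subseteq> X"
  obtains h y where "0 < h" "h < \<delta>" "(y, t + h) \<in> X" "H (y, t + h) = H (x, t)"
proof -
  \<comment> \<open>A step of length \<open>h\<close> moves the pair \<open>(x, t)\<close> by at most \<open>h B\<close>, and \<open>\<eta>\<close> makes the linearisation error at most \<open>norm a * (\<epsilon> * h)\<close>.\<close>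
  define B where "B = \<epsilon> + norm q + 1"
  have B: "B > 0" using e by (simp add: B_def add_pos_nonneg)
  define \<eta> where "\<eta> = norm a * \<epsilon> / B"
  have \<eta>: "\<eta> > 0" using a e B by (simp add: \<eta>_def)
  from der \<eta> obtain r where r: "r > 0"
    and rb: "\<And>p. \<lbrakk>p \<in> X; norm (p - (x, t)) < r\<rbrakk> \<Longrightarrow>
        norm (H p - H (x, t) - (case p - (x, t) of (y, s) \<Rightarrow> a * (y + of_real s * q)))
          \<le> \<eta> * norm (p - (x, t))"
    unfolding has_derivative_within_alt by blast
  define h where "h = min (\<delta> / 2) (r / (2 * B))"
  have h: "0 < h" "h < \<delta>" using d r B by (auto simp: h_def min_def)
  have hr: "h * B < r"
  proof -
    have "h * B \<le> r / (2 * B) * B" using B by (intro mult_right_mono) (auto simp: h_def)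
    also have "\<dots> < r" using B r by simp
    finally show ?thesis .
  qed
  define c where "c = x - of_real h * q"
  have inX: "(y, t + h) \<in> X" if "y \<in> cball c (\<epsilon> * h)" for y
    using sub[OF h] that by (auto simp: c_def)
  have est: "norm (H (y, t + h) - H (x, t) - a * (y - c)) \<le> norm a * (\<epsilon> * h)"
    if y: "y \<in> cball c (\<epsilon> * h)" for y
  proof -
    have n: "norm ((y, t + h) - (x, t)) \<le> h * B"
    proof -
      have "norm ((y, t + h) - (x, t)) \<le> norm (y - x) + norm h"
        using norm_Pair_le[of "y - x" h] by simp
      also have "norm (y - x) \<le> norm (y - c) + norm (of_real h * q)"
        using norm_triangle_ineq[of "y - c" "c - x"] by (simp add: c_def norm_minus_commute)
      also have "norm (y - c) \<le> \<epsilon> * h" using y by (simp add: dist_norm norm_minus_commute)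
      finally show ?thesis using h by (simp add: B_def norm_mult algebra_simps)
    qed
    have "norm (H (y, t + h) - H (x, t) - a * (y - c)) \<le> \<eta> * norm ((y, t + h) - (x, t))"
      using rb[OF inX[OF y]] n hr by (simp add: c_def algebra_simps)
    also have "\<dots> \<le> \<eta> * (h * B)" using \<eta> n by (intro mult_left_mono) auto
    also have "\<dots> = norm a * (\<epsilon> * h)" using B by (simp add: \<eta>_def)
    finally show ?thesis .
  qed
  have eh: "\<epsilon> * h > 0" using e h by simp
  define f where "f y = y - (H (y, t + h) - H (x, t)) / a" for y
  have "continuous_on (cball c (\<epsilon> * h)) (H \<circ> (\<lambda>y. (y, t + h)))"
    by (intro continuous_on_compose continuous_intros continuous_on_subset[OF cont])
       (use inX in auto)
  then have "continuous_on (cball c (\<epsilon> * h)) f"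
    unfolding f_def o_def using a by (intro continuous_intros) auto
  moreover have "f \<in> cball c (\<epsilon> * h) \<rightarrow> cball c (\<epsilon> * h)"
  proof
    fix y assume y: "y \<in> cball c (\<epsilon> * h)"
    have "f y - c = - (H (y, t + h) - H (x, t) - a * (y - c)) / a"
      using a by (simp add: f_def field_simps)
    then have "norm (f y - c) = norm (H (y, t + h) - H (x, t) - a * (y - c)) / norm a"
      by (simp only: norm_divide norm_minus_cancel)
    also have "\<dots> \<le> \<epsilon> * h"
      using est[OF y] a by (simp add: field_simps)
    finally show "f y \<in> cball c (\<epsilon> * h)" by (simp add: dist_norm norm_minus_commute)
  qed
  ultimately obtain y where y: "y \<in> cball c (\<epsilon> * h)" "f y = y"
    using brouwer_ball[OF eh] by metis
  then have "H (y, t + h) = H (x, t)" using a by (simp add: f_def)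
  with that[OF h inX[OF y(1)]] show thesis by blast
qed

text \<open>
  The points that a path starting at \<open>x = 0\<close>, \<open>t = t0\<close> can reach when its velocity has real part at most
  \<open>-\<kappa>\<close> and modulus at most \<open>C\<close>.
\<close>

definition transport_region :: "real \<Rightarrow> real \<Rightarrow> real \<Rightarrow> real \<Rightarrow> (complex \<times> real) set" where
  "transport_region \<kappa> C t0 t1 =
     {(x, t). t0 \<le> t \<and> t \<le> t1 \<and> Re x \<le> - \<kappa> * (t - t0) \<and> norm x \<le> C * (t - t0)}"

lemma compact_transport_region:
  assumes "0 \<le> C"
  shows "compact (transport_region \<kappa> C t0 t1)"
proof -
  have sub: "transport_region \<kappa> C t0 t1 \<subseteq> cball 0 (C * (t1 - t0)) \<times> {t0..t1}"
  proof
    fix p assume p: "p \<in> transport_region \<kappa> C t0 t1"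
    obtain x t where pt: "p = (x, t)" by (cases p)
    have "norm x \<le> C * (t - t0)" "t0 \<le> t" "t \<le> t1"
      using p by (auto simp: transport_region_def pt)
    moreover have "C * (t - t0) \<le> C * (t1 - t0)" using assms \<open>t \<le> t1\<close> by (intro mult_left_mono) auto
    ultimately show "p \<in> cball 0 (C * (t1 - t0)) \<times> {t0..t1}" by (auto simp: pt)
  qed
  have "compact (cball (0::complex) (C * (t1 - t0)) \<times> {t0..t1})"
    by (intro compact_Times) auto
  then have bdd: "bounded (transport_region \<kappa> C t0 t1)"
    using bounded_subset[OF compact_imp_bounded sub] by blast
  have eq: "transport_region \<kappa> C t0 t1 =
     {p. t0 \<le> snd p} \<inter> {p. snd p \<le> t1} \<inter> {p. Re (fst p) \<le> - \<kappa> * (snd p - t0)}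
       \<inter> {p. norm (fst p) \<le> C * (snd p - t0)}"
    by (auto simp: transport_region_def)
  have "closed (transport_region \<kappa> C t0 t1)" unfolding eq
    by (intro closed_Int closed_Collect_le continuous_intros)
  with bdd show ?thesis by (simp add: compact_eq_bounded_closed)
qed

text \<open>
  A real induction: the times reached by the level set within the region form a compact set, and
  \<open>transport_step\<close> moves every time before \<open>t1\<close> forward. The strict inequalities \<open>\<kappa> < Re q\<close> and
  \<open>|q| < C\<close> leave room for the error \<open>\<epsilon>h\<close> of a step inside the region. Derivatives are taken within
  the region only, because the functions of interest may start at a boundary point of their domain.
\<close>

lemma transport:
  fixes H :: "complex \<times> real \<Rightarrow> complex"
  assumes cont: "continuous_on (transport_region \<kappa> C t0 t1) H" and C: "0 \<le> C" and t: "t0 \<le> t1"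
    and der: "\<And>x t. \<lbrakk>(x, t) \<in> transport_region \<kappa> C t0 t1; t < t1; H (x, t) = H (0, t0)\<rbrakk> \<Longrightarrow>
       \<exists>a q. a \<noteq> 0 \<and> \<kappa> < Re q \<and> norm q < C \<and>
         (H has_derivative (\<lambda>(y, s). a * (y + of_real s * q))) (at (x, t) within transport_region \<kappa> C t0 t1)"
  shows "\<exists>x. (x, t1) \<in> transport_region \<kappa> C t0 t1 \<and> H (x, t1) = H (0, t0)"
proof -
  let ?X = "transport_region \<kappa> C t0 t1"
  define Y where "Y = {p \<in> ?X. H p = H (0, t0)}"
  have cX: "closed ?X" by (rule compact_imp_closed, rule compact_transport_region, rule C)
  have "closed (?X \<inter> H -` {H (0, t0)})"
    by (rule continuous_closed_preimage, rule cont, rule cX) simp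
  moreover have "Y = ?X \<inter> H -` {H (0, t0)}" by (auto simp: Y_def)
  ultimately have "closed Y" by simp
  then have "compact Y"
    using compact_transport_region[OF C, of \<kappa> t0 t1]
    by (metis (no_types, lifting) Y_def closed_Int_compact Int_absorb2 mem_Collect_eq subsetI)
  then have cJ: "compact (snd ` Y)" by (intro compact_continuous_image continuous_intros)
  have "(0, t0) \<in> Y" using t by (auto simp: Y_def transport_region_def)
  then have ne: "snd ` Y \<noteq> {}" by auto
  obtain t where "t \<in> snd ` Y" and mx': "\<forall>s\<in>snd ` Y. s \<le> t"
    using compact_attains_sup[OF cJ ne] by auto
  then obtain x where xt: "(x, t) \<in> Y" by auto
  have mx: "snd p \<le> t" if "p \<in> Y" for p using mx' that by auto
  have xtX: "(x, t) \<in> ?X" and Hxt: "H (x, t) = H (0, t0)" using xt by (auto simp: Y_def)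
  have "t = t1"
  proof (rule ccontr)
    assume "t \<noteq> t1"
    with xtX have tt: "t < t1" by (auto simp: transport_region_def)
    obtain a q where aq: "a \<noteq> 0" "\<kappa> < Re q" "norm q < C"
      "(H has_derivative (\<lambda>(y, s). a * (y + of_real s * q))) (at (x, t) within ?X)"
      using der[OF xtX tt Hxt] by blast
    define \<epsilon> where "\<epsilon> = min (Re q - \<kappa>) (C - norm q)"
    have e: "\<epsilon> > 0" "\<epsilon> \<le> Re q - \<kappa>" "\<epsilon> \<le> C - norm q" using aq by (auto simp: \<epsilon>_def)
    have xx: "Re x \<le> - \<kappa> * (t - t0)" "norm x \<le> C * (t - t0)"
      using xtX by (auto simp: transport_region_def)
    have sub: "cball (x - of_real h * q) (\<epsilon> * h) \<times> {t + h} \<subseteq> ?X"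
      if h: "0 < h" "h < t1 - t" for h
    proof
      fix p assume "p \<in> cball (x - of_real h * q) (\<epsilon> * h) \<times> {t + h}"
      then obtain y where p: "p = (y, t + h)" and y: "norm (y - (x - of_real h * q)) \<le> \<epsilon> * h"
        by (auto simp: dist_norm norm_minus_commute)
      have "Re (y - (x - of_real h * q)) \<le> \<epsilon> * h" using y complex_Re_le_cmod order_trans by blast
      then have "Re y \<le> Re x - h * Re q + \<epsilon> * h" by simp
      also have "\<dots> \<le> - \<kappa> * (t - t0) - h * Re q + (Re q - \<kappa>) * h"
        using xx mult_right_mono[OF e(2), of h] h by linarith
      finally have 1: "Re y \<le> - \<kappa> * (t + h - t0)" by (simp add: algebra_simps)
      have "norm y \<le> norm (y - (x - of_real h * q)) + norm (x - of_real h * q)"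
        using norm_triangle_sub[of y "x - of_real h * q"] by (simp add: add.commute)
      also have "norm (x - of_real h * q) \<le> norm x + norm (of_real h * q)"
        by (rule norm_triangle_ineq4)
      also have "norm (of_real h * q) = h * norm q" using h by (simp add: norm_mult)
      finally have "norm y \<le> \<epsilon> * h + (norm x + h * norm q)" using y by linarith
      also have "\<dots> \<le> (C - norm q) * h + (C * (t - t0) + h * norm q)"
        using xx mult_right_mono[OF e(3), of h] h by linarith
      finally have 2: "norm y \<le> C * (t + h - t0)" by (simp add: algebra_simps)
      show "p \<in> ?X" using 1 2 h xtX by (auto simp: p transport_region_def)
    qed
    obtain h y where hy: "0 < h" "h < t1 - t" "(y, t + h) \<in> ?X" "H (y, t + h) = H (x, t)"
      using transport_step[OF aq(4) cont aq(1) e(1) _ sub, of "t1 - t"] tt by auto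
    then have "(y, t + h) \<in> Y" using Hxt by (simp add: Y_def)
    from mx[OF this] hy(1) show False by simp
  qed
  with xtX Hxt show ?thesis by blast
qed

text \<open>
  Near \<open>p\<close> a continuous logarithm differs from a constant by the principal logarithm, so it inherits
  differentiability from its exponential.
\<close>

lemma has_derivative_of_exp:
  fixes u :: "'a::real_normed_vector \<Rightarrow> complex"
  assumes cont: "continuous (at p within S) u" and p: "p \<in> S"
    and der: "((\<lambda>x. exp (u x)) has_derivative d) (at p within S)"
  shows "(u has_derivative (\<lambda>y. d y / exp (u p))) (at p within S)"
proof -
  have "((\<lambda>x. exp (u x) / exp (u p)) has_derivative (\<lambda>y. d y / exp (u p))) (at p within S)"
    using has_derivative_mult_left[OF der, of "inverse (exp (u p))"] by (simp add: field_simps)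
  moreover have "(Ln has_derivative (*) 1) (at (exp (u p) / exp (u p)))"
    using has_field_derivative_imp_has_derivative[OF has_field_derivative_Ln[of 1]] by simp
  ultimately have "((\<lambda>x. Ln (exp (u x) / exp (u p))) has_derivative (\<lambda>y. 1 * (d y / exp (u p)))) (at p within S)"
    by (rule has_derivative_compose)
  then have L: "((\<lambda>x. u p + Ln (exp (u x) / exp (u p))) has_derivative (\<lambda>y. d y / exp (u p))) (at p within S)"
    using has_derivative_add[OF has_derivative_const[of "u p"]] by fastforce
  have "((\<lambda>x. norm (u x - u p)) \<longlongrightarrow> 0) (at p within S)"
    using cont by (simp add: continuous_within tendsto_norm_zero_iff LIM_zero_iff)
  then have "\<forall>\<^sub>F x in at p within S. norm (u x - u p) < pi"
    by (rule order_tendstoD) simp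
  then have "\<forall>\<^sub>F x in at p within S. u p + Ln (exp (u x) / exp (u p)) = u x"
  proof eventually_elim
    case (elim x)
    then have "\<bar>Im (u x - u p)\<bar> < pi" using abs_Im_le_cmod[of "u x - u p"] by linarith
    then have "Ln (exp (u x - u p)) = u x - u p" by (intro Ln_exp) (auto simp: abs_less_iff)
    then show ?case by (simp add: exp_diff)
  qed
  from has_derivative_transform_eventually[OF L this] p show ?thesis by simp
qed

section \<open>The Loewner family of a pair of functions\<close>

text \<open>
  The disc of radius \<open>k\<close> about 1 is mapped by inversion to the disc whose diameter is
  \<open>[1/(1+k), 1/(1-k)]\<close>; it is applied to \<open>X = 2D/\<mu>\<close>, where \<open>q = 2/X\<close>.
\<close>

lemma inverse_near_one:
  fixes X :: complex
  assumes "norm (X - 1) \<le> k" "0 \<le> k" "k < 1"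
  shows "X \<noteq> 0" "1 / (1 + k) \<le> Re (1 / X)" "norm (1 / X) \<le> 1 / (1 - k)"
proof -
  have lo: "1 - k \<le> norm X"
    using norm_triangle_ineq2[of 1 "1 - X"] assms by (simp add: norm_minus_commute)
  have hi: "norm X \<le> 1 + k"
    using norm_triangle_ineq[of "X - 1" 1] assms by simp
  show X: "X \<noteq> 0" using lo assms by auto
  show "norm (1 / X) \<le> 1 / (1 - k)"
    using lo assms X by (simp add: norm_divide frac_le)
  define n where "n = (norm X)^2"
  have n: "n > 0" using X by (simp add: n_def)
  have "(norm (X - 1))^2 \<le> k^2" using assms by (intro power_mono) auto
  then have re: "n + 1 - k^2 \<le> 2 * Re X"
    unfolding n_def cmod_power2 by (simp add: power2_eq_square algebra_simps)
  have "n \<le> (1 + k)^2" using hi assms unfolding n_def by (intro power_mono) auto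
  then have "(1 - k) * n \<le> (1 - k) * (1 + k)^2" using assms by (intro mult_left_mono) auto
  then have "2 * n \<le> (1 + k) * (n + 1 - k^2)" by (simp add: power2_eq_square algebra_simps)
  also have "\<dots> \<le> (1 + k) * (2 * Re X)" using re assms by (intro mult_left_mono) auto
  finally have "n \<le> (1 + k) * Re X" by simp
  then have "1 / (1 + k) \<le> Re X / n" using n assms by (simp add: field_simps)
  also have "Re X / n = Re (1 / X)" by (simp add: n_def cmod_power2 Re_divide)
  finally show "1 / (1 + k) \<le> Re (1 / X)" .
qed

lemma bounded_on_smaller_disc:
  assumes "f holomorphic_on \<U>" "r < 1"
  obtains M where "0 < M" "\<And>w. norm w \<le> r \<Longrightarrow> norm (f w) \<le> M"
proof -
  have "cball 0 r \<subseteq> \<U>" using assms by auto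
  then have "compact (f ` cball 0 r)"
    using assms by (intro compact_continuous_image continuous_on_subset[OF holomorphic_on_imp_continuous_on]) auto
  then obtain M where "\<forall>y\<in>f ` cball 0 r. norm y \<le> M" using compact_imp_bounded bounded_iff by blast
  then show thesis by (intro that[of "max M 1"]) (auto intro: order_trans[OF _ max.cobounded1])
qed

text \<open>
  The numerator is \<open>w\<^sup>1\<^sup>-\<^sup>\<alpha>\<close> times the derivative of \<open>w\<^sup>\<alpha> u(w)\<close>; in this form no branch of the power is
  involved.
\<close>

definition euler_quot :: "complex \<Rightarrow> (complex \<Rightarrow> complex) \<Rightarrow> (complex \<Rightarrow> complex) \<Rightarrow> complex \<Rightarrow> complex" where
  "euler_quot \<alpha> u v w = (\<alpha> * u w + w * deriv u w) / v w"

text \<open>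
  The hypotheses of the theorem in terms of \<open>\<phi>\<close> and \<open>\<Psi>\<close>.
\<close>

locale loewner_pair =
  fixes \<alpha> :: complex and \<mu> k :: real and \<phi> \<Psi> :: "complex \<Rightarrow> complex"
  assumes mu: "0 < \<mu>" and k: "0 \<le> k" "k < 1"
    and hol_phi: "\<phi> holomorphic_on \<U>" and hol_Psi: "\<Psi> holomorphic_on \<U>"
    and Psi_nz: "\<And>w. norm w < 1 \<Longrightarrow> \<Psi> w \<noteq> 0"
    and phi_0: "\<phi> 0 = 1"
    and B_bound: "\<And>w. norm w < 1 \<Longrightarrow> norm (euler_quot \<alpha> \<phi> \<Psi> w - of_real (\<mu> / 2)) \<le> k * (\<mu> / 2)"
    and Q_bound: "\<And>w. norm w < 1 \<Longrightarrow>
      norm (of_real (norm w powr \<mu>) * euler_quot \<alpha> \<phi> \<Psi> w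
            + (1 - of_real (norm w powr \<mu>)) * euler_quot \<alpha> \<Psi> \<Psi> w - of_real (\<mu> / 2)) \<le> k * (\<mu> / 2)"
begin

definition B :: "complex \<Rightarrow> complex" where "B = euler_quot \<alpha> \<phi> \<Psi>"
definition Q :: "complex \<Rightarrow> complex" where "Q = euler_quot \<alpha> \<Psi> \<Psi>"
definition D :: "real \<Rightarrow> complex \<Rightarrow> complex" where
  "D t w = of_real (exp (- \<mu> * t)) * B w + (1 - of_real (exp (- \<mu> * t))) * Q w"
definition q :: "real \<Rightarrow> complex \<Rightarrow> complex" where "q t w = of_real \<mu> / D t w"
definition A :: "complex \<Rightarrow> real \<Rightarrow> complex" where
  "A w t = \<phi> w + (of_real (exp (\<mu> * t)) - 1) * \<Psi> w"
definition A_w :: "complex \<Rightarrow> real \<Rightarrow> complex" where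
  "A_w w t = deriv \<phi> w + (of_real (exp (\<mu> * t)) - 1) * deriv \<Psi> w"

text \<open>
  The rate \<open>\<kappa>\<close> is the midpoint of 1, at which the wedge shrinks, and \<open>2/(1+k)\<close>, the least possible
  real part of \<open>q\<close>. The speed \<open>C\<close> exceeds the largest possible modulus \<open>2/(1-k)\<close> of \<open>q\<close>.
\<close>

definition \<kappa> :: real where "\<kappa> = (3 + k) / (2 * (1 + k))"
definition C :: real where "C = 2 / (1 - k) + 1"

lemma kappa_gt_1: "1 < \<kappa>" and kappa_less: "\<kappa> < 2 / (1 + k)"
proof -
  show "1 < \<kappa>" using k by (simp add: \<kappa>_def)
  have "(3 + k) / (2 * (1 + k)) < 4 / (2 * (1 + k))"
    using k by (intro divide_strict_right_mono) auto
  also have "\<dots> = 2 / (1 + k)" using k by (simp add: field_simps)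
  finally show "\<kappa> < 2 / (1 + k)" by (simp only: \<kappa>_def)
qed

lemma C_pos: "0 < C" using k by (simp add: C_def add_pos_pos)

lemma phi_deriv: "norm w < 1 \<Longrightarrow> (\<phi> has_field_derivative deriv \<phi> w) (at w)"
  using holomorphic_derivI[OF hol_phi open_ball] by simp

lemma Psi_deriv: "norm w < 1 \<Longrightarrow> (\<Psi> has_field_derivative deriv \<Psi> w) (at w)"
  using holomorphic_derivI[OF hol_Psi open_ball] by simp

lemma hol_B: "B holomorphic_on \<U>" and hol_Q: "Q holomorphic_on \<U>"
  unfolding B_def Q_def euler_quot_def
  by (auto intro!: holomorphic_intros hol_phi hol_Psi holomorphic_deriv simp: Psi_nz)

lemma Re_alpha: "0 < Re \<alpha>"
proof -
  have *: "norm (\<alpha> - of_real (\<mu> / 2)) \<le> k * (\<mu> / 2)"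
    using Q_bound[of 0] Psi_nz[of 0] by (simp add: euler_quot_def)
  have "\<mu> / 2 - Re \<alpha> \<le> norm (\<alpha> - of_real (\<mu> / 2))"
    using complex_Re_le_cmod[of "of_real (\<mu> / 2) - \<alpha>"] by (simp add: norm_minus_commute)
  also have "\<dots> \<le> k * (\<mu> / 2)" by (rule *)
  also have "\<dots> < \<mu> / 2" using mu k by simp
  finally show "0 < Re \<alpha>" by simp
qed

text \<open>
  On the circle \<open>|w| = exp(-t)\<close> the factor \<open>exp(-\<mu>t)\<close> is \<open>|w|\<^sup>\<mu>\<close>, so the bound is the hypothesis
  \<open>Q_bound\<close> there. For fixed \<open>t > 0\<close> the function \<open>D t\<close> is holomorphic on the closed disc of that
  radius and the maximum principle applies. At \<open>t = 0\<close> only the hypothesis \<open>B_bound\<close> is left.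
\<close>

lemma D_bound:
  assumes "0 \<le> t" "norm w \<le> exp (- t)" "norm w < 1"
  shows "norm (D t w - of_real (\<mu> / 2)) \<le> k * (\<mu> / 2)"
proof (cases "t = 0")
  case True
  then show ?thesis using B_bound[OF assms(3)] by (simp add: D_def B_def)
next
  case False
  with assms have t: "t > 0" by simp
  have lt: "exp (- t) < 1" using t by simp
  have sub: "cball 0 (exp (- t)) \<subseteq> \<U>"
    by (rule subsetI) (simp add: le_less_trans[OF _ lt])
  have hol: "(\<lambda>w. D t w - of_real (\<mu> / 2)) holomorphic_on \<U>"
    unfolding D_def by (intro holomorphic_intros hol_B hol_Q)
  show ?thesis
  proof (rule maximum_modulus_frontier[of "\<lambda>w. D t w - of_real (\<mu> / 2)" "cball 0 (exp (- t))"])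
    show "(\<lambda>w. D t w - of_real (\<mu> / 2)) holomorphic_on interior (cball 0 (exp (- t)))"
      using holomorphic_on_subset[OF hol] sub interior_subset by blast
    show "continuous_on (closure (cball 0 (exp (- t)))) (\<lambda>w. D t w - of_real (\<mu> / 2))"
      using continuous_on_subset[OF holomorphic_on_imp_continuous_on[OF hol]] sub by simp
  next
    fix z assume "z \<in> frontier (cball (0::complex) (exp (- t)))"
    then have z: "norm z = exp (- t)" by (simp add: frontier_cball)
    then have "norm z powr \<mu> = exp (- \<mu> * t)" by (simp add: powr_def)
    then show "norm (D t z - of_real (\<mu> / 2)) \<le> k * (\<mu> / 2)"
      using Q_bound[of z] z lt by (simp add: D_def B_def Q_def)
  qed (use assms in auto)
qed

lemma D_normalised:
  assumes "0 \<le> t" "norm w \<le> exp (- t)" "norm w < 1"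
  shows "norm (2 * D t w / of_real \<mu> - 1) \<le> k"
proof -
  have "2 * D t w / of_real \<mu> - 1 = (D t w - of_real (\<mu> / 2)) * of_real (2 / \<mu>)"
    using mu by (simp add: field_simps)
  then have "norm (2 * D t w / of_real \<mu> - 1) = norm (D t w - of_real (\<mu> / 2)) * (2 / \<mu>)"
    using mu by (simp only: norm_mult norm_of_real) simp
  also have "\<dots> \<le> k * (\<mu> / 2) * (2 / \<mu>)"
    using D_bound[OF assms] mu by (intro mult_right_mono) auto
  finally show ?thesis using mu by simp
qed

lemma
  assumes "0 \<le> t" "norm w \<le> exp (- t)" "norm w < 1"
  shows D_nz: "D t w \<noteq> 0" and Re_q: "\<kappa> < Re (q t w)" and norm_q: "norm (q t w) < C"
proof -
  note * = inverse_near_one[OF D_normalised[OF assms] k]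
  show D: "D t w \<noteq> 0" using *(1) by auto
  define Y where "Y = 1 / (2 * D t w / of_real \<mu>)"
  have q: "q t w = 2 * Y" using D by (simp add: q_def Y_def)
  note * = *[folded Y_def]
  have "2 / (1 + k) \<le> Re (q t w)"
    using *(2) by (simp add: q)
  then show "\<kappa> < Re (q t w)" using kappa_less by simp
  have "norm (q t w) \<le> 2 / (1 - k)"
    using *(3) by (simp add: q norm_mult)
  then show "norm (q t w) < C" by (simp add: C_def)
qed

text \<open>
  This identity turns the affine dependence of \<open>A\<close> on \<open>exp(\<mu>t)\<close> into the Loewner equation: the time
  derivative of \<open>A\<close> is \<open>\<mu> exp(\<mu>t) \<Psi>\<close>, that is, \<open>q\<close> times the right-hand side below.
\<close>

lemma A_euler:
  assumes "norm w < 1"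
  shows "\<alpha> * A w t + w * A_w w t = of_real (exp (\<mu> * t)) * \<Psi> w * D t w"
proof -
  have e: "complex_of_real (exp (\<mu> * t)) * of_real (exp (- \<mu> * t)) = 1"
    by (simp flip: of_real_mult exp_add)
  have B: "B w * \<Psi> w = \<alpha> * \<phi> w + w * deriv \<phi> w" and Q: "Q w * \<Psi> w = \<alpha> * \<Psi> w + w * deriv \<Psi> w"
    using Psi_nz[OF assms] by (auto simp: B_def Q_def euler_quot_def)
  define E F where "E = complex_of_real (exp (\<mu> * t))" and "F = complex_of_real (exp (- \<mu> * t))"
  have "E * \<Psi> w * D t w = (E * F) * (B w * \<Psi> w) + (E - E * F) * (Q w * \<Psi> w)"
    by (simp add: D_def E_def F_def algebra_simps)
  also have "E * F = 1" using e by (simp only: E_def F_def)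
  also have "1 * (B w * \<Psi> w) + (E - 1) * (Q w * \<Psi> w) = \<alpha> * A w t + w * A_w w t"
    by (simp only: B Q) (simp add: A_def A_w_def algebra_simps flip: E_def)
  finally show ?thesis by (simp add: E_def)
qed

definition region :: "real \<Rightarrow> real \<Rightarrow> (complex \<times> real) set" where
  "region t0 t1 = transport_region \<kappa> C t0 t1"

lemma region_norm:
  assumes "(x, t) \<in> region t0 t1"
  shows "norm (w * exp x) \<le> norm w * exp (- \<kappa> * (t - t0))"
  using assms by (auto simp: region_def transport_region_def norm_mult intro!: mult_left_mono)

text \<open>
  In the logarithmic coordinate \<open>w exp(x)\<close> the transport region shrinks \<open>|w|\<close> at a rate \<open>\<kappa> > 1\<close>, hence
  keeps points in the wedge and moves boundary points strictly inside.
\<close>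

lemma region_norm_fibre:
  assumes "(x, t) \<in> region t0 t1" "0 \<le> t0" "norm w \<le> exp (- t0)"
  shows "t0 \<le> t" "t \<le> t1" "0 \<le> t" "norm (w * exp x) \<le> exp (- t)" "norm (w * exp x) \<le> norm w"
    "norm w < 1 \<Longrightarrow> norm (w * exp x) < 1"
    "t0 < t \<Longrightarrow> norm (w * exp x) < exp (- t)"
proof -
  show t: "t0 \<le> t" "t \<le> t1" "0 \<le> t" using assms by (auto simp: region_def transport_region_def)
  have "1 * (t - t0) \<le> \<kappa> * (t - t0)" using kappa_gt_1 t by (intro mult_right_mono) auto
  then have 1: "exp (- \<kappa> * (t - t0)) \<le> exp (- (t - t0))" by simp
  have 2: "exp (- (t - t0)) \<le> 1" using t by simp
  have "norm (w * exp x) \<le> exp (- t0) * exp (- \<kappa> * (t - t0))"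
    using region_norm[OF assms(1), of w] assms(3) by (meson exp_ge_zero mult_right_mono order_trans)
  also have "\<dots> \<le> exp (- t0) * exp (- (t - t0))" using 1 by simp
  also have "\<dots> = exp (- t)" by (simp flip: exp_add)
  finally show "norm (w * exp x) \<le> exp (- t)" .
  show n: "norm (w * exp x) \<le> norm w"
    using region_norm[OF assms(1), of w] 1 2 mult_left_le[of "exp (- \<kappa> * (t - t0))" "norm w"] by simp
  then show "norm w < 1 \<Longrightarrow> norm (w * exp x) < 1" by simp
  assume "t0 < t"
  then have "1 * (t - t0) < \<kappa> * (t - t0)" using kappa_gt_1 by (intro mult_strict_right_mono) auto
  then have 1: "exp (- \<kappa> * (t - t0)) < exp (- (t - t0))" by simp
  have "norm (w * exp x) \<le> exp (- t0) * exp (- \<kappa> * (t - t0))"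
    using region_norm[OF assms(1), of w] assms(3) by (meson exp_ge_zero mult_right_mono order_trans)
  also have "\<dots> < exp (- t0) * exp (- (t - t0))" using 1 by simp
  also have "\<dots> = exp (- t)" by (simp flip: exp_add)
  finally show "norm (w * exp x) < exp (- t)" .
qed

lemma A_derivative:
  assumes w1: "norm (w p) < 1" and w: "(w has_derivative w') (at p within X)"
    and \<tau>: "(\<tau> has_derivative \<tau>') (at p within X)"
  shows "((\<lambda>x. A (w x) (\<tau> x)) has_derivative
     (\<lambda>h. A_w (w p) (\<tau> p) * w' h + of_real (\<mu> * exp (\<mu> * \<tau> p) * \<tau>' h) * \<Psi> (w p))) (at p within X)"
proof -
  have 1: "((\<lambda>x. \<phi> (w x)) has_derivative (\<lambda>h. deriv \<phi> (w p) * w' h)) (at p within X)"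
    using has_derivative_compose[OF w, of \<phi> "(*) (deriv \<phi> (w p))"] phi_deriv[OF w1]
    by (simp add: has_field_derivative_def)
  have 2: "((\<lambda>x. \<Psi> (w x)) has_derivative (\<lambda>h. deriv \<Psi> (w p) * w' h)) (at p within X)"
    using has_derivative_compose[OF w, of \<Psi> "(*) (deriv \<Psi> (w p))"] Psi_deriv[OF w1]
    by (simp add: has_field_derivative_def)
  have 3: "((\<lambda>x. complex_of_real (exp (\<mu> * \<tau> x))) has_derivative
      (\<lambda>h. of_real (\<mu> * exp (\<mu> * \<tau> p) * \<tau>' h))) (at p within X)"
    by (auto intro!: derivative_eq_intros \<tau> simp: algebra_simps)
  show ?thesis
    using has_derivative_add[OF 1 has_derivative_mult[OF has_derivative_diff[OF 3 has_derivative_const[of 1]] 2]]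
    by (simp add: A_def A_w_def algebra_simps)
qed

text \<open>
  The function \<open>A(w0 exp(x), t) exp(\<alpha>x)\<close> is a constant multiple of \<open>w\<^sup>\<alpha> A(w,t)\<close> along a path, with the
  branch of the power built into the coordinate \<open>x\<close>. Its differential has the form required by
  \<open>transport\<close>, with velocity \<open>q\<close>.
\<close>

lemma transported_A_derivative:
  assumes w: "norm (w0 * exp x) < 1"
  shows "((\<lambda>p. A (w0 * exp (fst p)) (snd p) * exp (\<alpha> * fst p)) has_derivative
     (\<lambda>(y, s). (exp (\<alpha> * x) * of_real (exp (\<mu> * t)) * \<Psi> (w0 * exp x)) *
        (D t (w0 * exp x) * y + of_real s * of_real \<mu>))) (at (x, t) within X)"
proof -
  define w where "w = w0 * exp x"
  have fst: "(fst has_derivative fst) (at (x, t) within X)" and snd: "(snd has_derivative snd) (at (x, t) within X)"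
    using has_derivative_fst[OF has_derivative_ident[of "at (x, t) within X"]]
      has_derivative_snd[OF has_derivative_ident[of "at (x, t) within X"]] by simp_all
  have 1: "((\<lambda>p. w0 * exp (fst p)) has_derivative (\<lambda>p. w * fst p)) (at (x, t) within X)"
    unfolding w_def
    using has_derivative_mult_right[OF has_derivative_compose[OF fst
      has_field_derivative_imp_has_derivative[OF DERIV_exp]], of w0]
    by (simp add: mult.assoc)
  have 2: "((\<lambda>p. exp (\<alpha> * fst p)) has_derivative (\<lambda>p. exp (\<alpha> * x) * (\<alpha> * fst p))) (at (x, t) within X)"
    using has_derivative_compose[OF has_derivative_mult_right[OF fst, of \<alpha>]
      has_field_derivative_imp_has_derivative[OF DERIV_exp]]
    by simp
  have 3: "((\<lambda>p. A (w0 * exp (fst p)) (snd p)) has_derivative (\<lambda>p. A_w w t * (w * fst p) +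
       of_real (\<mu> * exp (\<mu> * t) * snd p) * \<Psi> w)) (at (x, t) within X)"
    using A_derivative[OF _ 1 snd] w by (simp add: w_def)
  have "((\<lambda>p. A (w0 * exp (fst p)) (snd p) * exp (\<alpha> * fst p)) has_derivative
     (\<lambda>p. A w t * (exp (\<alpha> * x) * (\<alpha> * fst p)) + (A_w w t * (w * fst p) +
       of_real (\<mu> * exp (\<mu> * t) * snd p) * \<Psi> w) * exp (\<alpha> * x)))
     (at (x, t) within X)"
    using has_derivative_mult[OF 3 2] by (simp add: w_def)
  moreover have "A w t * (exp (\<alpha> * x) * (\<alpha> * y)) + (A_w w t * (w * y) +
       of_real (\<mu> * exp (\<mu> * t) * s) * \<Psi> w) * exp (\<alpha> * x)
     = (exp (\<alpha> * x) * of_real (exp (\<mu> * t)) * \<Psi> w) * (D t w * y + of_real s * of_real \<mu>)" for y s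
  proof -
    have "A w t * (exp (\<alpha> * x) * (\<alpha> * y)) + (A_w w t * (w * y) +
       of_real (\<mu> * exp (\<mu> * t) * s) * \<Psi> w) * exp (\<alpha> * x)
     = exp (\<alpha> * x) * ((\<alpha> * A w t + w * A_w w t) * y
        + of_real (exp (\<mu> * t)) * \<Psi> w * of_real s * of_real \<mu>)"
      by (simp add: algebra_simps)
    also have "\<dots> = (exp (\<alpha> * x) * of_real (exp (\<mu> * t)) * \<Psi> w) * (D t w * y + of_real s * of_real \<mu>)"
      using A_euler[of w t] w by (simp add: w_def algebra_simps)
    finally show ?thesis .
  qed
  ultimately show ?thesis by (simp add: w_def case_prod_unfold)
qed

lemma continuous_on_A:
  "continuous_on {p. norm (fst p) < 1} (\<lambda>p. A (fst p) (snd p))"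
  unfolding A_def
  by (intro continuous_intros continuous_on_compose2[OF holomorphic_on_imp_continuous_on[OF hol_phi]]
       continuous_on_compose2[OF holomorphic_on_imp_continuous_on[OF hol_Psi]]) auto

lemma transport_A:
  assumes w0: "norm w0 < 1" "norm w0 \<le> exp (- t0)" and t: "0 \<le> t0" "t0 \<le> t1"
  obtains x where "(x, t1) \<in> region t0 t1" "A (w0 * exp x) t1 * exp (\<alpha> * x) = A w0 t0"
proof -
  let ?H = "\<lambda>p. A (w0 * exp (fst p)) (snd p) * exp (\<alpha> * fst p)"
  have "\<exists>x. (x, t1) \<in> transport_region \<kappa> C t0 t1 \<and> ?H (x, t1) = ?H (0, t0)"
  proof (rule transport)
    show "continuous_on (transport_region \<kappa> C t0 t1) ?H"
      by (intro continuous_intros continuous_on_compose2[OF continuous_on_A,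
            of _ "\<lambda>p. (w0 * exp (fst p), snd p)", simplified])
         (use region_norm_fibre[OF _ t(1) w0(2)] w0 in \<open>auto simp: region_def\<close>)
    fix x t assume xt: "(x, t) \<in> transport_region \<kappa> C t0 t1"
    note r = region_norm_fibre[OF xt[folded region_def] t(1) w0(2)]
    have n: "norm (w0 * exp x) < 1" using r w0 by blast
    note f = r(3,4) n
    let ?a = "exp (\<alpha> * x) * of_real (exp (\<mu> * t)) * \<Psi> (w0 * exp x) * D t (w0 * exp x)"
    have a: "?a \<noteq> 0" using Psi_nz[OF n] D_nz[OF f] by simp
    have "(?H has_derivative (\<lambda>(y, s). ?a * (y + of_real s * q t (w0 * exp x)))) (at (x, t) within transport_region \<kappa> C t0 t1)"
      using transported_A_derivative[OF n, of t "transport_region \<kappa> C t0 t1"] D_nz[OF f]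
      by (simp add: q_def algebra_simps)
    with a Re_q[OF f] norm_q[OF f] show "\<exists>a q. a \<noteq> 0 \<and> \<kappa> < Re q \<and> norm q < C \<and>
         (?H has_derivative (\<lambda>(y, s). a * (y + of_real s * q))) (at (x, t) within transport_region \<kappa> C t0 t1)"
      by blast
  qed (use C_pos t in auto)
  with that show thesis by (auto simp: region_def)
qed

text \<open>
  Late in time the wedge lies over a small disc, so bounds on the fixed disc of radius 1/2 decide how
  \<open>A\<close> behaves for large \<open>t\<close>.
\<close>

lemma half_disc_bounds:
  obtains c M where "0 < c" "0 < M"
    "\<And>w. norm w \<le> 1/2 \<Longrightarrow> c \<le> norm (\<Psi> w) \<and> norm (\<phi> w) \<le> M \<and> norm (deriv \<phi> w) \<le> M \<and> norm (deriv \<Psi> w) \<le> M"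
proof -
  have sub: "cball 0 (1/2) \<subseteq> \<U>" by auto
  obtain M1 where M1: "0 < M1" "\<And>w. norm w \<le> 1/2 \<Longrightarrow> norm (\<phi> w) \<le> M1"
    using bounded_on_smaller_disc[OF hol_phi, of "1/2"] by auto
  obtain M2 where M2: "0 < M2" "\<And>w. norm w \<le> 1/2 \<Longrightarrow> norm (deriv \<phi> w) \<le> M2"
    using bounded_on_smaller_disc[OF holomorphic_deriv[OF hol_phi open_ball], of "1/2"] by auto
  obtain M3 where M3: "0 < M3" "\<And>w. norm w \<le> 1/2 \<Longrightarrow> norm (deriv \<Psi> w) \<le> M3"
    using bounded_on_smaller_disc[OF holomorphic_deriv[OF hol_Psi open_ball], of "1/2"] by auto
  have cont: "continuous_on (cball 0 (1/2)) (\<lambda>w. norm (\<Psi> w))"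
    using sub by (intro continuous_intros continuous_on_subset[OF holomorphic_on_imp_continuous_on[OF hol_Psi]]) auto
  obtain w0 where w0: "w0 \<in> cball 0 (1/2)" "\<forall>w\<in>cball 0 (1/2). norm (\<Psi> w0) \<le> norm (\<Psi> w)"
    using continuous_attains_inf[OF _ _ cont] by auto
  show thesis
  proof (rule that[of "norm (\<Psi> w0)" "M1 + M2 + M3"])
    show "0 < norm (\<Psi> w0)" using Psi_nz[of w0] w0(1) by simp
    show "0 < M1 + M2 + M3" using M1(1) M2(1) M3(1) by simp
    fix w :: complex assume w: "norm w \<le> 1/2"
    show "norm (\<Psi> w0) \<le> norm (\<Psi> w) \<and> norm (\<phi> w) \<le> M1 + M2 + M3 \<and>
      norm (deriv \<phi> w) \<le> M1 + M2 + M3 \<and> norm (deriv \<Psi> w) \<le> M1 + M2 + M3"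
      using M1(2)[OF w] M2(2)[OF w] M3(2)[OF w] M1(1) M2(1) M3(1) w0(2) w by auto
  qed
qed

text \<open>
  For large \<open>t\<close> the term \<open>(exp(\<mu>t) - 1) \<Psi>\<close> dominates \<open>\<phi>\<close>, and the logarithmic derivative of \<open>A\<close> stays
  bounded.
\<close>

lemma late_bounds:
  obtains T K where "0 < T" "0 < K" "\<And>t w. \<lbrakk>T \<le> t; norm w \<le> 1/2\<rbrakk> \<Longrightarrow> A w t \<noteq> 0 \<and>
     norm (A_w w t) \<le> K * norm (A w t)"
proof -
  obtain c M where cM: "0 < c" "0 < M" and
    b: "\<And>w. norm w \<le> 1/2 \<Longrightarrow> c \<le> norm (\<Psi> w) \<and> norm (\<phi> w) \<le> M \<and> norm (deriv \<phi> w) \<le> M \<and> norm (deriv \<Psi> w) \<le> M"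
    using half_disc_bounds by blast
  define T where "T = (2 * M / c + 1) / \<mu>"
  show thesis
  proof (rule that[of T "4 * M / c"])
    show "0 < T" using cM mu by (simp add: T_def add_pos_pos)
    show "0 < 4 * M / c" using cM by simp
    fix t :: real and w :: complex assume t: "T \<le> t" and w: "norm w \<le> 1/2"
    define \<tau> where "\<tau> = exp (\<mu> * t) - 1"
    have "2 * M / c + 1 \<le> \<mu> * t" using t mu by (simp add: T_def field_simps)
    also have "\<dots> \<le> \<tau>" using exp_ge_add_one_self[of "\<mu> * t"] unfolding \<tau>_def by linarith
    finally have tau: "2 * M / c + 1 \<le> \<tau>" .
    then have tau1: "1 \<le> \<tau>" using cM by (smt (verit) divide_pos_pos)
    have "2 * M / c \<le> \<tau>" using tau by simp
    then have tau2: "2 * M \<le> \<tau> * c" using cM by (simp add: field_simps)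
    have Aeq: "A w t = \<phi> w + of_real \<tau> * \<Psi> w" by (simp add: A_def \<tau>_def)
    have "\<tau> * c \<le> norm (of_real \<tau> * \<Psi> w)"
      using b[OF w] tau1 by (simp add: norm_mult)
    moreover have "norm (of_real \<tau> * \<Psi> w) - norm (\<phi> w) \<le> norm (A w t)"
      unfolding Aeq using norm_diff_ineq[of "of_real \<tau> * \<Psi> w" "\<phi> w"] by (simp add: add.commute)
    ultimately have lo: "\<tau> * c / 2 \<le> norm (A w t)" using b[OF w] tau2 by linarith
    have "0 < \<tau> * c" using tau1 cM by (intro mult_pos_pos) auto
    then have nz: "A w t \<noteq> 0" using lo by auto
    have "norm (deriv \<phi> w + of_real \<tau> * deriv \<Psi> w) \<le> norm (deriv \<phi> w) + \<tau> * norm (deriv \<Psi> w)"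
      using norm_triangle_ineq[of "deriv \<phi> w" "of_real \<tau> * deriv \<Psi> w"] tau1 by (simp add: norm_mult)
    also have "\<dots> \<le> M + \<tau> * M" using b[OF w] tau1 by (intro add_mono mult_left_mono) auto
    also have "\<dots> \<le> 2 * \<tau> * M" using mult_right_mono[OF tau1, of M] cM by simp
    also have "\<dots> = 4 * M / c * (\<tau> * c / 2)" using cM by simp
    also have "\<dots> \<le> 4 * M / c * norm (A w t)" using lo cM by (intro mult_left_mono) auto
    finally show "A w t \<noteq> 0 \<and>
     norm (A_w w t) \<le> 4 * M / c * norm (A w t)"
      using nz by (simp add: \<tau>_def A_w_def)
  qed
qed

text \<open>
  Transport keeps \<open>A(w,t) exp(\<alpha>x)\<close> constant, so a zero would persist to a time covered by
  \<open>late_bounds\<close>.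
\<close>

lemma A_nz:
  assumes "0 \<le> t" "norm w \<le> exp (- t)" "norm w < 1"
  shows "A w t \<noteq> 0"
proof
  assume 0: "A w t = 0"
  obtain T K where T: "0 < T" "\<And>t w. \<lbrakk>T \<le> t; norm w \<le> 1/2\<rbrakk> \<Longrightarrow> A w t \<noteq> 0"
    using late_bounds by metis
  \<comment> \<open>The summand 1 puts the transported point into the disc of radius 1/2.\<close>
  define t1 where "t1 = max T t + 1"
  have t1: "t \<le> t1" "T \<le> t1" "1 \<le> t1" using T assms by (auto simp: t1_def)
  obtain x where x: "(x, t1) \<in> region t t1" "A (w * exp x) t1 * exp (\<alpha> * x) = A w t"
    using transport_A[OF assms(3,2,1) t1(1)] by blast
  have "norm (w * exp x) \<le> exp (- t1)" using region_norm_fibre(4)[OF x(1) assms(1,2)] .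
  also have "\<dots> \<le> exp (- 1)" using t1 by simp
  also have "\<dots> \<le> 1/2" using exp_ge_add_one_self[of 1] by (simp add: exp_minus field_simps)
  finally have "A (w * exp x) t1 \<noteq> 0" by (intro T t1)
  with x(2) 0 show False by simp
qed

text \<open>
  The bound must hold up to the unit circle, where \<open>A\<close> is not yet defined. Transport to time 1 compares
  each value with one on the compact disc \<open>|w| \<le> exp(-1)\<close> inside the domain, at the cost of the factor
  \<open>exp(\<alpha>x)\<close>, which is controlled because the path has length at most \<open>C\<close>.
\<close>

lemma A_lower_bound:
  obtains \<delta> where "0 < \<delta>" "\<And>t w. \<lbrakk>0 \<le> t; t \<le> 1; norm w \<le> exp (- t); norm w < 1\<rbrakk> \<Longrightarrow> \<delta> \<le> norm (A w t)"
proof -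
  have e1: "exp (- 1) < (1::real)" by simp
  have cont: "continuous_on (cball 0 (exp (- 1))) (\<lambda>w. norm (A w 1))"
    by (intro continuous_intros continuous_on_compose2[OF continuous_on_A, of _ "\<lambda>w. (w, 1)", simplified])
       (auto intro: le_less_trans[OF _ e1])
  obtain w1 where w1: "w1 \<in> cball 0 (exp (- 1))" "\<forall>w\<in>cball 0 (exp (- 1)). norm (A w1 1) \<le> norm (A w 1)"
    using continuous_attains_inf[OF _ _ cont] by auto
  have pos: "0 < norm (A w1 1)" using A_nz[of 1 w1] w1(1) e1 by simp
  show thesis
  proof (rule that[of "norm (A w1 1) * exp (- norm \<alpha> * C)"])
    show "0 < norm (A w1 1) * exp (- norm \<alpha> * C)" using pos by simp
    fix t w assume tw: "0 \<le> t" "t \<le> 1" "norm w \<le> exp (- t)" "norm (w::complex) < 1"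
    obtain x where x: "(x, 1) \<in> region t 1" "A (w * exp x) 1 * exp (\<alpha> * x) = A w t"
      using transport_A[OF tw(4,3,1,2)] by blast
    have "norm x \<le> C * (1 - t)" using x(1) by (simp add: region_def transport_region_def)
    also have "\<dots> \<le> C * 1" using C_pos tw by (intro mult_left_mono) auto
    finally have "norm (\<alpha> * x) \<le> norm \<alpha> * C" by (simp add: norm_mult mult_left_mono)
    then have "- norm \<alpha> * C \<le> Re (\<alpha> * x)" using abs_Re_le_cmod[of "\<alpha> * x"] by linarith
    then have "exp (- norm \<alpha> * C) \<le> norm (exp (\<alpha> * x))" by simp
    moreover have "norm (A w1 1) \<le> norm (A (w * exp x) 1)"
      using w1(2) region_norm_fibre(4)[OF x(1) tw(1,3)] by simp
    ultimately have "norm (A w1 1) * exp (- norm \<alpha> * C) \<le> norm (A (w * exp x) 1) * norm (exp (\<alpha> * x))"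
      by (intro mult_mono) auto
    then show "norm (A w1 1) * exp (- norm \<alpha> * C) \<le> norm (A w t)"
      by (simp only: x(2) flip: norm_mult)
  qed
qed

end

section \<open>Growth at the unit circle\<close>

text \<open>
  Converts the growth bounds in \<open>1 - |w|\<^sup>\<mu>\<close>, in which the hypotheses are phrased, into bounds in
  \<open>1 - |w|\<close>. It follows from \<open>s\<^sup>\<nu> \<le> exp(-y) \<le> 1/(1+y)\<close> with \<open>y = \<nu>(1-s)\<close>.
\<close>

lemma one_minus_powr_ge:
  fixes s \<nu> :: real
  assumes "0 \<le> s" "s \<le> 1" "0 < \<nu>"
  shows "\<nu> / (1 + \<nu>) * (1 - s) \<le> 1 - s powr \<nu>"
proof (cases "s = 0")
  case True
  then show ?thesis using assms by simp
next
  case False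
  define y where "y = \<nu> * (1 - s)"
  have y: "0 \<le> y" "y \<le> \<nu>" using assms by (auto simp: y_def mult_le_cancel_left2)
  have "ln s \<le> s - 1" using False assms by (intro ln_le_minus_one) auto
  then have "\<nu> * ln s \<le> \<nu> * (s - 1)" using assms by (intro mult_left_mono) auto
  then have "\<nu> * ln s \<le> - y" by (simp add: y_def algebra_simps)
  then have "s powr \<nu> \<le> exp (- y)" using False assms by (simp add: powr_def)
  also have "\<dots> \<le> 1 / (1 + y)"
    using y exp_ge_add_one_self[of y] by (simp add: exp_minus divide_simps)
  finally have "y / (1 + y) \<le> 1 - s powr \<nu>" using y by (simp add: field_simps)
  moreover have "y / (1 + \<nu>) \<le> y / (1 + y)" using y by (intro divide_left_mono) auto
  ultimately show ?thesis by (simp add: y_def)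
qed

lemma powr_less_1: "\<lbrakk>0 \<le> s; s < 1; 0 < \<nu>\<rbrakk> \<Longrightarrow> s powr \<nu> < 1" for s \<nu> :: real
  using powr_less_mono2[of \<nu> s 1] by simp

lemma has_vector_derivative_radial:
  assumes "(f has_field_derivative d) (at (of_real s * w))"
  shows "((\<lambda>s. f (of_real s * w)) has_vector_derivative (w * d)) (at s)"
proof -
  have "((\<lambda>s. of_real s * w) has_vector_derivative w) (at s)"
    by (auto intro!: derivative_eq_intros simp: has_vector_derivative_def scaleR_conv_of_real)
  from field_vector_diff_chain_at[OF this, of f d] assms show ?thesis by (simp add: o_def)
qed

lemma radial_growth:
  assumes hol: "u holomorphic_on \<U>" and k: "0 \<le> k" "k < 1" and K: "0 \<le> K"
    and bd: "\<And>w. norm w < 1 \<Longrightarrow> norm (deriv u w) \<le> K * (1 - norm w) powr (- k)"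
    and w: "norm w < 1" and \<rho>: "0 \<le> \<rho>" "\<rho> \<le> 1"
  shows "norm (u w - u (of_real \<rho> * w))
           \<le> K / (1 - k) * ((1 - \<rho> * norm w) powr (1 - k) - (1 - norm w) powr (1 - k))"
proof (cases "\<rho> = 1")
  case False
  then have r: "\<rho> < 1" using \<rho> by simp
  have in_disc: "norm (of_real s * w) < 1" if "\<rho> \<le> s" "s \<le> 1" for s
    using that w \<rho> by (simp add: norm_mult) (meson le_less_trans mult_left_le_one_le norm_ge_zero order_trans)
  have pos: "0 < 1 - s * norm w" if "\<rho> \<le> s" "s \<le> 1" for s
    using in_disc[OF that] that \<rho> by (simp add: norm_mult)
  let ?v = "\<lambda>s. - K / (1 - k) * (1 - s * norm w) powr (1 - k)"
  have "norm (u (of_real 1 * w) - u (of_real \<rho> * w)) \<le> ?v 1 - ?v \<rho>"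
  proof (rule differentiable_bound_general[OF r, of "\<lambda>s. u (of_real s * w)" ?v
        "\<lambda>s. w * deriv u (of_real s * w)" "\<lambda>s. norm w * (K * (1 - s * norm w) powr (- k))"])
    show "continuous_on {\<rho>..1} (\<lambda>s. u (of_real s * w))"
      using in_disc by (intro continuous_on_compose2[OF holomorphic_on_imp_continuous_on[OF hol]] continuous_intros) auto
    show "continuous_on {\<rho>..1} ?v" using pos by (intro continuous_intros) force+
    fix s assume s: "\<rho> < s" "s < 1"
    then have s': "\<rho> \<le> s" "s \<le> 1" by auto
    show "((\<lambda>s. u (of_real s * w)) has_vector_derivative w * deriv u (of_real s * w)) (at s)"
      using holomorphic_derivI[OF hol open_ball] in_disc[OF s'] by (intro has_vector_derivative_radial) simp
    show "(?v has_vector_derivative norm w * (K * (1 - s * norm w) powr (- k))) (at s)"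
      using pos[OF s'] k
      by (auto intro!: derivative_eq_intros simp flip: has_real_derivative_iff_has_vector_derivative)
    show "norm (w * deriv u (of_real s * w)) \<le> norm w * (K * (1 - s * norm w) powr (- k))"
      using bd[OF in_disc[OF s']] s' \<rho> by (simp add: norm_mult mult_left_mono)
  qed
  then show ?thesis by (simp add: algebra_simps)
qed simp

text \<open>
  By \<open>radial_growth\<close> the functions \<open>w \<mapsto> u(\<rho>w)\<close>, which are uniformly continuous, converge uniformly to
  \<open>u\<close> as \<open>\<rho>\<close> tends to 1. Hence \<open>u\<close> is uniformly continuous.
\<close>

lemma continuous_extension_to_closed_disc:
  assumes hol: "u holomorphic_on \<U>" and k: "0 \<le> k" "k < 1" and K: "0 \<le> K"
    and bd: "\<And>w. norm w < 1 \<Longrightarrow> norm (deriv u w) \<le> K * (1 - norm w) powr (- k)"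
  obtains v where "continuous_on (cball 0 1) v" "\<And>w. norm w < 1 \<Longrightarrow> v w = u w"
proof -
  have "uniformly_continuous_on \<U> u"
    unfolding uniformly_continuous_on_def
  proof (intro allI impI)
    fix e :: real assume e: "0 < e"
    then have e3: "0 < e / 3" by simp
    have "uniformly_continuous_on {0..1} (\<lambda>x::real. K / (1 - k) * x powr (1 - k))"
      using k by (intro compact_uniformly_continuous continuous_on_mult continuous_on_const continuous_on_powr'
        continuous_on_id) auto
    then have "\<exists>d>0. \<forall>x\<in>{0..1}. \<forall>x'\<in>{0..1}. dist x' x < d \<longrightarrow>
        dist (K / (1 - k) * x' powr (1 - k)) (K / (1 - k) * x powr (1 - k)) < e / 3"
      unfolding uniformly_continuous_on_def using e3 by (elim allE impE)
    then obtain d where d: "0 < d" and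
      dd: "\<And>x y. \<lbrakk>x \<in> {0..1}; y \<in> {0..1}; \<bar>x - y\<bar> < d\<rbrakk> \<Longrightarrow>
        \<bar>K / (1 - k) * x powr (1 - k) - K / (1 - k) * y powr (1 - k)\<bar> < e / 3"
      unfolding dist_real_def by blast
    define \<rho> where "\<rho> = max 0 (1 - d / 2)"
    have r: "0 \<le> \<rho>" "\<rho> < 1" "1 - \<rho> < d" using d by (auto simp: \<rho>_def)
    have close: "norm (u w - u (of_real \<rho> * w)) < e / 3" if w: "norm w < 1" for w
    proof -
      have 1: "\<rho> * norm w \<le> norm w" using r by (simp add: mult_left_le_one_le)
      have 2: "(1 - \<rho>) * norm w \<le> 1 - \<rho>" using r w by (simp add: mult_left_le)
      have "norm (u w - u (of_real \<rho> * w))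
           \<le> K / (1 - k) * ((1 - \<rho> * norm w) powr (1 - k) - (1 - norm w) powr (1 - k))"
        using r by (intro radial_growth[OF hol k K bd w]) auto
      also have "\<dots> < e / 3"
      proof -
        have "\<rho> * norm w \<le> 1" "norm w - \<rho> * norm w \<le> 1 - \<rho>" using 1 2 w by (auto simp: algebra_simps)
        then have "\<bar>K / (1 - k) * (1 - \<rho> * norm w) powr (1 - k) - K / (1 - k) * (1 - norm w) powr (1 - k)\<bar> < e / 3"
          using 1 r w by (intro dd) auto
        moreover have "K / (1 - k) * (x - y) = K / (1 - k) * x - K / (1 - k) * y" for x y
          by (rule right_diff_distrib)
        ultimately show ?thesis by (simp only: abs_less_iff)
      qed
      finally show ?thesis .
    qed
    have "uniformly_continuous_on (cball 0 1) (\<lambda>w. u (of_real \<rho> * w))"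
      using r by (intro compact_uniformly_continuous continuous_intros
          continuous_on_compose2[OF holomorphic_on_imp_continuous_on[OF hol]])
        (auto simp: norm_mult intro: le_less_trans[OF mult_left_le, of _ \<rho>])
    then have "\<exists>d>0. \<forall>x\<in>cball 0 1. \<forall>x'\<in>cball 0 1. dist x' x < d \<longrightarrow>
        dist (u (of_real \<rho> * x')) (u (of_real \<rho> * x)) < e / 3"
      unfolding uniformly_continuous_on_def using e3 by (elim allE impE)
    then obtain d' where d': "0 < d'" "\<And>x y. \<lbrakk>x \<in> cball 0 1; y \<in> cball 0 1; dist y x < d'\<rbrakk> \<Longrightarrow>
        dist (u (of_real \<rho> * y)) (u (of_real \<rho> * x)) < e / 3"
      by blast
    show "\<exists>d>0. \<forall>x\<in>\<U>. \<forall>x'\<in>\<U>. dist x' x < d \<longrightarrow> dist (u x') (u x) < e"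
    proof (intro exI[of _ d'] conjI ballI impI d')
      fix x x' assume x: "x \<in> \<U>" "x' \<in> \<U>" "dist x' x < d'"
      have "dist (u x') (u x) \<le> dist (u x') (u (of_real \<rho> * x')) +
          dist (u (of_real \<rho> * x')) (u (of_real \<rho> * x)) + dist (u (of_real \<rho> * x)) (u x)"
        using dist_triangle[of "u x'" "u x" "u (of_real \<rho> * x')"]
          dist_triangle[of "u (of_real \<rho> * x')" "u x" "u (of_real \<rho> * x)"] by linarith
      also have "\<dots> < e / 3 + e / 3 + e / 3"
        using close[of x'] close[of x] d'(2)[of x x'] x
        by (intro add_strict_mono) (auto simp: dist_norm norm_minus_commute)
      finally show "dist (u x') (u x) < e" by simp
    qed
  qed
  then obtain v where "uniformly_continuous_on (closure \<U>) v" "\<And>x. x \<in> \<U> \<Longrightarrow> u x = v x"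
    using uniformly_continuous_on_extension_on_closure by metis
  then show thesis using that[of v] by (simp add: uniformly_continuous_imp_continuous)
qed

context loewner_pair
begin

lemma norm_B: "norm w < 1 \<Longrightarrow> norm (B w) \<le> \<mu>"
proof -
  assume "norm w < 1"
  then have "norm (B w - of_real (\<mu> / 2)) \<le> k * (\<mu> / 2)" using B_bound by (simp add: B_def)
  then have "norm (B w) \<le> k * (\<mu> / 2) + \<mu> / 2"
    using norm_triangle_sub[of "B w" "of_real (\<mu> / 2)"] mu by simp
  also have "k * (\<mu> / 2) \<le> 1 * (\<mu> / 2)" using k mu by (intro mult_right_mono) auto
  finally show ?thesis by simp
qed

text \<open>
  Combining the two hypotheses bounds \<open>(1 - |w|\<^sup>\<mu>) |Q|\<close> by \<open>k\<mu>\<close> up to a term that vanishes on the circle.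
  The constant \<open>k\<mu>\<close> is what matters: it becomes the exponent \<open>k < 1\<close> in \<open>Psi_growth\<close>.
\<close>

lemma norm_Q:
  assumes w: "norm w < 1"
  defines "x \<equiv> norm w powr \<mu>"
  shows "norm (Q w) \<le> \<mu> / 2 + k * \<mu> / (1 - x)"
proof -
  have x: "0 \<le> x" "x < 1" using w mu unfolding x_def by (auto simp: powr_less_1)
  have tri: "norm (a + b - c) \<le> norm a + norm b + norm c" for a b c :: complex
    using norm_triangle_ineq4[of "a + b" c] norm_triangle_ineq[of a b] by linarith
  have eq: "(1 - of_real x) * Q w = (of_real x * B w + (1 - of_real x) * Q w - of_real (\<mu> / 2))
      + of_real ((1 - x) * (\<mu> / 2)) - of_real x * (B w - of_real (\<mu> / 2))"
    by (simp only: of_real_mult of_real_diff of_real_1) (simp only: algebra_simps mult_1_left)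
  have "norm ((1 - of_real x) * Q w) \<le> norm (of_real x * B w + (1 - of_real x) * Q w - of_real (\<mu> / 2))
      + norm (complex_of_real ((1 - x) * (\<mu> / 2))) + norm (of_real x * (B w - of_real (\<mu> / 2)))"
    by (rule ord_eq_le_trans[OF arg_cong[OF eq, of norm] tri])
  also have "\<dots> \<le> k * (\<mu> / 2) + (1 - x) * (\<mu> / 2) + x * (k * (\<mu> / 2))"
  proof (intro add_mono)
    show "norm (of_real x * B w + (1 - of_real x) * Q w - of_real (\<mu> / 2)) \<le> k * (\<mu> / 2)"
      using Q_bound[OF w] by (simp add: B_def Q_def x_def)
    show "norm (complex_of_real ((1 - x) * (\<mu> / 2))) \<le> (1 - x) * (\<mu> / 2)"
      using x mu by (simp only: norm_of_real) simp
    have "norm (B w - of_real (\<mu> / 2)) \<le> k * (\<mu> / 2)" using B_bound[OF w] by (simp add: B_def)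
    from mult_left_mono[OF this x(1)]
    show "norm (of_real x * (B w - of_real (\<mu> / 2))) \<le> x * (k * (\<mu> / 2))"
      using x by (simp only: norm_mult norm_of_real abs_of_nonneg)
  qed
  also have "x * (k * (\<mu> / 2)) \<le> k * (\<mu> / 2)" using x k mu by (intro mult_left_le_one_le) auto
  finally have "norm ((1 - of_real x) * Q w) \<le> k * \<mu> + (1 - x) * (\<mu> / 2)" by (simp add: mult.commute)
  also have "norm ((1 - of_real x) * Q w) = (1 - x) * norm (Q w)"
  proof -
    have "norm (1 - complex_of_real x) = 1 - x"
      using x by (metis abs_of_nonneg diff_ge_0_iff_ge less_imp_le norm_of_real of_real_1 of_real_diff)
    then show ?thesis by (simp add: norm_mult)
  qed
  finally show ?thesis using x by (simp add: field_simps)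
qed

text \<open>
  Along a radius the logarithmic derivative of \<open>\<Psi>\<close> is \<open>(Q - \<alpha>)/w\<close>. By \<open>norm_Q\<close> it is dominated by
  the derivative of \<open>E s - k log(1 - s\<^sup>\<mu>)\<close>, and exponentiating the integrated bound gives the claim.
\<close>

lemma Psi_growth:
  obtains K where "0 < K" "\<And>w. norm w < 1 \<Longrightarrow> norm (\<Psi> w) \<le> K * (1 - norm w) powr (- k)"
proof -
  obtain l where l: "l holomorphic_on \<U>" "\<And>z. z \<in> \<U> \<Longrightarrow> \<Psi> z = exp (l z)"
    using contractible_imp_holomorphic_log[OF hol_Psi convex_imp_contractible[OF convex_ball]] Psi_nz
    by (metis mem_ball_0)
  have dl: "(l has_field_derivative deriv \<Psi> w / \<Psi> w) (at w)" if "norm w < 1" for w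
  proof -
    have 1: "(l has_field_derivative deriv l w) (at w)"
      using holomorphic_derivI[OF l(1) open_ball] that by simp
    then have "((\<lambda>z. exp (l z)) has_field_derivative exp (l w) * deriv l w) (at w)"
      by (auto intro!: derivative_eq_intros)
    then have "(\<Psi> has_field_derivative exp (l w) * deriv l w) (at w)"
      by (rule has_field_derivative_transform_within_open[of _ _ _ \<U>]) (use l(2) that in auto)
    then have "deriv \<Psi> w = \<Psi> w * deriv l w" using l(2)[of w] that by (simp add: DERIV_imp_deriv)
    with 1 Psi_nz[OF that] show ?thesis by simp
  qed
  obtain M where M: "0 < M" "\<And>w. norm w \<le> 1/2 \<Longrightarrow> norm (\<Psi> w) \<le> M"
    using bounded_on_smaller_disc[OF hol_Psi, of "1/2"] by auto
  define E where "E = 2 * (\<mu> / 2 + norm \<alpha> + k * \<mu>)"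
  have E: "0 \<le> E" using mu k by (simp add: E_def)
  define c where "c = \<mu> / (1 + \<mu>)"
  have c: "0 < c" using mu by (simp add: c_def)
  show thesis
  proof (rule that[of "M * exp E * c powr (- k)"])
    show "0 < M * exp E * c powr (- k)" using M c by simp
    fix w :: complex assume w: "norm w < 1"
    define r where "r = norm w"
    have x1: "0 < 1 - r powr \<mu>" using w mu by (simp add: r_def powr_less_1)
    have key: "norm (\<Psi> w) \<le> M * exp E * (1 - r powr \<mu>) powr (- k)"
    proof (cases "r \<le> 1/2")
      case True
      have "(1 - r powr \<mu>) powr k \<le> 1" using x1 k by (intro powr_le1) auto
      then have "1 \<le> (1 - r powr \<mu>) powr (- k)" using x1 by (simp add: powr_minus field_simps)
      then have "1 \<le> exp E * (1 - r powr \<mu>) powr (- k)"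
        using E mult_mono[of 1 "exp E" 1 "(1 - r powr \<mu>) powr (- k)"] by simp
      then have "M * 1 \<le> M * (exp E * (1 - r powr \<mu>) powr (- k))" using M by (intro mult_left_mono) auto
      then show ?thesis using M(2)[of w] True by (simp add: r_def mult.assoc)
    next
      case False
      then have r: "1/2 < r" "r < 1" using w by (auto simp: r_def)
      define \<zeta> where "\<zeta> = w / of_real r"
      have z: "norm \<zeta> = 1" "of_real r * \<zeta> = w" using r by (auto simp: \<zeta>_def norm_divide r_def)
      have nz: "norm (of_real s * \<zeta>) = s" if "0 \<le> s" for s using that z by (simp add: norm_mult)
      let ?v = "\<lambda>s. E * s - k * ln (1 - s powr \<mu>)"
      have pos: "0 < 1 - s powr \<mu>" if "1/2 \<le> s" "s \<le> r" for s
        using that r mu by (simp add: powr_less_1)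
      have "norm (l (of_real r * \<zeta>) - l (of_real (1/2) * \<zeta>)) \<le> ?v r - ?v (1/2)"
      proof (rule differentiable_bound_general[OF r(1), of "\<lambda>s. l (of_real s * \<zeta>)" ?v
         "\<lambda>s. \<zeta> * (deriv \<Psi> (of_real s * \<zeta>) / \<Psi> (of_real s * \<zeta>))"
         "\<lambda>s. E + k * (\<mu> * s powr (\<mu> - 1)) / (1 - s powr \<mu>)"])
        show "continuous_on {1/2..r} (\<lambda>s. l (of_real s * \<zeta>))"
          using r nz by (intro continuous_on_compose2[OF holomorphic_on_imp_continuous_on[OF l(1)]] continuous_intros) auto
        show "continuous_on {1/2..r} ?v" using pos by (intro continuous_intros) force+
        fix s assume s: "1/2 < s" "s < r"
        then have s1: "norm (of_real s * \<zeta>) < 1" using r nz[of s] by simp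
        show "((\<lambda>s. l (of_real s * \<zeta>)) has_vector_derivative \<zeta> * (deriv \<Psi> (of_real s * \<zeta>) / \<Psi> (of_real s * \<zeta>))) (at s)"
          by (intro has_vector_derivative_radial dl s1)
        have p: "0 < 1 - s powr \<mu>" using pos[of s] s by simp
        show "(?v has_vector_derivative E + k * (\<mu> * s powr (\<mu> - 1)) / (1 - s powr \<mu>)) (at s)"
          using p s by (auto intro!: derivative_eq_intros simp: field_simps
              simp flip: has_real_derivative_iff_has_vector_derivative)
        define y where "y = of_real s * \<zeta>"
        have y: "norm y = s" "norm y < 1" using s1 nz[of s] s by (auto simp: y_def)
        have gen: "X \<le> E / 2 + Z" if "X \<le> \<mu> / 2 + (k * \<mu> + Z) + norm \<alpha>" for X Z
          using that by (simp add: E_def field_simps)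
        have "of_real s * (\<zeta> * (deriv \<Psi> y / \<Psi> y)) = Q y - \<alpha>"
          using Psi_nz[OF y(2)] by (simp add: Q_def euler_quot_def y_def field_simps)
        then have "s * norm (\<zeta> * (deriv \<Psi> y / \<Psi> y)) = norm (Q y - \<alpha>)"
          using s by (metis norm_mult norm_of_real abs_of_pos less_trans half_gt_zero_iff zero_less_one)
        also have "norm (Q y - \<alpha>) \<le> \<mu> / 2 + k * \<mu> / (1 - s powr \<mu>) + norm \<alpha>"
          using norm_Q[OF y(2)] norm_triangle_ineq4[of "Q y" \<alpha>] y(1) by simp
        \<comment> \<open>Splitting off \<open>k * \<mu>\<close> leaves a multiple of \<open>s powr (\<mu> - 1)\<close>, the derivative of \<open>s powr \<mu>\<close>, after division by \<open>s\<close>.\<close>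
        also have "k * \<mu> / (1 - s powr \<mu>) = k * \<mu> + k * \<mu> * s powr \<mu> / (1 - s powr \<mu>)"
          using p by (simp add: field_simps)
        also have "k * \<mu> * s powr \<mu> / (1 - s powr \<mu>) = s * (k * (\<mu> * s powr (\<mu> - 1)) / (1 - s powr \<mu>))"
          using s by (simp add: powr_diff)
        finally have "s * norm (\<zeta> * (deriv \<Psi> y / \<Psi> y)) \<le> E / 2 + s * (k * (\<mu> * s powr (\<mu> - 1)) / (1 - s powr \<mu>))"
          by (rule gen)
        also have "E / 2 \<le> s * E" using s E mult_right_mono[of "1/2" s E] by simp
        finally have "s * norm (\<zeta> * (deriv \<Psi> y / \<Psi> y)) \<le> s * (E + k * (\<mu> * s powr (\<mu> - 1)) / (1 - s powr \<mu>))"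
          by (simp add: algebra_simps)
        then show "norm (\<zeta> * (deriv \<Psi> (of_real s * \<zeta>) / \<Psi> (of_real s * \<zeta>)))
            \<le> E + k * (\<mu> * s powr (\<mu> - 1)) / (1 - s powr \<mu>)"
          using s unfolding y_def by (subst (asm) mult_le_cancel_left_pos) auto
      qed
      also have "\<dots> \<le> E - k * ln (1 - r powr \<mu>)"
      proof -
        have "ln (1 - (1/2) powr \<mu>) \<le> 0" using pos[of "1/2"] r by (simp add: ln_le_zero_iff)
        then have "k * ln (1 - (1/2) powr \<mu>) \<le> 0" using k by (simp add: mult_nonneg_nonpos)
        moreover have "E * r \<le> E" using E r by (simp add: mult_left_le)
        ultimately show ?thesis using E by simp
      qed
      finally have "Re (l w) \<le> Re (l (of_real (1/2) * \<zeta>)) + (E - k * ln (1 - r powr \<mu>))"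
        using abs_Re_le_cmod[of "l w - l (of_real (1/2) * \<zeta>)"] z by simp
      then have "exp (Re (l w)) \<le> exp (Re (l (of_real (1/2) * \<zeta>)) + (E - k * ln (1 - r powr \<mu>)))" by simp
      also have "\<dots> = exp (Re (l (of_real (1/2) * \<zeta>))) * exp E * (1 - r powr \<mu>) powr (- k)"
        using x1 by (simp add: powr_def exp_add exp_diff exp_minus field_simps)
      finally have "norm (\<Psi> w) \<le> norm (\<Psi> (of_real (1/2) * \<zeta>)) * exp E * (1 - r powr \<mu>) powr (- k)"
        using l(2)[of w] l(2)[of "of_real (1/2) * \<zeta>"] w nz[of "1/2"] by simp
      also have "\<dots> \<le> M * exp E * (1 - r powr \<mu>) powr (- k)"
        using M(2)[of "of_real (1/2) * \<zeta>"] nz[of "1/2"] by (intro mult_right_mono) auto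
      finally show ?thesis .
    qed
    have "c * (1 - r) \<le> 1 - r powr \<mu>" using one_minus_powr_ge[of r \<mu>] w mu by (simp add: c_def r_def)
    then have "(1 - r powr \<mu>) powr (- k) \<le> (c * (1 - r)) powr (- k)"
      using c w k by (intro powr_mono2') (auto simp: r_def)
    also have "\<dots> = c powr (- k) * (1 - r) powr (- k)" using c w by (simp add: powr_mult r_def)
    finally have "M * exp E * (1 - r powr \<mu>) powr (- k) \<le> M * exp E * (c powr (- k) * (1 - r) powr (- k))"
      using M by (intro mult_left_mono) auto
    with key show "norm (\<Psi> w) \<le> M * exp E * c powr (- k) * (1 - norm w) powr (- k)"
      by (simp add: r_def mult.assoc)
  qed
qed

text \<open>
  Along a radius \<open>s\<^sup>\<alpha> \<phi>\<close> has the derivative \<open>s\<^sup>\<alpha>\<^sup>-\<^sup>1 B \<Psi>\<close>, which is integrable up to the circle because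
  \<open>B\<close> is bounded and \<open>\<Psi> = O((1 - s)\<^sup>-\<^sup>k)\<close>.
\<close>

lemma phi_bounded:
  obtains M where "\<And>w. norm w < 1 \<Longrightarrow> norm (\<phi> w) \<le> M"
proof -
  obtain K where K: "0 < K" "\<And>w. norm w < 1 \<Longrightarrow> norm (\<Psi> w) \<le> K * (1 - norm w) powr (- k)"
    using Psi_growth by blast
  obtain M where M: "0 < M" "\<And>w. norm w \<le> 1/2 \<Longrightarrow> norm (\<phi> w) \<le> M"
    using bounded_on_smaller_disc[OF hol_phi, of "1/2"] by auto
  define a where "a = Re \<alpha>"
  have a: "0 < a" using Re_alpha by (simp add: a_def)
  define N where "N = 2 * \<mu> * K"
  have N: "0 \<le> N" using mu K by (simp add: N_def)
  define R where "R = 2 powr a * (M + N / (1 - k))"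
  have R0: "M \<le> R"
  proof -
    have "1 * M \<le> 2 powr a * (M + N / (1 - k))"
      using a N M k by (intro mult_mono) (auto simp: ge_one_powr_ge_zero)
    then show ?thesis by (simp add: R_def)
  qed
  show thesis
  proof (rule that[of R])
    fix w :: complex assume w: "norm w < 1"
    show "norm (\<phi> w) \<le> R"
    proof (cases "norm w \<le> 1/2")
      case True
      then show ?thesis using M(2)[of w] R0 by linarith
    next
      case False
      define r where "r = norm w"
      have r: "1/2 < r" "r < 1" using w False by (auto simp: r_def)
      define \<zeta> where "\<zeta> = w / of_real r"
      have z: "norm \<zeta> = 1" "of_real r * \<zeta> = w" using r by (auto simp: \<zeta>_def norm_divide r_def)
      have nz: "norm (of_real s * \<zeta>) = s" if "0 \<le> s" for s using that z by (simp add: norm_mult)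
      define y where "y s = exp (\<alpha> * of_real (ln s)) * \<phi> (of_real s * \<zeta>)" for s
      have ny: "norm (exp (\<alpha> * of_real (ln s))) = s powr a" if "0 < s" for s
        using that by (simp add: powr_def a_def)
      let ?v = "\<lambda>s. - N / (1 - k) * (1 - s) powr (1 - k)"
      have "norm (y r - y (1/2)) \<le> ?v r - ?v (1/2)"
      proof (rule differentiable_bound_general[OF r(1), of y ?v
         "\<lambda>s. exp (\<alpha> * of_real (ln s)) / of_real s * (B (of_real s * \<zeta>) * \<Psi> (of_real s * \<zeta>))"
         "\<lambda>s. N * (1 - s) powr (- k)"])
        show "continuous_on {1/2..r} y" unfolding y_def
          using r nz by (intro continuous_on_compose2[OF holomorphic_on_imp_continuous_on[OF hol_phi]] continuous_intros) auto
        show "continuous_on {1/2..r} ?v" using r by (intro continuous_intros) auto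
        fix s assume s: "1/2 < s" "s < r"
        define x where "x = of_real s * \<zeta>"
        have x: "norm x = s" "norm x < 1" using s r nz[of s] by (auto simp: x_def)
        have d1: "((\<lambda>s. \<phi> (of_real s * \<zeta>)) has_vector_derivative \<zeta> * deriv \<phi> x) (at s)"
          unfolding x_def using phi_deriv[OF x(2)] by (intro has_vector_derivative_radial) (simp add: x_def)
        have d2: "((\<lambda>s. exp (\<alpha> * of_real (ln s))) has_vector_derivative (\<alpha> / of_real s) * exp (\<alpha> * of_real (ln s))) (at s)"
        proof -
          have "((\<lambda>s. \<alpha> * of_real (ln s)) has_vector_derivative \<alpha> * of_real (1 / s)) (at s)"
            using s by (auto intro!: derivative_eq_intros has_vector_derivative_mult_right
               has_vector_derivative_of_real simp flip: has_real_derivative_iff_has_vector_derivative)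
          from field_vector_diff_chain_at[OF this, of exp] show ?thesis
            by (auto simp: o_def intro!: DERIV_exp)
        qed
        have Bx: "B x * \<Psi> x = \<alpha> * \<phi> x + x * deriv \<phi> x"
          using Psi_nz[OF x(2)] by (simp add: B_def euler_quot_def)
        have "(y has_vector_derivative exp (\<alpha> * of_real (ln s)) * (\<zeta> * deriv \<phi> x)
             + (\<alpha> / of_real s) * exp (\<alpha> * of_real (ln s)) * \<phi> x) (at s)"
          unfolding y_def using has_vector_derivative_mult[OF d2 d1] by (simp add: x_def)
        moreover have "exp (\<alpha> * of_real (ln s)) * (\<zeta> * deriv \<phi> x)
             + (\<alpha> / of_real s) * exp (\<alpha> * of_real (ln s)) * \<phi> x
             = exp (\<alpha> * of_real (ln s)) / of_real s * (B x * \<Psi> x)"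
          unfolding Bx using s by (simp add: x_def field_simps)
        ultimately show "(y has_vector_derivative exp (\<alpha> * of_real (ln s)) / of_real s * (B (of_real s * \<zeta>) * \<Psi> (of_real s * \<zeta>))) (at s)"
          by (simp add: x_def)
        show "(?v has_vector_derivative N * (1 - s) powr (- k)) (at s)"
          using s r k by (auto intro!: derivative_eq_intros simp flip: has_real_derivative_iff_has_vector_derivative)
        have "norm (exp (\<alpha> * of_real (ln s)) / of_real s * (B x * \<Psi> x))
            = s powr a / s * (norm (B x) * norm (\<Psi> x))"
          using s by (simp only: norm_mult norm_divide ny norm_of_real abs_of_pos)
        also have "\<dots> \<le> 2 * (\<mu> * (K * (1 - s) powr (- k)))"
        proof (rule mult_mono)
          have "s powr a \<le> 1" using s r a by (intro powr_le1) auto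
          then show "s powr a / s \<le> 2" using s by (simp add: field_simps)
          show "norm (B x) * norm (\<Psi> x) \<le> \<mu> * (K * (1 - s) powr (- k))"
            using norm_B[OF x(2)] K(2)[OF x(2)] mu x(1) by (intro mult_mono) auto
        qed auto
        finally show "norm (exp (\<alpha> * of_real (ln s)) / of_real s * (B (of_real s * \<zeta>) * \<Psi> (of_real s * \<zeta>)))
           \<le> N * (1 - s) powr (- k)" by (simp add: N_def x_def)
      qed
      also have "\<dots> \<le> N / (1 - k)"
      proof -
        have "N / (1 - k) * (1/2) powr (1 - k) \<le> N / (1 - k) * 1"
          using k N by (intro mult_left_mono powr_le1) auto
        moreover have "0 \<le> N / (1 - k) * (1 - r) powr (1 - k)" using k N by simp
        ultimately show ?thesis by simp
      qed
      finally have "norm (y r) \<le> norm (y (1/2)) + N / (1 - k)"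
        using norm_triangle_sub[of "y r" "y (1/2)"] by simp
      also have "norm (y (1/2)) \<le> M"
      proof -
        have "norm (y (1/2)) = (1/2) powr a * norm (\<phi> (of_real (1/2) * \<zeta>))"
          using ny[of "1/2"] by (simp only: y_def norm_mult)
        also have "\<dots> \<le> 1 * M"
          using M(2)[of "of_real (1/2) * \<zeta>"] nz[of "1/2"] a by (intro mult_mono powr_le1) auto
        finally show ?thesis by simp
      qed
      finally have yr: "r powr a * norm (\<phi> w) \<le> M + N / (1 - k)"
        using ny[of r] r z by (simp add: y_def norm_mult)
      have "(1/2) powr a * norm (\<phi> w) \<le> r powr a * norm (\<phi> w)"
        using r a by (intro mult_right_mono powr_mono2) auto
      with yr have "(1/2) powr a * norm (\<phi> w) \<le> M + N / (1 - k)" by linarith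
      then have "2 powr a * ((1/2) powr a * norm (\<phi> w)) \<le> R" unfolding R_def by (intro mult_left_mono) auto
      moreover have "2 powr a * (1/2) powr a = (1::real)" by (simp flip: powr_mult)
      ultimately show ?thesis by (simp flip: mult.assoc)
    qed
  qed
qed

lemma phi_deriv_growth:
  obtains K where "0 < K" "\<And>w. norm w < 1 \<Longrightarrow> norm (deriv \<phi> w) \<le> K * (1 - norm w) powr (- k)"
proof -
  obtain K where K: "0 < K" "\<And>w. norm w < 1 \<Longrightarrow> norm (\<Psi> w) \<le> K * (1 - norm w) powr (- k)"
    using Psi_growth by blast
  obtain N where N: "\<And>w. norm w < 1 \<Longrightarrow> norm (\<phi> w) \<le> N" using phi_bounded by blast
  have N0: "0 \<le> N" using order_trans[OF norm_ge_zero N[of 0]] by simp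
  obtain M where M: "0 < M" "\<And>w. norm w \<le> 1/2 \<Longrightarrow> norm (deriv \<phi> w) \<le> M"
    using bounded_on_smaller_disc[OF holomorphic_deriv[OF hol_phi open_ball], of "1/2"] by auto
  show thesis
  proof (rule that[of "M + 2 * (\<mu> * K + norm \<alpha> * N)"])
    show "0 < M + 2 * (\<mu> * K + norm \<alpha> * N)" using M N0 K mu by (simp add: add_pos_nonneg)
    fix w :: complex assume w: "norm w < 1"
    have "(1 - norm w) powr k \<le> 1" using w k by (intro powr_le1) auto
    then have one: "1 \<le> (1 - norm w) powr (- k)" using w by (simp add: powr_minus field_simps)
    define p where "p = (1 - norm w) powr (- k)"
    show "norm (deriv \<phi> w) \<le> (M + 2 * (\<mu> * K + norm \<alpha> * N)) * (1 - norm w) powr (- k)"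
    proof (cases "norm w \<le> 1/2")
      case True
      have "M * 1 \<le> (M + 2 * (\<mu> * K + norm \<alpha> * N)) * p"
        using M N0 K mu one by (intro mult_mono) (auto simp: p_def)
      then show ?thesis using M(2)[OF True] by (simp add: p_def)
    next
      case False
      have "w * deriv \<phi> w = B w * \<Psi> w - \<alpha> * \<phi> w"
        using Psi_nz[OF w] by (simp add: B_def euler_quot_def)
      then have "norm w * norm (deriv \<phi> w) \<le> norm (B w) * norm (\<Psi> w) + norm \<alpha> * norm (\<phi> w)"
        by (metis norm_mult norm_triangle_ineq4)
      also have "\<dots> \<le> \<mu> * (K * p) + norm \<alpha> * N"
        using norm_B[OF w] K(2)[OF w] N[OF w] mu by (intro add_mono mult_mono) (auto simp: p_def)
      also have "norm \<alpha> * N \<le> norm \<alpha> * N * p"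
        using one N0 mult_left_mono[of 1 p "norm \<alpha> * N"] by (simp add: p_def)
      finally have 1: "norm w * norm (deriv \<phi> w) \<le> (\<mu> * K + norm \<alpha> * N) * p" by (simp add: algebra_simps)
      have "1/2 * norm (deriv \<phi> w) \<le> norm w * norm (deriv \<phi> w)"
        using False by (intro mult_right_mono) auto
      with 1 have "norm (deriv \<phi> w) \<le> 2 * ((\<mu> * K + norm \<alpha> * N) * p)" by linarith
      also have "\<dots> = 2 * (\<mu> * K + norm \<alpha> * N) * p" by simp
      also have "\<dots> \<le> (M + 2 * (\<mu> * K + norm \<alpha> * N)) * p"
        using M by (intro mult_right_mono) (auto simp: p_def)
      finally show ?thesis by (simp add: p_def)
    qed
  qed
qed

end

section \<open>The Loewner chain and its injectivity\<close>

lemma norm_exp_minus_1_left_half_plane: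
  fixes x :: complex
  assumes "Re x \<le> 0"
  shows "norm (exp x - 1) \<le> norm x"
proof -
  have "norm (exp x - exp 0) \<le> 1 * norm (x - 0)"
    by (rule field_differentiable_bound[of "{z. Re z \<le> 0}" exp exp])
       (use assms in \<open>auto intro: convex_halfspace_Re_le DERIV_exp DERIV_subset\<close>)
  then show ?thesis by simp
qed

lemma norm_exp_minus_1_unit_disc:
  fixes x :: complex
  assumes "norm x \<le> 1"
  shows "norm (exp x - 1) \<le> 3 * norm x"
proof -
  have "norm (exp x - exp 0) \<le> 3 * norm (x - 0)"
  proof (rule field_differentiable_bound[of "cball 0 1" exp exp])
    fix z :: complex assume "z \<in> cball 0 1"
    then have "Re z \<le> 1" using complex_Re_le_cmod[of z] by simp
    then have "norm (exp z) \<le> exp 1" by simp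
    also have "\<dots> \<le> 3" by (rule exp_le)
    finally show "norm (exp z) \<le> 3" .
  qed (use assms in \<open>auto intro: DERIV_exp DERIV_subset\<close>)
  then show ?thesis by simp
qed

context loewner_pair
begin

text \<open>
  The closed domain of the chain. Of the unit circle only the points \<open>(w,0)\<close> belong to it.
\<close>

definition wedge :: "(complex \<times> real) set" where
  "wedge = {p. 0 \<le> snd p \<and> norm (fst p) \<le> exp (- snd p)}"

lemma wedge_iff: "(w, t) \<in> wedge \<longleftrightarrow> 0 \<le> t \<and> norm w \<le> exp (- t)"
  by (simp add: wedge_def)

lemma wedge_norm_le: "(w, t) \<in> wedge \<Longrightarrow> norm w \<le> 1"
  by (auto simp: wedge_iff intro: order_trans)

lemma wedge_norm_less: "(w, t) \<in> wedge \<Longrightarrow> 0 < t \<Longrightarrow> norm w < 1"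
  by (auto simp: wedge_iff intro: le_less_trans)

definition phi_ext :: "complex \<Rightarrow> complex" where
  "phi_ext = (SOME v. continuous_on (cball 0 1) v \<and> (\<forall>w. norm w < 1 \<longrightarrow> v w = \<phi> w))"

lemma phi_ext: "continuous_on (cball 0 1) phi_ext" "norm w < 1 \<Longrightarrow> phi_ext w = \<phi> w"
proof -
  obtain K where K: "0 < K" "\<And>w. norm w < 1 \<Longrightarrow> norm (deriv \<phi> w) \<le> K * (1 - norm w) powr (- k)"
    using phi_deriv_growth by blast
  obtain v where "continuous_on (cball 0 1) v" "\<And>w. norm w < 1 \<Longrightarrow> v w = \<phi> w"
    using continuous_extension_to_closed_disc[OF hol_phi k less_imp_le[OF K(1)] K(2)] by blast
  then have "\<exists>v. continuous_on (cball 0 1) v \<and> (\<forall>w. norm w < 1 \<longrightarrow> v w = \<phi> w)" by blast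
  from someI_ex[OF this] show "continuous_on (cball 0 1) phi_ext" "norm w < 1 \<Longrightarrow> phi_ext w = \<phi> w"
    unfolding phi_ext_def by blast+
qed

definition A_ext :: "complex \<times> real \<Rightarrow> complex" where
  "A_ext p = phi_ext (fst p) + (of_real (exp (\<mu> * snd p)) - 1) * \<Psi> (fst p)"

lemma A_ext_eq: "norm w < 1 \<Longrightarrow> A_ext (w, t) = A w t"
  by (simp add: A_ext_def A_def phi_ext)

text \<open>
  The unit circle meets the wedge only at time 0, and there the factor \<open>exp(\<mu>t) - 1 = O(t)\<close> beats the
  growth \<open>(1 - |w|)\<^sup>-\<^sup>k \<le> (1 - exp(-t))\<^sup>-\<^sup>k = O(t\<^sup>-\<^sup>k)\<close> of \<open>\<Psi>\<close>.
\<close>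

lemma continuous_on_A_ext: "continuous_on wedge A_ext"
proof -
  have 1: "continuous_on wedge (\<lambda>p. phi_ext (fst p))"
    by (intro continuous_on_compose2[OF phi_ext(1)] continuous_intros) (auto dest: wedge_norm_le)
  let ?T = "\<lambda>p::complex \<times> real. (complex_of_real (exp (\<mu> * snd p)) - 1) * \<Psi> (fst p)"
  have "continuous_on wedge ?T"
    unfolding continuous_on_eq_continuous_within
  proof
    fix p assume p: "p \<in> wedge"
    obtain w t where wt: "p = (w, t)" by (cases p)
    show "continuous (at p within wedge) ?T"
    proof (cases "norm w < 1")
      case True
      have "continuous_on {p. norm (fst p) < 1} ?T"
        by (intro continuous_intros continuous_on_compose2[OF holomorphic_on_imp_continuous_on[OF hol_Psi]]) auto
      moreover have "open {p::complex \<times> real. norm (fst p) < 1}"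
        by (intro open_Collect_less continuous_intros)
      ultimately have "continuous (at p) ?T" using True by (simp add: continuous_on_eq_continuous_at wt)
      then show ?thesis by (rule continuous_at_imp_continuous_at_within)
    next
      case False
      then have n1: "norm w = 1" and t0: "t = 0"
        using p wedge_norm_le[of w t] wedge_norm_less[of w t] by (auto simp: wt wedge_iff)
      obtain K where K: "0 < K" "\<And>w. norm w < 1 \<Longrightarrow> norm (\<Psi> w) \<le> K * (1 - norm w) powr (- k)"
        using Psi_growth by blast
      let ?b = "\<lambda>t. K * \<mu> * exp ((\<mu> + k) * t) * t powr (1 - k)"
      have bd: "norm (?T q) \<le> ?b (snd q)" if q: "q \<in> wedge" for q
      proof (cases "snd q = 0")
        case True
        then show ?thesis using k by simp
      next
        case False
        obtain v s where vs: "q = (v, s)" by (cases q)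
        have s: "0 < s" "norm v \<le> exp (- s)" "norm v < 1"
          using q False wedge_norm_less[of v s] by (auto simp: vs wedge_iff)
        have "1 - norm v \<ge> 1 - exp (- s)" using s by simp
        moreover have "1 - exp (- s) \<ge> s * exp (- s)"
          using exp_ge_add_one_self[of s] by (simp add: exp_minus field_simps)
        ultimately have "(1 - norm v) powr (- k) \<le> (s * exp (- s)) powr (- k)"
          using k s by (intro powr_mono2') auto
        also have "\<dots> = s powr (- k) * exp (k * s)"
        proof -
          have "exp (- s) powr (- k) = exp (k * s)" by (simp add: powr_def)
          then show ?thesis using s by (simp only: powr_mult less_imp_le exp_ge_zero)
        qed
        finally have "norm (\<Psi> v) \<le> K * (s powr (- k) * exp (k * s))"
          using K(2)[OF s(3)] K(1) by (meson less_imp_le mult_left_mono order_trans)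
        moreover have "norm (complex_of_real (exp (\<mu> * s)) - 1) \<le> \<mu> * s * exp (\<mu> * s)"
        proof -
          have "norm (complex_of_real (exp (\<mu> * s)) - 1) = exp (\<mu> * s) - 1"
            using s mu by (metis abs_of_nonneg diff_ge_0_iff_ge less_imp_le mult_pos_pos norm_of_real of_real_1 of_real_diff one_le_exp_iff)
          also have "\<dots> \<le> \<mu> * s * exp (\<mu> * s)"
            using exp_ge_add_one_self[of "- (\<mu> * s)"] by (simp add: exp_minus field_simps)
          finally show ?thesis .
        qed
        ultimately have "norm (?T q) \<le> (\<mu> * s * exp (\<mu> * s)) * (K * (s powr (- k) * exp (k * s)))"
          unfolding vs norm_mult fst_conv snd_conv using s mu by (intro mult_mono) auto
        also have "\<dots> = ?b s"
          using s by (simp add: powr_diff powr_minus field_simps exp_add)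
        finally show ?thesis by (simp add: vs)
      qed
      have "continuous_on wedge (\<lambda>q. ?b (snd q))"
        using k by (intro continuous_on_mult continuous_on_const continuous_on_exp continuous_on_snd
           continuous_on_id continuous_on_powr') (auto simp: wedge_def)
      then have "((\<lambda>q. ?b (snd q)) \<longlongrightarrow> ?b (snd p)) (at p within wedge)"
        using p by (simp add: continuous_on_def)
      then have "((\<lambda>q. ?b (snd q)) \<longlongrightarrow> 0) (at p within wedge)"
        using k by (simp add: wt t0)
      moreover have "\<forall>\<^sub>F q in at p within wedge. norm (?T q) \<le> ?b (snd q)"
        using bd by (auto simp: eventually_at_filter)
      ultimately have "(?T \<longlongrightarrow> 0) (at p within wedge)"
        by (rule Lim_null_comparison[rotated])
      then show ?thesis by (simp add: continuous_within wt t0)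
    qed
  qed
  with 1 show ?thesis unfolding A_ext_def by (rule continuous_on_add)
qed

lemma A_ext_nz:
  assumes "p \<in> wedge"
  shows "A_ext p \<noteq> 0"
proof -
  obtain w t where wt: "p = (w, t)" by (cases p)
  show ?thesis
  proof (cases "norm w < 1")
    case True
    then show ?thesis using A_nz[of t w] assms by (simp add: wt A_ext_eq wedge_iff)
  next
    case False
    then have n1: "norm w = 1" and t0: "t = 0"
      using assms wedge_norm_le[of w t] wedge_norm_less[of w t] by (auto simp: wt wedge_iff)
    obtain \<delta> where d: "0 < \<delta>" "\<And>t w. \<lbrakk>0 \<le> t; t \<le> 1; norm w \<le> exp (- t); norm w < 1\<rbrakk> \<Longrightarrow> \<delta> \<le> norm (A w t)"
      using A_lower_bound by blast
    have "\<delta> \<le> norm (phi_ext z)" if "z \<in> ball 0 1" for z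
      using d(2)[of 0 z] that by (simp add: phi_ext A_def)
    moreover have "continuous_on (closure \<U>) (\<lambda>z. norm (phi_ext z))"
      using phi_ext(1) by (auto intro: continuous_intros)
    ultimately have "\<delta> \<le> norm (phi_ext w)"
      using continuous_ge_on_closure[of \<U> "\<lambda>z. norm (phi_ext z)" w \<delta>] n1 by simp
    then show ?thesis using d(1) by (auto simp: wt t0 A_ext_def)
  qed
qed

text \<open>
  The function \<open>exp(-t)\<close> decreases, so the wedge is starlike about \<open>(0,0)\<close>.
\<close>

lemma contractible_wedge: "contractible wedge"
proof (rule starlike_imp_contractible)
  show "starlike wedge" unfolding starlike_def
  proof (intro bexI ballI subsetI)
    show "(0, 0) \<in> wedge" by (simp add: wedge_iff)
    fix p q assume p: "p \<in> wedge" and q: "q \<in> closed_segment (0, 0) p"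
    obtain u where u: "0 \<le> u" "u \<le> 1" "q = u *\<^sub>R p"
      using q by (auto simp: closed_segment_def zero_prod_def[symmetric])
    have "u * norm (fst p) \<le> 1 * exp (- snd p)" using p u by (intro mult_mono) (auto simp: wedge_def)
    also have "\<dots> \<le> exp (- (u * snd p))" using p u by (simp add: wedge_def mult_left_le_one_le)
    finally show "q \<in> wedge" using p u by (simp add: wedge_def)
  qed
qed

text \<open>
  One continuous logarithm of \<open>A\<close> on the whole wedge fixes the branch of \<open>A\<^sup>1\<^sup>/\<^sup>\<alpha>\<close>, in agreement with the
  normalisation \<open>\<phi>(0) = 1\<close> at the origin.
\<close>

definition Lam :: "complex \<times> real \<Rightarrow> complex" where
  "Lam = (SOME l. continuous_on wedge l \<and> (\<forall>p\<in>wedge. exp (l p) = A_ext p) \<and> l (0, 0) = 0)"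

lemma Lam: "continuous_on wedge Lam" "p \<in> wedge \<Longrightarrow> exp (Lam p) = A_ext p" "Lam (0, 0) = 0"
proof -
  obtain g where g: "continuous_on wedge g" "\<And>p. p \<in> wedge \<Longrightarrow> A_ext p = exp (g p)"
    using continuous_logarithm_on_contractible[OF continuous_on_A_ext contractible_wedge] A_ext_nz by metis
  have "exp (g (0, 0)) = 1"
    using g(2)[of "(0, 0)"] by (simp add: wedge_iff A_ext_eq A_def phi_0)
  then have "continuous_on wedge (\<lambda>p. g p - g (0, 0)) \<and> (\<forall>p\<in>wedge. exp (g p - g (0, 0)) = A_ext p)
      \<and> g (0, 0) - g (0, 0) = 0"
    using g by (auto intro!: continuous_intros simp: exp_diff)
  then have "\<exists>l. continuous_on wedge l \<and> (\<forall>p\<in>wedge. exp (l p) = A_ext p) \<and> l (0, 0) = 0" by blast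
  from someI_ex[OF this] show "continuous_on wedge Lam" "p \<in> wedge \<Longrightarrow> exp (Lam p) = A_ext p" "Lam (0, 0) = 0"
    unfolding Lam_def by blast+
qed

lemma alpha_nz: "\<alpha> \<noteq> 0" using Re_alpha by auto

definition V :: "complex \<times> real \<Rightarrow> complex" where "V p = fst p * exp (Lam p / \<alpha>)"

lemma continuous_on_V: "continuous_on wedge V"
  unfolding V_def using alpha_nz by (intro continuous_intros Lam(1)) auto

text \<open>
  Transport of \<open>Lam(w0 exp(x), t) + \<alpha>x\<close> instead of its exponential, treated in \<open>transport_A\<close>, also keeps
  track of the branch; dividing by \<open>\<alpha>\<close> and exponentiating shows that \<open>V\<close> is constant.
\<close>

lemma transport_V_inner:
  assumes w0: "norm w0 < 1" "(w0, t0) \<in> wedge" and t: "t0 \<le> t1"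
  obtains x where "(x, t1) \<in> region t0 t1" "V (w0 * exp x, t1) = V (w0, t0)"
proof -
  have t0: "0 \<le> t0" "norm w0 \<le> exp (- t0)" using w0 by (auto simp: wedge_iff)
  let ?X = "transport_region \<kappa> C t0 t1"
  let ?H = "\<lambda>p. Lam (w0 * exp (fst p), snd p) + \<alpha> * fst p"
  note reg = region_norm_fibre[OF _ t0, unfolded region_def]
  have in_wedge: "(w0 * exp x, t) \<in> wedge" and in_disc: "norm (w0 * exp x) < 1" if "(x, t) \<in> ?X" for x t
    using reg[OF that] w0 by (auto simp: wedge_iff)
  have cont: "continuous_on ?X ?H"
    by (intro continuous_intros continuous_on_compose2[OF Lam(1)]) (use in_wedge in auto)
  have "\<exists>x. (x, t1) \<in> ?X \<and> ?H (x, t1) = ?H (0, t0)"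
  proof (rule transport[OF cont])
    fix x t assume xt: "(x, t) \<in> ?X"
    have f: "0 \<le> t" "norm (w0 * exp x) \<le> exp (- t)" "norm (w0 * exp x) < 1"
      using in_wedge[OF xt] in_disc[OF xt] by (auto simp: wedge_iff)
    let ?c = "exp (\<alpha> * x) * of_real (exp (\<mu> * t)) * \<Psi> (w0 * exp x)"
    have "((\<lambda>p. exp (?H p)) has_derivative (\<lambda>(y, s). ?c * (D t (w0 * exp x) * y + of_real s * of_real \<mu>)))
        (at (x, t) within ?X)"
    proof (rule has_derivative_transform[OF xt _ transported_A_derivative[OF f(3), of t ?X]])
      fix p assume "p \<in> ?X"
      then have "(fst p, snd p) \<in> ?X" by simp
      from in_wedge[OF this] in_disc[OF this]
      show "exp (?H p) = A (w0 * exp (fst p)) (snd p) * exp (\<alpha> * fst p)"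
        by (simp add: exp_add Lam(2) A_ext_eq)
    qed
    then have "(?H has_derivative (\<lambda>p. (case p of (y, s) \<Rightarrow> ?c * (D t (w0 * exp x) * y + of_real s * of_real \<mu>)) / exp (?H (x, t))))
        (at (x, t) within ?X)"
      using cont xt by (intro has_derivative_of_exp) (auto simp: continuous_on_eq_continuous_within)
    moreover let ?a = "?c * D t (w0 * exp x) / exp (?H (x, t))"
    have "(case p of (y, s) \<Rightarrow> ?c * (D t (w0 * exp x) * y + of_real s * of_real \<mu>)) / exp (?H (x, t))
       = (case p of (y, s) \<Rightarrow> ?a * (y + of_real s * q t (w0 * exp x)))" for p
      using D_nz[OF f] by (cases p) (simp add: q_def field_simps)
    ultimately have "(?H has_derivative (\<lambda>(y, s). ?a * (y + of_real s * q t (w0 * exp x)))) (at (x, t) within ?X)"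
      by (simp only:)
    moreover have "?a \<noteq> 0" using Psi_nz[OF f(3)] D_nz[OF f] by simp
    ultimately show "\<exists>a q. a \<noteq> 0 \<and> \<kappa> < Re q \<and> norm q < C \<and>
         (?H has_derivative (\<lambda>(y, s). a * (y + of_real s * q))) (at (x, t) within ?X)"
      using Re_q[OF f] norm_q[OF f] by blast
  qed (use C_pos t in auto)
  then obtain x where x: "(x, t1) \<in> ?X" "Lam (w0 * exp x, t1) + \<alpha> * x = Lam (w0, t0)" by auto
  have "V (w0 * exp x, t1) = w0 * exp (x + Lam (w0 * exp x, t1) / \<alpha>)"
    by (simp add: V_def exp_add)
  also have "x + Lam (w0 * exp x, t1) / \<alpha> = (Lam (w0 * exp x, t1) + \<alpha> * x) / \<alpha>"
    using alpha_nz by (simp add: field_simps)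
  also have "w0 * exp ((Lam (w0 * exp x, t1) + \<alpha> * x) / \<alpha>) = V (w0, t0)"
    using x(2) by (simp add: V_def)
  finally show thesis using that[of x] x(1) by (simp add: region_def)
qed

lemma region_dist:
  assumes "(x, t1) \<in> region t0 t1" "norm w0 \<le> 1" "t0 \<le> t1"
  shows "norm (w0 * exp x - w0) \<le> C * (t1 - t0)"
proof -
  have x: "Re x \<le> - \<kappa> * (t1 - t0)" "norm x \<le> C * (t1 - t0)"
    using assms(1) by (auto simp: region_def transport_region_def)
  have "0 \<le> \<kappa> * (t1 - t0)" using kappa_gt_1 assms(3) by simp
  then have "Re x \<le> 0" using x(1) by simp
  have "norm (w0 * exp x - w0) = norm w0 * norm (exp x - 1)" by (simp add: algebra_simps flip: norm_mult)
  also have "\<dots> \<le> 1 * norm x"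
    using assms(2) norm_exp_minus_1_left_half_plane[OF \<open>Re x \<le> 0\<close>] by (intro mult_mono) auto
  finally show ?thesis using x(2) by simp
qed

text \<open>
  Transport from a point of the unit circle is obtained as a limit of transports from the inner
  points \<open>(exp(-e) w0, e)\<close> with \<open>e\<close> tending to 0. The estimates in \<open>transport_region\<close> are uniform and
  survive in the limit.
\<close>

lemma transport_V:
  assumes p: "(w0, t0) \<in> wedge" and t: "t0 < t1"
  obtains w1 where "V (w1, t1) = V (w0, t0)" "norm w1 < exp (- t1)" "norm (w1 - w0) \<le> C * (t1 - t0)"
proof (cases "norm w0 < 1")
  case True
  have t0: "0 \<le> t0" "norm w0 \<le> exp (- t0)" using p by (auto simp: wedge_iff)
  obtain x where x: "(x, t1) \<in> region t0 t1" "V (w0 * exp x, t1) = V (w0, t0)"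
    using transport_V_inner[OF True p less_imp_le[OF t]] by blast
  show thesis
    by (rule that[of "w0 * exp x"]) (use x region_norm_fibre(7)[OF x(1) t0] t True region_dist[OF x(1), of w0] in auto)
next
  case False
  then have n1: "norm w0 = 1" and t0: "t0 = 0"
    using p wedge_norm_le[OF p] wedge_norm_less[OF p] by (auto simp: wedge_iff)
  have t1: "0 < t1" using t t0 by simp
  define e where "e n = t1 / (real n + 2)" for n
  have e: "0 < e n" "e n < t1" for n
  proof -
    show "0 < e n" using t1 by (simp add: e_def)
    have "t1 / (real n + 2) < t1 / 1" using t1 by (intro divide_strict_left_mono) auto
    then show "e n < t1" by (simp add: e_def)
  qed
  have elim: "e \<longlonglongrightarrow> 0" unfolding e_def by real_asymp
  define z where "z n = of_real (exp (- e n)) * w0" for n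
  have nz: "norm (z n) = exp (- e n)" for n using n1 by (simp add: z_def norm_mult)
  have zc: "(z n, e n) \<in> wedge" "norm (z n) < 1" for n using e[of n] by (auto simp: wedge_iff nz)
  have "\<exists>x. (x, t1) \<in> region (e n) t1 \<and> V (z n * exp x, t1) = V (z n, e n)" for n
    using transport_V_inner[OF zc(2) zc(1), of n t1] e[of n] by (metis less_imp_le)
  then obtain x where x: "\<And>n. (x n, t1) \<in> region (e n) t1" "\<And>n. V (z n * exp (x n), t1) = V (z n, e n)"
    by metis
  define y where "y n = z n * exp (x n)" for n
  have yn: "norm (y n) \<le> exp (- e n) * exp (- \<kappa> * (t1 - e n))" for n
    using region_norm[OF x(1), of "z n" n] by (simp add: y_def nz)
  have yc: "norm (y n) \<le> exp (- t1)" for n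
    using region_norm_fibre(4)[OF x(1)[of n], of "z n"] e[of n] by (simp add: y_def nz)
  have yd: "norm (y n - z n) \<le> C * (t1 - e n)" for n
    using region_dist[OF x(1)[of n], of "z n"] e[of n] by (simp add: y_def nz)
  obtain w1 r where r: "strict_mono r" "(y \<circ> r) \<longlonglongrightarrow> w1"
    using compact_cball[of 0 "exp (- t1)"] yc unfolding compact_def by (metis mem_cball_0)
  have er: "(e \<circ> r) \<longlonglongrightarrow> 0" using LIMSEQ_subseq_LIMSEQ[OF elim r(1)] .
  have zlim: "z \<longlonglongrightarrow> of_real (exp (- 0)) * w0" unfolding z_def by (intro tendsto_intros elim)
  have zr: "(z \<circ> r) \<longlonglongrightarrow> w0" using LIMSEQ_subseq_LIMSEQ[OF zlim r(1)] by simp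
  have w1c: "norm w1 \<le> exp (- t1)"
    by (rule Lim_norm_ubound[OF _ r(2)]) (auto simp: yc)
  have "(\<lambda>n. V ((y \<circ> r) n, t1)) \<longlonglongrightarrow> V (w1, t1)"
    by (rule continuous_on_tendsto_compose[OF continuous_on_V, of "\<lambda>n. ((y \<circ> r) n, t1)" "(w1, t1)"])
       (use t1 w1c yc in \<open>auto intro!: tendsto_Pair r(2)[unfolded o_def] simp: wedge_iff\<close>)
  moreover have "(\<lambda>n. V ((z \<circ> r) n, (e \<circ> r) n)) \<longlonglongrightarrow> V (w0, 0)"
    by (rule continuous_on_tendsto_compose[OF continuous_on_V, of "\<lambda>n. ((z \<circ> r) n, (e \<circ> r) n)" "(w0, 0)"])
       (use zc n1 in \<open>auto intro!: tendsto_Pair zr[unfolded o_def] er[unfolded o_def] simp: wedge_iff\<close>)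
  moreover have "(\<lambda>n. V ((y \<circ> r) n, t1)) = (\<lambda>n. V ((z \<circ> r) n, (e \<circ> r) n))"
    using x(2) by (auto simp: y_def)
  ultimately have 1: "V (w1, t1) = V (w0, 0)" using LIMSEQ_unique by metis
  have "(\<lambda>n. norm ((y \<circ> r) n)) \<longlonglongrightarrow> norm w1" by (intro tendsto_intros r(2))
  moreover have "(\<lambda>n. exp (- (e \<circ> r) n) * exp (- \<kappa> * (t1 - (e \<circ> r) n))) \<longlonglongrightarrow> exp (- 0) * exp (- \<kappa> * (t1 - 0))"
    by (intro tendsto_intros er)
  ultimately have "norm w1 \<le> exp (- 0) * exp (- \<kappa> * (t1 - 0))"
    by (rule LIMSEQ_le) (use yn in auto)
  also have "\<dots> < exp (- t1)" using kappa_gt_1 t1 by simp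
  finally have 2: "norm w1 < exp (- t1)" .
  have "(\<lambda>n. norm ((y \<circ> r) n - (z \<circ> r) n)) \<longlonglongrightarrow> norm (w1 - w0)" by (intro tendsto_intros r(2) zr)
  moreover have "(\<lambda>n. C * (t1 - (e \<circ> r) n)) \<longlonglongrightarrow> C * (t1 - 0)" by (intro tendsto_intros er)
  ultimately have 3: "norm (w1 - w0) \<le> C * (t1 - 0)"
    by (rule LIMSEQ_le) (use yd in auto)
  show thesis using that[of w1] 1 2 3 by (simp add: t0)
qed

text \<open>
  The partial derivative of \<open>V\<close> in \<open>w\<close>, which is nonzero because \<open>\<Psi>\<close> and \<open>D\<close> are.
\<close>

definition V_w :: "complex \<times> real \<Rightarrow> complex" where
  "V_w p = exp (Lam p / \<alpha>) * (of_real (exp (\<mu> * snd p)) * \<Psi> (fst p) * D (snd p) (fst p) / (\<alpha> * A (fst p) (snd p)))"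

lemma Lam_derivative:
  assumes p: "p \<in> X" and X: "\<And>x. x \<in> X \<Longrightarrow> (w x, \<tau> x) \<in> wedge \<and> norm (w x) < 1"
    and w: "(w has_derivative w') (at p within X)" and \<tau>: "(\<tau> has_derivative \<tau>') (at p within X)"
  shows "((\<lambda>x. Lam (w x, \<tau> x)) has_derivative
     (\<lambda>h. (A_w (w p) (\<tau> p) * w' h + of_real (\<mu> * exp (\<mu> * \<tau> p) * \<tau>' h) * \<Psi> (w p)) / A (w p) (\<tau> p))) (at p within X)"
proof -
  have exp_Lam: "exp (Lam (w x, \<tau> x)) = A (w x) (\<tau> x)" if "x \<in> X" for x
    using X[OF that] by (simp add: Lam(2) A_ext_eq)
  have "((\<lambda>x. (w x, \<tau> x)) \<longlongrightarrow> (w p, \<tau> p)) (at p within X)"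
    using has_derivative_continuous[OF w] has_derivative_continuous[OF \<tau>]
    by (auto intro!: tendsto_Pair simp: continuous_within)
  then have "((\<lambda>x. Lam (w x, \<tau> x)) \<longlongrightarrow> Lam (w p, \<tau> p)) (at p within X)"
    by (rule continuous_on_tendsto_compose[OF Lam(1)])
      (use X X[OF p] in \<open>auto simp: eventually_at_filter\<close>)
  then have "continuous (at p within X) (\<lambda>x. Lam (w x, \<tau> x))" by (simp add: continuous_within)
  moreover have "((\<lambda>x. exp (Lam (w x, \<tau> x))) has_derivative
     (\<lambda>h. A_w (w p) (\<tau> p) * w' h + of_real (\<mu> * exp (\<mu> * \<tau> p) * \<tau>' h) * \<Psi> (w p))) (at p within X)"
    by (rule has_derivative_transform[OF p exp_Lam A_derivative[OF _ w \<tau>]]) (use X[OF p] in auto)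
  ultimately show ?thesis
    using has_derivative_of_exp[OF _ p] by (fastforce simp: exp_Lam[OF p])
qed

text \<open>
  The Loewner equation \<open>V\<^sub>t = q w V\<^sub>w\<close>, stated along arbitrary curves and surfaces in the wedge so that it
  covers the fibres \<open>t = const\<close> and the boundary \<open>|w| = exp(-t)\<close> alike.
\<close>

lemma V_derivative:
  assumes p: "p \<in> X" and X: "\<And>x. x \<in> X \<Longrightarrow> (w x, \<tau> x) \<in> wedge \<and> norm (w x) < 1"
    and w: "(w has_derivative w') (at p within X)" and \<tau>: "(\<tau> has_derivative \<tau>') (at p within X)"
  shows "((\<lambda>x. V (w x, \<tau> x)) has_derivative
     (\<lambda>h. V_w (w p, \<tau> p) * (w' h + w p * q (\<tau> p) (w p) * of_real (\<tau>' h)))) (at p within X)"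
proof -
  have w1: "norm (w p) < 1" and c: "0 \<le> \<tau> p" "norm (w p) \<le> exp (- \<tau> p)" using X[OF p] by (auto simp: wedge_iff)
  define a where "a = A (w p) (\<tau> p)"
  define L where "L h = (A_w (w p) (\<tau> p) * w' h + of_real (\<mu> * exp (\<mu> * \<tau> p) * \<tau>' h) * \<Psi> (w p)) / a" for h
  have a: "a \<noteq> 0" using A_nz[OF c w1] by (simp add: a_def)
  have "((\<lambda>x. Lam (w x, \<tau> x)) has_derivative L) (at p within X)"
    unfolding L_def a_def by (rule Lam_derivative[OF p X w \<tau>])
  then have "((\<lambda>x. Lam (w x, \<tau> x) * inverse \<alpha>) has_derivative (\<lambda>h. L h * inverse \<alpha>)) (at p within X)"
    by (rule has_derivative_mult_left)
  from has_derivative_compose[OF this has_field_derivative_imp_has_derivative[OF DERIV_exp]]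
  have "((\<lambda>x. exp (Lam (w x, \<tau> x) / \<alpha>)) has_derivative
      (\<lambda>h. exp (Lam (w p, \<tau> p) / \<alpha>) * (L h / \<alpha>))) (at p within X)"
    by (simp add: divide_inverse)
  from has_derivative_mult[OF w this]
  have "((\<lambda>x. V (w x, \<tau> x)) has_derivative (\<lambda>h. w p * (exp (Lam (w p, \<tau> p) / \<alpha>) * (L h / \<alpha>))
        + w' h * exp (Lam (w p, \<tau> p) / \<alpha>))) (at p within X)"
    by (simp add: V_def)
  moreover have "w p * (exp (Lam (w p, \<tau> p) / \<alpha>) * (L h / \<alpha>)) + w' h * exp (Lam (w p, \<tau> p) / \<alpha>)
     = V_w (w p, \<tau> p) * (w' h + w p * q (\<tau> p) (w p) * of_real (\<tau>' h))" for h
  proof -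
    define E where "E = exp (Lam (w p, \<tau> p) / \<alpha>)"
    have "w p * (E * (L h / \<alpha>)) + w' h * E = E / (\<alpha> * a) * (\<alpha> * a * w' h + w p * (L h * a))"
      using a alpha_nz by (simp add: field_simps)
    also have "L h * a = A_w (w p) (\<tau> p) * w' h + of_real (\<mu> * exp (\<mu> * \<tau> p) * \<tau>' h) * \<Psi> (w p)"
      using a by (simp add: L_def)
    also have "\<alpha> * a * w' h + w p * (A_w (w p) (\<tau> p) * w' h + of_real (\<mu> * exp (\<mu> * \<tau> p) * \<tau>' h) * \<Psi> (w p))
       = (\<alpha> * a + w p * A_w (w p) (\<tau> p)) * w' h + w p * (of_real \<mu> * of_real (exp (\<mu> * \<tau> p)) * of_real (\<tau>' h) * \<Psi> (w p))"
      by (simp add: algebra_simps)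
    also have "\<alpha> * a + w p * A_w (w p) (\<tau> p) = of_real (exp (\<mu> * \<tau> p)) * \<Psi> (w p) * D (\<tau> p) (w p)"
      using A_euler[OF w1] by (simp add: a_def)
    also have "E / (\<alpha> * a) * (of_real (exp (\<mu> * \<tau> p)) * \<Psi> (w p) * D (\<tau> p) (w p) * w' h
         + w p * (of_real \<mu> * of_real (exp (\<mu> * \<tau> p)) * of_real (\<tau>' h) * \<Psi> (w p)))
       = V_w (w p, \<tau> p) * (w' h + w p * q (\<tau> p) (w p) * of_real (\<tau>' h))"
      using D_nz[OF c w1] a alpha_nz by (simp add: V_w_def q_def E_def field_simps flip: a_def)
    finally show ?thesis by (simp only: E_def)
  qed
  ultimately show ?thesis by simp
qed

lemma Lam_fibre_derivative:
  assumes p: "(w, t) \<in> wedge" and w: "norm w < 1"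
  shows "((\<lambda>w. Lam (w, t)) has_field_derivative A_w w t / A w t) (at w within cball 0 (exp (- t)) \<inter> \<U>)"
proof -
  have "((\<lambda>w. Lam (w, t)) has_derivative (\<lambda>h. (A_w w t * h + of_real (\<mu> * exp (\<mu> * t) * 0) * \<Psi> w) / A w t))
      (at w within cball 0 (exp (- t)) \<inter> \<U>)"
    by (rule Lam_derivative) (use p w in \<open>auto simp: wedge_iff\<close>)
  moreover have "(\<lambda>h. (A_w w t * h + of_real (\<mu> * exp (\<mu> * t) * 0) * \<Psi> w) / A w t) = (*) (A_w w t / A w t)"
    by (auto simp: fun_eq_iff)
  ultimately show ?thesis by (simp only: has_field_derivative_def)
qed

lemma V_fibre_derivative:
  assumes p: "(w, t) \<in> wedge" and w: "norm w < 1"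
  shows "((\<lambda>w. V (w, t)) has_field_derivative V_w (w, t)) (at w within cball 0 (exp (- t)) \<inter> \<U>)"
proof -
  have "((\<lambda>w. V (w, t)) has_derivative (\<lambda>h. V_w (w, t) * (h + w * q t w * of_real 0)))
      (at w within cball 0 (exp (- t)) \<inter> \<U>)"
    by (rule V_derivative) (use p w in \<open>auto simp: wedge_iff\<close>)
  then show ?thesis by (simp add: has_field_derivative_def)
qed

lemma V_w_nz: "(w, t) \<in> wedge \<Longrightarrow> norm w < 1 \<Longrightarrow> V_w (w, t) \<noteq> 0"
  using D_nz[of t w] A_nz[of t w] Psi_nz[of w] alpha_nz by (simp add: V_w_def wedge_iff)

lemma continuous_on_V_w: "continuous_on (wedge \<inter> {p. norm (fst p) < 1}) V_w"
proof -
  have h: "continuous_on (wedge \<inter> {p. norm (fst p) < 1}) (\<lambda>p. f (fst p))" if "f holomorphic_on \<U>" for f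
    by (intro continuous_on_compose2[OF holomorphic_on_imp_continuous_on[OF that]] continuous_intros) auto
  show ?thesis unfolding V_w_def D_def
    by (intro continuous_intros h hol_Psi hol_B hol_Q continuous_on_subset[OF continuous_on_A] continuous_on_subset[OF Lam(1)])
       (use A_nz alpha_nz in \<open>auto simp: wedge_def\<close>)
qed

text \<open>
  The radius does not depend on the time: on the convex sets \<open>cball 0 (exp (- t)) \<inter> ball w0 \<epsilon>\<close> the
  function \<open>V\<close> differs from a linear bijection by a map with half its Lipschitz constant.
\<close>

lemma V_locally_injective:
  assumes p: "(w0, t0) \<in> wedge" "norm w0 < 1"
  obtains \<epsilon> where "0 < \<epsilon>" "\<And>w1 w2 t. \<lbrakk>\<bar>t - t0\<bar> < \<epsilon>; norm (w1 - w0) < \<epsilon>; norm (w2 - w0) < \<epsilon>;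
     (w1, t) \<in> wedge; (w2, t) \<in> wedge; V (w1, t) = V (w2, t)\<rbrakk> \<Longrightarrow> w1 = w2"
proof -
  define a where "a = V_w (w0, t0)"
  have a: "a \<noteq> 0" using V_w_nz[OF p] by (simp add: a_def)
  have pS: "(w0, t0) \<in> wedge \<inter> {p. norm (fst p) < 1}" using p by simp
  obtain d where d: "0 < d" "\<And>p. \<lbrakk>p \<in> wedge \<inter> {p. norm (fst p) < 1}; dist p (w0, t0) < d\<rbrakk> \<Longrightarrow> dist (V_w p) a < norm a / 2"
    using continuous_on_V_w pS a unfolding continuous_on_iff a_def by (metis half_gt_zero_iff zero_less_norm_iff)
  define \<epsilon> where "\<epsilon> = min (d / 2) (1 - norm w0)"
  have e: "0 < \<epsilon>" using d p by (simp add: \<epsilon>_def)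
  have e2: "\<epsilon> \<le> d / 2" "\<epsilon> \<le> 1 - norm w0" unfolding \<epsilon>_def by (rule min.cobounded1, rule min.cobounded2)
  show thesis
  proof (rule that[OF e])
    fix w1 w2 t assume h: "\<bar>t - t0\<bar> < \<epsilon>" "norm (w1 - w0) < \<epsilon>" "norm (w2 - w0) < \<epsilon>"
      "(w1, t) \<in> wedge" "(w2, t) \<in> wedge" "V (w1, t) = V (w2, t)"
    let ?S = "cball 0 (exp (- t)) \<inter> ball w0 \<epsilon>"
    have t: "0 \<le> t" using h by (simp add: wedge_iff)
    have disc: "norm w < 1" if "w \<in> ball w0 \<epsilon>" for w
      using that e2 norm_triangle_sub[of w w0] by (simp add: dist_norm norm_minus_commute)
    have "norm ((V (w1, t) - a * w1) - (V (w2, t) - a * w2)) \<le> norm a / 2 * norm (w1 - w2)"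
    proof (rule field_differentiable_bound[of ?S "\<lambda>w. V (w, t) - a * w" "\<lambda>w. V_w (w, t) - a"])
      show "convex ?S" by (intro convex_Int convex_cball convex_ball)
      fix w assume w: "w \<in> ?S"
      then have wc: "(w, t) \<in> wedge" and w1: "norm w < 1" using t disc by (auto simp: wedge_iff)
      have "((\<lambda>w. V (w, t)) has_field_derivative V_w (w, t)) (at w within ?S)"
        by (rule DERIV_subset[OF V_fibre_derivative[OF wc w1]]) (use disc in auto)
      then show "((\<lambda>w. V (w, t) - a * w) has_field_derivative V_w (w, t) - a) (at w within ?S)"
        by (auto intro!: derivative_eq_intros)
      have "dist (w, t) (w0, t0) \<le> norm (w - w0) + \<bar>t - t0\<bar>"
        using norm_Pair_le[of "w - w0" "t - t0"] by (simp add: dist_norm)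
      also have "\<dots> < d" using w h(1) e2 by (simp add: dist_norm norm_minus_commute)
      finally have "dist (V_w (w, t)) a < norm a / 2" using d(2)[of "(w, t)"] wc w1 by simp
      then show "norm (V_w (w, t) - a) \<le> norm a / 2" by (simp add: dist_norm)
    qed (use h in \<open>auto simp: wedge_iff dist_norm norm_minus_commute\<close>)
    then have "norm (a * (w2 - w1)) \<le> norm a / 2 * norm (w1 - w2)" by (simp add: h(6) algebra_simps)
    then have "norm a * norm (w1 - w2) \<le> norm a * (norm (w1 - w2) / 2)" by (simp add: norm_mult norm_minus_commute)
    then have "norm (w1 - w2) \<le> norm (w1 - w2) / 2" using a by simp
    then show "w1 = w2" by simp
  qed
qed

text \<open>
  For large \<open>t\<close>, \<open>V(w,t) = w exp(j(w))\<close> with \<open>j'\<close> bounded by \<open>K\<close>, on a disc whose radius is small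
  compared with \<open>1/K\<close>. Equal values at \<open>w1\<close> and \<open>w2\<close> then satisfy
  \<open>|w1 - w2| = |w2| |exp(j(w2) - j(w1)) - 1| < |w1 - w2|\<close> unless \<open>w1 = w2\<close>.
\<close>

lemma V_injective_late:
  obtains T where "0 < T" "\<And>t. T \<le> t \<Longrightarrow> inj_on (\<lambda>w. V (w, t)) (cball 0 (exp (- t)))"
proof -
  obtain T0 K0 where TK: "0 < T0" "0 < K0" and b: "\<And>t w. \<lbrakk>T0 \<le> t; norm w \<le> 1/2\<rbrakk> \<Longrightarrow> A w t \<noteq> 0 \<and>
     norm (A_w w t) \<le> K0 * norm (A w t)"
    using late_bounds by blast
  define K where "K = K0 / norm \<alpha>"
  have K: "0 < K" using TK alpha_nz by (simp add: K_def)
  \<comment> \<open>The last entry makes \<open>exp (- t) * 4 * K < 1\<close>, because \<open>exp t \<ge> 1 + t\<close>.\<close>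
  define T where "T = max (max T0 1) (4 * K)"
  have T: "T0 \<le> T" "1 \<le> T" "4 * K \<le> T" by (auto simp: T_def)
  show thesis
  proof (rule that[of T])
    show "0 < T" using T by simp
    fix t assume t: "T \<le> t"
    define \<rho> where "\<rho> = exp (- t)"
    have "exp t \<ge> 1 + t" by (rule exp_ge_add_one_self)
    then have "\<rho> \<le> 1 / (1 + t)" using t T by (simp add: \<rho>_def exp_minus field_simps)
    also have "\<dots> \<le> 1 / 2" using t T by simp
    finally have r2: "\<rho> \<le> 1/2" .
    have "\<rho> \<le> 1 / (1 + t)" using \<open>exp t \<ge> 1 + t\<close> t T by (simp add: \<rho>_def exp_minus field_simps)
    then have "\<rho> * (1 + t) \<le> 1" using t T by (simp add: field_simps)
    moreover have "\<rho> * (4 * K) < \<rho> * (1 + t)" using t T by (intro mult_strict_left_mono) (auto simp: \<rho>_def)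
    ultimately have rK: "\<rho> * (4 * K) < 1" by simp
    have r0: "0 < \<rho>" by (simp add: \<rho>_def)
    have tpos: "0 \<le> t" using t T by simp
    show "inj_on (\<lambda>w. V (w, t)) (cball 0 (exp (- t)))"
    proof (rule inj_onI)
      fix w1 w2 assume w: "w1 \<in> cball 0 (exp (- t))" "w2 \<in> cball 0 (exp (- t))" and eq: "V (w1, t) = V (w2, t)"
      let ?j = "\<lambda>w. Lam (w, t) / \<alpha>"
      have "norm (?j w2 - ?j w1) \<le> K * norm (w2 - w1)"
      proof (rule field_differentiable_bound[of "cball 0 \<rho>" ?j
          "\<lambda>w. A_w w t / A w t / \<alpha>"])
        fix w :: complex assume "w \<in> cball 0 \<rho>"
        then have w: "norm w \<le> \<rho>" "norm w \<le> 1/2" using r2 by auto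
        have "cball 0 \<rho> \<subseteq> cball 0 (exp (- t)) \<inter> \<U>" using r2 by (auto simp: \<rho>_def)
        then have "((\<lambda>w. Lam (w, t)) has_field_derivative
           A_w w t / A w t) (at w within cball 0 \<rho>)"
          using w tpos by (intro DERIV_subset[OF Lam_fibre_derivative]) (auto simp: wedge_iff \<rho>_def)
        then show "(?j has_field_derivative A_w w t / A w t / \<alpha>) (at w within cball 0 \<rho>)"
          by (rule DERIV_cdivide)
        show "norm (A_w w t / A w t / \<alpha>) \<le> K"
        proof -
          have "norm (A_w w t) / norm (A w t) \<le> K0"
            using b[of t w] w t T by (subst pos_divide_le_eq) auto
          then show ?thesis unfolding K_def norm_divide by (rule divide_right_mono) simp
        qed
      qed (use w in \<open>auto simp: \<rho>_def\<close>)
      then have j: "norm (?j w2 - ?j w1) \<le> K * norm (w1 - w2)" by (simp add: norm_minus_commute)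
      have n: "norm w1 \<le> \<rho>" "norm w2 \<le> \<rho>" using w by (auto simp: \<rho>_def)
      have d2: "norm (w1 - w2) \<le> 2 * \<rho>" using norm_triangle_ineq4[of w1 w2] n by simp
      have "K * norm (w1 - w2) \<le> K * (2 * \<rho>)" using K d2 by (intro mult_left_mono) auto
      also have "\<dots> \<le> 1" using rK K r0 by (simp add: mult.commute mult.left_commute)
      finally have "norm (exp (?j w2 - ?j w1) - 1) \<le> 3 * norm (?j w2 - ?j w1)"
        using j by (intro norm_exp_minus_1_unit_disc) simp
      also have "\<dots> \<le> 3 * (K * norm (w1 - w2))" using j by simp
      finally have ex: "norm (exp (?j w2 - ?j w1) - 1) \<le> 3 * (K * norm (w1 - w2))" .
      have "w1 = w2 * exp (?j w2 - ?j w1)"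
        using eq by (simp add: V_def exp_diff field_simps)
      then have "w1 - w2 = w2 * (exp (?j w2 - ?j w1) - 1)" by (simp add: algebra_simps)
      then have "norm (w1 - w2) = norm w2 * norm (exp (?j w2 - ?j w1) - 1)" by (metis norm_mult)
      also have "\<dots> \<le> \<rho> * (3 * (K * norm (w1 - w2)))" using ex n r0 by (intro mult_mono) auto
      finally have "norm (w1 - w2) \<le> (\<rho> * (3 * K)) * norm (w1 - w2)" by (simp add: algebra_simps)
      moreover have "\<rho> * (3 * K) < 1" using rK mult_pos_pos[OF r0 K] by simp
      ultimately show "w1 = w2"
        by (metis eq_iff_diff_eq_0 linorder_not_le mult_less_cancel_right2 norm_le_zero_iff)
    qed
  qed
qed

text \<open>
  Let \<open>s\<close> be the supremum of the times at which injectivity fails. At \<open>s\<close> it holds: two points with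
  equal values at time \<open>s\<close> could be transported to a slightly later time without merging. Pairs of
  points with equal values, at times tending to \<open>s\<close> from below, accumulate at a pair with equal
  values at time \<open>s\<close>, hence at a single point. This contradicts local injectivity.
\<close>

lemma V_injective:
  assumes "0 < t"
  shows "inj_on (\<lambda>w. V (w, t)) (cball 0 (exp (- t)))"
proof (rule ccontr)
  let ?I = "\<lambda>t. inj_on (\<lambda>w. V (w, t)) (cball 0 (exp (- t)))"
  assume neg: "\<not> ?I t"
  obtain T where T: "0 < T" "\<And>t. T \<le> t \<Longrightarrow> ?I t" using V_injective_late by blast
  define N where "N = {s. t \<le> s \<and> \<not> ?I s}"
  have tN: "t \<in> N" using neg by (simp add: N_def)
  have bdd: "bdd_above N" 
  proof (rule bdd_aboveI[of _ T])
    show "x \<le> T" if "x \<in> N" for x using that T(2)[of x] by (cases "T \<le> x") (auto simp: N_def)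
  qed
  define s where "s = Sup N"
  have ts: "t \<le> s" unfolding s_def using tN bdd by (rule cSup_upper)
  have later: "?I r" if "s < r" for r
  proof (rule ccontr)
    assume "\<not> ?I r"
    then have "r \<in> N" using that ts by (simp add: N_def)
    from cSup_upper[OF this bdd] that show False by (simp add: s_def)
  qed
  have Is: "?I s"
  proof (rule inj_onI, rule ccontr)
    fix w1 w2 assume w: "w1 \<in> cball 0 (exp (- s))" "w2 \<in> cball 0 (exp (- s))" "V (w1, s) = V (w2, s)" "w1 \<noteq> w2"
    \<comment> \<open>In time \<open>h\<close> each point moves by at most a quarter of the distance.\<close>
    define h where "h = norm (w1 - w2) / (4 * C)"
    have h: "0 < h" using w C_pos by (simp add: h_def)
    have c: "(w1, s) \<in> wedge" "(w2, s) \<in> wedge" using w ts assms by (auto simp: wedge_iff)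
    obtain v1 where v1: "V (v1, s + h) = V (w1, s)" "norm v1 < exp (- (s + h))" "norm (v1 - w1) \<le> C * h"
      using transport_V[OF c(1), of "s + h"] h by auto
    obtain v2 where v2: "V (v2, s + h) = V (w2, s)" "norm v2 < exp (- (s + h))" "norm (v2 - w2) \<le> C * h"
      using transport_V[OF c(2), of "s + h"] h by auto
    have "v1 = v2" by (rule inj_onD[OF later[of "s + h"]]) (use v1 v2 w h in auto)
    then have "norm (w1 - w2) \<le> C * h + C * h"
      using v1(3) v2(3) norm_triangle_ineq[of "w1 - v1" "v1 - w2"] by (simp add: norm_minus_commute mult.commute)
    also have "\<dots> = norm (w1 - w2) / 2" using C_pos by (simp add: h_def)
    finally show False using w(4) by simp
  qed
  then have "s \<notin> N" by (simp add: N_def)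
  have "\<exists>r w1 w2. r \<in> N \<and> s - 1 / (real n + 1) < r \<and> w1 \<noteq> w2 \<and> w1 \<in> cball 0 (exp (- r)) \<and> w2 \<in> cball 0 (exp (- r)) \<and>
      V (w1, r) = V (w2, r)" for n
  proof -
    obtain r where "r \<in> N" "s - 1 / (real n + 1) < r"
      using less_cSupD[of N "s - 1 / (real n + 1)"] tN by (auto simp: s_def)
    then show ?thesis unfolding N_def inj_on_def by blast
  qed
  then obtain r w1 w2 where rw: "\<And>n. r n \<in> N" "\<And>n. s - 1 / (real n + 1) < r n" "\<And>n. w1 n \<noteq> w2 n"
    "\<And>n. w1 n \<in> cball 0 (exp (- r n))" "\<And>n. w2 n \<in> cball 0 (exp (- r n))" "\<And>n. V (w1 n, r n) = V (w2 n, r n)"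
    by metis
  have rs: "r n \<le> s" "t \<le> r n" for n using rw(1)[of n] cSup_upper[OF _ bdd] by (auto simp: s_def N_def)
  have rlim: "r \<longlonglongrightarrow> s"
  proof (rule tendsto_sandwich[of "\<lambda>n. s - 1 / (real n + 1)" _ _ "\<lambda>_. s"])
    show "(\<lambda>n. s - 1 / (real n + 1)) \<longlonglongrightarrow> s" by real_asymp
  qed (use less_imp_le[OF rw(2)] rs in auto)
  have bnd: "exp (- r n) \<le> exp (- t)" for n using rs(2)[of n] by simp
  have "(w1 n, w2 n) \<in> cball 0 (exp (- t)) \<times> cball 0 (exp (- t))" for n
    using order_trans[OF _ bnd[of n], of "norm (w1 n)"] order_trans[OF _ bnd[of n], of "norm (w2 n)"] rw(4,5)[of n]
    by simp
  moreover have "compact (cball (0::complex) (exp (- t)) \<times> cball (0::complex) (exp (- t)))"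
    by (intro compact_Times compact_cball)
  ultimately obtain l \<sigma> where l: "strict_mono \<sigma>" "((\<lambda>n. (w1 n, w2 n)) \<circ> \<sigma>) \<longlonglongrightarrow> l"
    unfolding compact_def by meson
  define v1 v2 where "v1 = fst l" and "v2 = snd l"
  have l1: "(w1 \<circ> \<sigma>) \<longlonglongrightarrow> v1" using tendsto_fst[OF l(2)] by (simp add: o_def v1_def)
  have l2: "(w2 \<circ> \<sigma>) \<longlonglongrightarrow> v2" using tendsto_snd[OF l(2)] by (simp add: o_def v2_def)
  have lr: "(r \<circ> \<sigma>) \<longlonglongrightarrow> s" using LIMSEQ_subseq_LIMSEQ[OF rlim l(1)] .
  have lim_wedge: "(x, s) \<in> wedge" if "(y \<circ> \<sigma>) \<longlonglongrightarrow> x" "\<And>n. y n \<in> cball 0 (exp (- r n))" for x y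
  proof -
    have "(\<lambda>n. norm ((y \<circ> \<sigma>) n)) \<longlonglongrightarrow> norm x" by (intro tendsto_intros that(1))
    moreover have "(\<lambda>n. exp (- (r \<circ> \<sigma>) n)) \<longlonglongrightarrow> exp (- s)" by (intro tendsto_intros lr)
    ultimately have "norm x \<le> exp (- s)" by (rule LIMSEQ_le) (use that(2) in auto)
    then show ?thesis using ts assms by (simp add: wedge_iff)
  qed
  have vc: "(v1, s) \<in> wedge" "(v2, s) \<in> wedge" using lim_wedge[OF l1 rw(4)] lim_wedge[OF l2 rw(5)] .
  have lim_V: "(\<lambda>n. V ((y \<circ> \<sigma>) n, (r \<circ> \<sigma>) n)) \<longlonglongrightarrow> V (x, s)"
    if "(y \<circ> \<sigma>) \<longlonglongrightarrow> x" "\<And>n. y n \<in> cball 0 (exp (- r n))" for x y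
    by (rule continuous_on_tendsto_compose[OF continuous_on_V, of "\<lambda>n. ((y \<circ> \<sigma>) n, (r \<circ> \<sigma>) n)" "(x, s)"])
       (use that(2) lim_wedge[OF that] order_trans[OF less_imp_le[OF assms] rs(2)] in
          \<open>auto intro!: tendsto_Pair lr[unfolded o_def] that(1)[unfolded o_def] simp: wedge_iff\<close>)
  have "V (v1, s) = V (v2, s)"
    using lim_V[OF l1 rw(4)] lim_V[OF l2 rw(5)] rw(6) LIMSEQ_unique by (simp add: o_def)
  then have v12: "v1 = v2" using inj_onD[OF Is] vc by (auto simp: wedge_iff)
  have "norm v1 < 1" using wedge_norm_less[OF vc(1)] ts assms by simp
  then obtain \<epsilon> where e: "0 < \<epsilon>" and inj: "\<And>w1 w2 t. \<lbrakk>\<bar>t - s\<bar> < \<epsilon>; norm (w1 - v1) < \<epsilon>; norm (w2 - v1) < \<epsilon>;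
     (w1, t) \<in> wedge; (w2, t) \<in> wedge; V (w1, t) = V (w2, t)\<rbrakk> \<Longrightarrow> w1 = w2"
    using V_locally_injective[OF vc(1)] by metis
  have "\<forall>\<^sub>F n in sequentially. dist ((w1 \<circ> \<sigma>) n) v1 < \<epsilon> \<and> dist ((w2 \<circ> \<sigma>) n) v1 < \<epsilon> \<and> dist ((r \<circ> \<sigma>) n) s < \<epsilon>"
    using tendstoD[OF l1 e] tendstoD[OF l2 e] tendstoD[OF lr e] by (simp add: v12 eventually_conj_iff)
  then obtain n where n: "dist (w1 (\<sigma> n)) v1 < \<epsilon>" "dist (w2 (\<sigma> n)) v1 < \<epsilon>" "dist (r (\<sigma> n)) s < \<epsilon>"
    by (auto dest: eventually_happens)
  have "0 \<le> r (\<sigma> n)" using rs(2)[of "\<sigma> n"] assms by simp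
  then have "w1 (\<sigma> n) = w2 (\<sigma> n)"
    using inj[of "r (\<sigma> n)" "w1 (\<sigma> n)" "w2 (\<sigma> n)"] n rw(4,5,6)[of "\<sigma> n"] by (simp add: dist_norm wedge_iff)
  with rw(3) show False by blast
qed

text \<open>
  These are the points of the wedge that the extension uses. If the times differ, transport the
  earlier point to the later time: it arrives strictly inside the fibre, while the other point is on
  its boundary. If the times agree, transport both for a time \<open>h\<close>: injectivity at the later time makes
  the images coincide, so the points are at distance \<open>O(h)\<close> for every \<open>h\<close>. This covers points of the
  unit circle at time 0, where \<open>V_injective\<close> says nothing.
\<close>

lemma V_boundary_injective:
  assumes 1: "(w1, t1) \<in> wedge" "t1 = 0 \<or> norm w1 = exp (- t1)"
    and 2: "(w2, t2) \<in> wedge" "t2 = 0 \<or> norm w2 = exp (- t2)"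
    and eq: "V (w1, t1) = V (w2, t2)"
  shows "w1 = w2 \<and> t1 = t2"
proof -
  have less: False if h: "(w1, t1) \<in> wedge" "(w2, t2) \<in> wedge" "t2 = 0 \<or> norm w2 = exp (- t2)"
    "V (w1, t1) = V (w2, t2)" "t1 < t2" for w1 w2 t1 t2
  proof -
    have t2: "0 < t2" using h by (auto simp: wedge_iff)
    obtain v where v: "V (v, t2) = V (w1, t1)" "norm v < exp (- t2)" using transport_V[OF h(1,5)] by blast
    have "v = w2" by (rule inj_onD[OF V_injective[OF t2]]) (use v h t2 in \<open>auto simp: wedge_iff\<close>)
    then show False using v(2) h(3) t2 by simp
  qed
  have t: "t1 = t2" using less[of w1 t1 w2 t2] less[of w2 t2 w1 t1] assms by (metis linorder_neqE)
  have "norm (w1 - w2) \<le> 0 + e" if e: "0 < e" for e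
  proof -
    define h where "h = e / (2 * C)"
    have h: "0 < h" using e C_pos by (simp add: h_def)
    have p: "0 < t1 + h" using 1 h by (simp add: wedge_iff add_nonneg_pos)
    obtain v1 where v1: "V (v1, t1 + h) = V (w1, t1)" "norm v1 < exp (- (t1 + h))" "norm (v1 - w1) \<le> C * h"
      using transport_V[OF 1(1), of "t1 + h"] h by auto
    obtain v2 where v2: "V (v2, t1 + h) = V (w2, t1)" "norm v2 < exp (- (t1 + h))" "norm (v2 - w2) \<le> C * h"
      using transport_V[OF 2(1), of "t1 + h"] h by (auto simp: t)
    have "v1 = v2" by (rule inj_onD[OF V_injective[OF p]]) (use v1 v2 eq t in auto)
    then have "norm (w1 - w2) \<le> C * h + C * h"
      using v1(3) v2(3) norm_triangle_ineq[of "w1 - v1" "v1 - w2"] by (simp add: norm_minus_commute mult.commute)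
    then show ?thesis using C_pos by (simp add: h_def)
  qed
  then have "norm (w1 - w2) \<le> 0" by (rule field_le_epsilon)
  with t show ?thesis by simp
qed

end

section \<open>Absolute continuity from a dominated derivative\<close>

lemma norm_increment_le_integral:
  fixes u :: "real \<Rightarrow> complex"
  assumes xy: "x \<le> y" "{x..y} \<subseteq> {a..b}" and cont: "continuous_on {a..b} u" and S: "finite S"
    and der: "\<And>s. s \<in> {a<..<b} - S \<Longrightarrow> \<exists>d. (u has_vector_derivative d) (at s) \<and> norm d \<le> g s"
    and int: "g integrable_on {a..b}" and nn: "\<And>s. 0 \<le> g s"
  shows "norm (u y - u x) \<le> integral {x..y} g"
proof -
  define u' where "u' s = (if s \<in> {a<..<b} - S then vector_derivative u (at s) else 0)" for s
  have u': "norm (u' s) \<le> g s" for s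
    using der[of s] nn[of s] by (auto simp: u'_def vector_derivative_at)
  have ab: "{x<..<y} \<subseteq> {a<..<b}" using xy by (cases "x = y") auto
  have "(u' has_integral (u y - u x)) {x..y}"
  proof (rule fundamental_theorem_of_calculus_interior_strong[OF S xy(1)])
    fix s assume "s \<in> {x<..<y} - S"
    then have s: "s \<in> {a<..<b} - S" using ab by auto
    then show "(u has_vector_derivative u' s) (at s)"
      using der[OF s] by (auto simp: u'_def vector_derivative_at)
  qed (use cont xy continuous_on_subset in blast)
  then have "u y - u x = integral {x..y} u'" "u' integrable_on {x..y}"
    by (auto simp: integral_unique)
  moreover have "g integrable_on {x..y}" using integrable_on_subinterval[OF int] xy by auto
  ultimately show ?thesis using u' by (auto intro!: integral_norm_bound_integral)
qed

lemma sum_integral_disjoint_le: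
  fixes h :: "real \<Rightarrow> real"
  assumes I: "finite I" "\<And>x y. (x, y) \<in> I \<Longrightarrow> a \<le> x \<and> x \<le> y \<and> y \<le> b"
    and disj: "pairwise (\<lambda>p q. disjnt {fst p<..<snd p} {fst q<..<snd q}) I"
    and int: "h integrable_on {a..b}" and nn: "\<And>s. 0 \<le> h s"
  shows "(\<Sum>(x, y)\<in>I. integral {x..y} h) \<le> integral {a..b} h"
proof (rule has_integral_subset_le)
  show "(h has_integral (\<Sum>(x, y)\<in>I. integral {x..y} h)) (\<Union>p\<in>I. {fst p<..<snd p})"
  proof (rule has_integral_UN[OF I(1)])
    fix p assume p: "p \<in> I"
    then have "a \<le> fst p" "snd p \<le> b" using I(2)[of "fst p" "snd p"] by auto
    then have "h integrable_on {fst p..snd p}" using integrable_on_subinterval[OF int] by auto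
    then show "(h has_integral (case p of (x, y) \<Rightarrow> integral {x..y} h)) {fst p<..<snd p}"
      by (simp add: case_prod_beta integrable_integral flip: has_integral_Icc_iff_Ioo)
  next
    show "pairwise (\<lambda>p q. negligible ({fst p<..<snd p} \<inter> {fst q<..<snd q})) I"
      using disj by (rule pairwise_mono) (auto simp: disjnt_def)
  qed
  show "(\<Union>p\<in>I. {fst p<..<snd p}) \<subseteq> {a..b}" using I(2) by fastforce
  show "(h has_integral integral {a..b} h) {a..b}" using int by (rule integrable_integral)
qed (use nn in auto)

text \<open>
  Increments are bounded by integrals of \<open>g\<close>. Truncating \<open>g\<close> at a height \<open>N\<close> splits these into a part
  with small total integral and a part bounded by \<open>N\<close> times the length.
\<close>

lemma abs_continuous_if_derivative_dominated:
  fixes u :: "real \<Rightarrow> complex"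
  assumes cont: "continuous_on {a..b} u" and S: "finite S"
    and der: "\<And>s. s \<in> {a<..<b} - S \<Longrightarrow> \<exists>d. (u has_vector_derivative d) (at s) \<and> norm d \<le> g s"
    and int: "g integrable_on {a..b}" and nn: "\<And>s. 0 \<le> g s"
  shows "abs_continuous_on_interval a b u"
  unfolding abs_continuous_on_interval_def
proof (intro allI impI)
  fix e :: real assume e: "0 < e"
  define m where "m n s = min (g s) (real n)" for n s
  have m_int: "m n integrable_on {a..b}" for n
  proof -
    have "(\<lambda>s. min (g s) (real n)) absolutely_integrable_on {a..b}"
      by (intro absolutely_integrable_min_1 nonnegative_absolutely_integrable_1 int) (auto simp: nn)
    then show ?thesis unfolding m_def using set_lebesgue_integral_eq_integral(1) by blast
  qed
  have "(\<lambda>n. integral {a..b} (m n)) \<longlonglongrightarrow> integral {a..b} g"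
  proof (rule dominated_convergence(2)[OF m_int int])
    show "norm (m n s) \<le> g s" for n s using nn[of s] by (simp add: m_def)
    show "(\<lambda>n. m n s) \<longlonglongrightarrow> g s" for s
    proof (rule tendsto_eventually)
      obtain n0 :: nat where "g s \<le> real n0" using real_arch_simple by blast
      then show "\<forall>\<^sub>F n in sequentially. m n s = g s"
        by (intro eventually_sequentiallyI[of n0]) (auto simp: m_def)
    qed
  qed
  then have "\<forall>\<^sub>F n in sequentially. dist (integral {a..b} (m n)) (integral {a..b} g) < e / 2"
    using e by (intro tendstoD) auto
  then obtain N where N: "dist (integral {a..b} (m N)) (integral {a..b} g) < e / 2"
    by (auto dest: eventually_happens)
  define h where "h s = g s - m N s" for s
  have h: "h integrable_on {a..b}" "\<And>s. 0 \<le> h s"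
    using integrable_diff[OF int m_int[of N]] by (auto simp: h_def[abs_def] m_def)
  have "integral {a..b} h = integral {a..b} g - integral {a..b} (m N)"
    unfolding h_def by (rule integral_diff[OF int m_int])
  then have hs: "integral {a..b} h < e / 2" using N unfolding dist_real_def by linarith
  show "\<exists>\<delta>>0. \<forall>I :: (real \<times> real) set. finite I \<and> (\<forall>(x, y)\<in>I. a \<le> x \<and> x \<le> y \<and> y \<le> b) \<and>
        pairwise (\<lambda>p q. disjnt {fst p<..<snd p} {fst q<..<snd q}) I \<and>
        (\<Sum>(x, y)\<in>I. y - x) < \<delta> \<longrightarrow> (\<Sum>(x, y)\<in>I. norm (u y - u x)) < e"
  proof (intro exI[of _ "e / (2 * (real N + 1))"] conjI allI impI)
    show "0 < e / (2 * (real N + 1))" using e by simp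
    fix I :: "(real \<times> real) set"
    assume "finite I \<and> (\<forall>(x, y)\<in>I. a \<le> x \<and> x \<le> y \<and> y \<le> b) \<and>
        pairwise (\<lambda>p q. disjnt {fst p<..<snd p} {fst q<..<snd q}) I \<and>
        (\<Sum>(x, y)\<in>I. y - x) < e / (2 * (real N + 1))"
    then have I: "finite I" "\<And>x y. (x, y) \<in> I \<Longrightarrow> a \<le> x \<and> x \<le> y \<and> y \<le> b"
      and disj: "pairwise (\<lambda>p q. disjnt {fst p<..<snd p} {fst q<..<snd q}) I"
      and len: "(\<Sum>(x, y)\<in>I. y - x) < e / (2 * (real N + 1))" by auto
    have piece: "norm (u y - u x) \<le> integral {x..y} h + real N * (y - x)" if p: "(x, y) \<in> I" for x y
    proof -
      have sub: "x \<le> y" "{x..y} \<subseteq> {a..b}" using I(2)[OF p] by auto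
      have "norm (u y - u x) \<le> integral {x..y} g"
        by (rule norm_increment_le_integral[OF sub cont S der int nn])
      also have "\<dots> = integral {x..y} h + integral {x..y} (m N)"
      proof -
        have "integral {x..y} (\<lambda>s. h s + m N s) = integral {x..y} h + integral {x..y} (m N)"
          using sub by (intro integral_add integrable_on_subinterval[OF h(1)] integrable_on_subinterval[OF m_int]) auto
        then show ?thesis by (simp add: h_def)
      qed
      also have "integral {x..y} (m N) \<le> integral {x..y} (\<lambda>s. real N)"
        using sub by (intro integral_le integrable_on_subinterval[OF m_int]) (auto simp: m_def)
      also have "\<dots> = real N * (y - x)" using sub by simp
      finally show ?thesis by simp
    qed
    have "(\<Sum>(x, y)\<in>I. norm (u y - u x)) \<le> (\<Sum>(x, y)\<in>I. integral {x..y} h + real N * (y - x))"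
      using piece by (intro sum_mono) auto
    also have "\<dots> = (\<Sum>(x, y)\<in>I. integral {x..y} h) + real N * (\<Sum>(x, y)\<in>I. y - x)"
      by (simp add: case_prod_beta sum.distrib sum_distrib_left)
    also have "(\<Sum>(x, y)\<in>I. integral {x..y} h) \<le> integral {a..b} h"
      by (rule sum_integral_disjoint_le[OF I disj h])
    also have "real N * (\<Sum>(x, y)\<in>I. y - x) \<le> real N * (e / (2 * (real N + 1)))"
      using len by (intro mult_left_mono) auto
    also have "\<dots> \<le> e / 2" using e by (simp add: field_simps)
    finally show "(\<Sum>(x, y)\<in>I. norm (u y - u x)) < e" using hs by linarith
  qed
qed

lemma integrable_abs_powr:
  fixes c k :: real
  assumes k: "k < 1"
  shows "(\<lambda>x. \<bar>x - c\<bar> powr (- k)) integrable_on {a..b}"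
proof (cases "a \<le> b")
  case True
  let ?W = "\<lambda>x. max 0 (x - c) powr (1 - k) / (1 - k) - max 0 (c - x) powr (1 - k) / (1 - k)"
  have "((\<lambda>x. \<bar>x - c\<bar> powr (- k)) has_integral ?W b - ?W a) {a..b}"
  proof (rule fundamental_theorem_of_calculus_interior_strong[of "{c}"])
    show "continuous_on {a..b} ?W" using k
      by (intro continuous_on_diff continuous_on_divide continuous_on_powr' continuous_on_max continuous_on_const continuous_on_id) auto
    fix x assume x: "x \<in> {a<..<b} - {c}"
    have "(?W has_real_derivative \<bar>x - c\<bar> powr (- k)) (at x)"
    proof (cases "c < x")
      case True
      have "((\<lambda>x. (x - c) powr (1 - k) / (1 - k)) has_real_derivative \<bar>x - c\<bar> powr (- k)) (at x)"
        using True k by (auto intro!: derivative_eq_intros)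
      then show ?thesis
        by (rule has_field_derivative_transform_within_open[of _ _ _ "{c<..}"]) (use True k in auto)
    next
      case False
      then have lt: "x < c" using x by auto
      have "((\<lambda>x. - ((c - x) powr (1 - k) / (1 - k))) has_real_derivative \<bar>x - c\<bar> powr (- k)) (at x)"
        using lt k by (auto intro!: derivative_eq_intros)
      then show ?thesis
        by (rule has_field_derivative_transform_within_open[of _ _ _ "{..<c}"]) (use lt k in auto)
    qed
    then show "(?W has_vector_derivative \<bar>x - c\<bar> powr (- k)) (at x)"
      by (simp add: has_real_derivative_iff_has_vector_derivative)
  qed (use True in auto)
  then show ?thesis by blast
qed auto

text \<open>
  On a horizontal or vertical line \<open>|z|\<^sup>2 - 1\<close> has the form \<open>x\<^sup>2 - c\<close>, and \<open>c = 0\<close> is the tangential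
  case. Otherwise the singularities at \<open>\<plusminus>sqrt c\<close> are separated, and one of the two factors is
  always at least \<open>sqrt c\<close> in modulus.
\<close>

lemma quadratic_singularity_majorant:
  fixes c k :: real
  assumes k: "0 \<le> k" "k < 1" and c: "c \<noteq> 0"
  obtains g where "g integrable_on {a..b}" "\<And>x. 0 \<le> g x" "\<And>x. x\<^sup>2 \<noteq> c \<Longrightarrow> \<bar>x\<^sup>2 - c\<bar> powr (- k) \<le> g x"
proof (cases "c < 0")
  case True
  show thesis
  proof (rule that[of "\<lambda>_. \<bar>c\<bar> powr (- k)"])
    fix x :: real
    have "\<bar>c\<bar> \<le> \<bar>x\<^sup>2 - c\<bar>" using True zero_le_power2[of x] by linarith
    then show "\<bar>x\<^sup>2 - c\<bar> powr (- k) \<le> \<bar>c\<bar> powr (- k)" using True k by (intro powr_mono2') auto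
  qed auto
next
  case False
  define r where "r = sqrt c"
  have r: "0 < r" "c = r\<^sup>2" using False c by (auto simp: r_def)
  show thesis
  proof (rule that[of "\<lambda>x. r powr (- k) * (\<bar>x - r\<bar> powr (- k) + \<bar>x - - r\<bar> powr (- k))"])
    show "(\<lambda>x. r powr (- k) * (\<bar>x - r\<bar> powr (- k) + \<bar>x - - r\<bar> powr (- k))) integrable_on {a..b}"
      by (intro integrable_on_mult_right integrable_add integrable_abs_powr k)
    fix x :: real assume x: "x\<^sup>2 \<noteq> c"
    then have nz: "x \<noteq> r" "x \<noteq> - r" using r by auto
    have "\<bar>x\<^sup>2 - c\<bar> = \<bar>x - r\<bar> * \<bar>x - - r\<bar>"
      unfolding r(2) by (simp add: power2_eq_square algebra_simps flip: abs_mult)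
    then have e: "\<bar>x\<^sup>2 - c\<bar> powr (- k) = \<bar>x - r\<bar> powr (- k) * \<bar>x - - r\<bar> powr (- k)"
      by (simp add: powr_mult)
    have "\<bar>x - r\<bar> powr (- k) \<le> r powr (- k) \<or> \<bar>x - - r\<bar> powr (- k) \<le> r powr (- k)"
    proof (cases "0 \<le> x")
      case True
      then have "r \<le> \<bar>x - - r\<bar>" using r by simp
      then show ?thesis using r k by (intro disjI2 powr_mono2') auto
    next
      case False
      then have "r \<le> \<bar>x - r\<bar>" using r by simp
      then show ?thesis using r k by (intro disjI1 powr_mono2') auto
    qed
    moreover have "p * p' \<le> d * (p + p')" if "p \<le> d \<or> p' \<le> d" "0 \<le> p" "0 \<le> p'" "0 \<le> d" for p p' d :: real
    proof -
      have "p * p' \<le> d * p' \<or> p * p' \<le> p * d"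
        using that by (auto intro: mult_right_mono mult_left_mono)
      moreover have "0 \<le> d * p" "0 \<le> d * p'" using that by simp_all
      ultimately show ?thesis unfolding distrib_left mult.commute[of p d] by linarith
    qed
    ultimately show "\<bar>x\<^sup>2 - c\<bar> powr (- k) \<le> r powr (- k) * (\<bar>x - r\<bar> powr (- k) + \<bar>x - - r\<bar> powr (- k))"
      unfolding e by simp
  qed auto
qed

section \<open>The quasiconformal extension\<close>

lemma partials_of_has_derivative:
  assumes "(F has_derivative F') (at z)"
  shows "has_partials_at F z" "partial_x F z = F' 1" "partial_y F z = F' \<i>"
proof -
  have *: "((\<lambda>t::real. F (z + d * of_real t)) has_vector_derivative F' d) (at 0)" for d
  proof -
    have "((\<lambda>t::real. z + d * of_real t) has_derivative (\<lambda>h. d * of_real h)) (at 0)"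
      by (auto intro!: derivative_eq_intros)
    from has_derivative_compose[OF this, of F F'] assms
    have "((\<lambda>t::real. F (z + d * of_real t)) has_derivative (\<lambda>h. F' (d * of_real h))) (at 0)" by simp
    moreover have "F' (d * of_real h) = h *\<^sub>R F' d" for h
      using linear_scale[OF has_derivative_linear[OF assms], of h d] by (simp add: scaleR_conv_of_real mult.commute)
    ultimately show ?thesis by (simp add: has_vector_derivative_def)
  qed
  have x: "((\<lambda>t::real. F (z + of_real t)) has_vector_derivative F' 1) (at 0)" using *[of 1] by simp
  note y = *[of \<i>]
  show "has_partials_at F z" unfolding has_partials_at_def
    using x y by (auto simp: has_vector_derivative_def differentiable_def)
  show "partial_x F z = F' 1" "partial_y F z = F' \<i>"
    unfolding partial_x_def partial_y_def using vector_derivative_at[OF x] vector_derivative_at[OF y] by auto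
qed

context loewner_pair
begin

text \<open>
  Outside the disc the point \<open>w = 1/cnj z\<close> has the argument of \<open>z\<close> and the modulus \<open>exp(-t)\<close> for
  \<open>t = log |z|\<close>, so it is on the boundary of the fibre over \<open>t\<close>. On the unit circle both
  formulas agree.
\<close>

definition F :: "complex \<Rightarrow> complex" where
  "F z = (if norm z \<le> 1 then V (z, 0) else V (1 / cnj z, ln (norm z)))"

lemma outer_point:
  assumes "1 \<le> norm z"
  shows "(1 / cnj z, ln (norm z)) \<in> wedge" "norm (1 / cnj z) = exp (- ln (norm z))"
  using assms by (auto simp: wedge_iff norm_divide exp_minus divide_simps)

lemma continuous_on_F: "continuous_on UNIV F"
proof -
  have "continuous_on UNIV (\<lambda>z. if norm z \<le> 1 then V (z, 0) else V (1 / cnj z, ln (norm z)))"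
  proof (rule continuous_on_cases_le)
    show "continuous_on {z \<in> UNIV. norm z \<le> 1} (\<lambda>z. V (z, 0))"
      by (intro continuous_on_compose2[OF continuous_on_V] continuous_intros) (auto simp: wedge_iff)
    show "continuous_on {z \<in> UNIV. 1 \<le> norm z} (\<lambda>z. V (1 / cnj z, ln (norm z)))"
      by (intro continuous_on_compose2[OF continuous_on_V] continuous_intros) (auto simp: outer_point)
    show "V (z, 0) = V (1 / cnj z, ln (norm z))" if "norm z = 1" for z
      using that complex_norm_square[of z] by (simp add: field_simps) (metis div_by_1 mult.commute nonzero_eq_divide_eq norm_zero zero_neq_one complex_cnj_zero_iff)
  qed (intro continuous_intros)
  then show ?thesis by (simp add: F_def[abs_def])
qed

lemma inj_F: "inj F"
proof (rule injI)
  fix z1 z2 assume eq: "F z1 = F z2"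
  define p where "p z = (if norm z \<le> 1 then (z, 0) else (1 / cnj z, ln (norm z)))" for z :: complex
  have Fp: "F z = V (p z)" for z by (simp add: F_def p_def)
  have pw: "p z \<in> wedge \<and> (snd (p z) = 0 \<or> norm (fst (p z)) = exp (- snd (p z)))" for z
    using outer_point[of z] by (auto simp: p_def wedge_iff)
  have "p z1 = p z2"
    using V_boundary_injective[of "fst (p z1)" "snd (p z1)" "fst (p z2)" "snd (p z2)"] pw[of z1] pw[of z2] eq
    by (simp add: Fp prod_eq_iff)
  moreover have "0 < ln (norm z)" if "\<not> norm z \<le> 1" for z :: complex
    using that by (intro ln_gt_zero) simp
  ultimately show "z1 = z2"
    by (cases "norm z1 \<le> 1"; cases "norm z2 \<le> 1") (force simp: p_def)+
qed

lemma F_derivative_inner: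
  assumes z: "norm z < 1"
  shows "(F has_derivative (*) (V_w (z, 0))) (at z)"
proof -
  have "((\<lambda>w. V (w, 0)) has_field_derivative V_w (z, 0)) (at z within cball 0 (exp (- 0)) \<inter> \<U>)"
    using z by (intro V_fibre_derivative) (auto simp: wedge_iff)
  moreover have "cball 0 (exp (- 0)) \<inter> \<U> = \<U>" by auto
  moreover have "at z within \<U> = at z" using z by (intro at_within_open) auto
  ultimately have "((\<lambda>w. V (w, 0)) has_derivative (*) (V_w (z, 0))) (at z)" by (simp add: has_field_derivative_def)
  then show ?thesis
    by (rule has_derivative_transform_within_open[of _ _ _ _ \<U>]) (use z in \<open>auto simp: F_def\<close>)
qed

lemma F_derivative_outer:
  assumes z: "1 < norm z"
  defines "w \<equiv> 1 / cnj z" and "t \<equiv> ln (norm z)"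
  shows "(F has_derivative (\<lambda>v. V_w (w, t) * w * (q t w * of_real (Re (v / z)) - cnj (v / z)))) (at z)"
proof -
  let ?X = "{x::complex. 1 < norm x}"
  have op: "open ?X" by (intro open_Collect_less continuous_intros)
  have zX: "z \<in> ?X" using z by simp
  have z0: "z \<noteq> 0" using z by auto
  have at: "at z within ?X = at z" by (rule at_within_open[OF zX op])
  have 1: "((\<lambda>x. 1 / cnj x) has_derivative (\<lambda>v. - (cnj v / (cnj z)\<^sup>2))) (at z within ?X)"
  proof -
    have "(cnj has_derivative cnj) (at z within ?X)"
      by (rule bounded_linear.has_derivative[OF bounded_linear_cnj has_derivative_ident])
    from Deriv.has_derivative_inverse[OF _ this] z0 show ?thesis
      by (simp add: field_simps power2_eq_square)
  qed
  have 2: "((\<lambda>x. ln (norm x)) has_derivative (\<lambda>v. Re (v / z))) (at z within ?X)"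
  proof -
    have n: "(norm has_derivative (\<lambda>v. v \<bullet> sgn z)) (at z within ?X)"
      using has_derivative_norm[OF z0] by (rule has_derivative_at_withinI)
    have sq: "norm z * norm z = Im z * Im z + Re z * Re z"
      using cmod_power2[of z] by (simp add: power2_eq_square)
    have "((\<lambda>x. ln (norm x)) has_derivative (\<lambda>v. (v \<bullet> sgn z) * inverse (norm z))) (at z within ?X)"
      by (rule has_derivative_ln[OF _ n]) (use z0 in simp)
    moreover have "(v \<bullet> sgn z) * inverse (norm z) = Re (v / z)" for v
      using z0 by (simp add: sgn_div_norm inner_complex_def Re_divide power2_eq_square field_simps sq)
    ultimately show ?thesis by simp
  qed
  have "((\<lambda>x. V (1 / cnj x, ln (norm x))) has_derivative
     (\<lambda>v. V_w (1 / cnj z, ln (norm z)) * (- (cnj v / (cnj z)\<^sup>2) + 1 / cnj z * q (ln (norm z)) (1 / cnj z) * of_real (Re (v / z)))))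
     (at z within ?X)"
    by (rule V_derivative[OF zX _ 1 2]) (auto simp: outer_point norm_divide divide_less_eq)
  then have "((\<lambda>x. V (1 / cnj x, ln (norm x))) has_derivative
     (\<lambda>v. V_w (w, t) * w * (q t w * of_real (Re (v / z)) - cnj (v / z)))) (at z)"
    by (simp add: at w_def t_def power2_eq_square algebra_simps)
  then show ?thesis
    by (rule has_derivative_transform_within_open[OF _ op zX]) (auto simp: F_def)
qed

text \<open>
  With \<open>P = w V\<^sub>w\<close>, the differential \<open>P (q Re(v/z) - cnj(v/z))\<close> splits into the coefficients
  \<open>P q/(2z)\<close> of \<open>v\<close> and \<open>P (q/2 - 1) cnj(1/z)\<close> of \<open>cnj v\<close>. Their quotient has modulus
  \<open>|1 - 2/q|\<close>, which is \<open>|1 - 2D/\<mu>|\<close>.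
\<close>

lemma F_dilatation:
  assumes z: "norm z \<noteq> 1"
  shows "has_partials_at F z \<and> norm (partial_zbar F z) \<le> k * norm (partial_z F z)"
proof (cases "norm z < 1")
  case True
  have d: "partial_x F z = V_w (z, 0)" "partial_y F z = \<i> * V_w (z, 0)"
    using partials_of_has_derivative[OF F_derivative_inner[OF True]] by (auto simp: mult.commute)
  have "partial_zbar F z = 0" by (simp add: partial_zbar_def d)
  then show ?thesis using k partials_of_has_derivative(1)[OF F_derivative_inner[OF True]] by simp
next
  case False
  then have z: "1 < norm z" using z by simp
  define w t where "w = 1 / cnj z" and "t = ln (norm z)"
  have c: "0 \<le> t" "norm w \<le> exp (- t)" "norm w < 1"
    using outer_point[of z] z ln_gt_zero[OF z] by (auto simp: w_def t_def wedge_iff norm_divide)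
  note d = partials_of_has_derivative[OF F_derivative_outer[OF z], folded w_def t_def]
  define P qq where "P = V_w (w, t) * w" and "qq = q t w"
  have re: "complex_of_real (Re x) = (x + cnj x) / 2" for x by (simp add: complex_add_cnj)
  have d1: "partial_x F z = P * (qq * ((1 / z + cnj (1 / z)) / 2) - cnj (1 / z))"
    unfolding d(2) re P_def qq_def ..
  have d2: "partial_y F z = P * (qq * ((\<i> / z + cnj (\<i> / z)) / 2) - cnj (\<i> / z))"
    unfolding d(3) re P_def qq_def ..
  have i: "\<i> / z = \<i> * (1 / z)" "cnj (\<i> / z) = - \<i> * cnj (1 / z)" by auto
  have pz: "partial_z F z = P * (qq / 2 * (1 / z))"
    unfolding partial_z_def d1 d2 i by (simp add: algebra_simps add_divide_distrib diff_divide_distrib)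
  have pzb: "partial_zbar F z = P * ((qq / 2 - 1) * cnj (1 / z))"
    unfolding partial_zbar_def d1 d2 i by (simp add: algebra_simps add_divide_distrib diff_divide_distrib)
  have D: "D t w \<noteq> 0" by (rule D_nz[OF c])
  have "qq / 2 - 1 = qq / 2 * (1 - 2 * D t w / of_real \<mu>)" using D mu by (simp add: qq_def q_def field_simps)
  then have "norm (qq / 2 - 1) = norm (qq / 2) * norm (2 * D t w / of_real \<mu> - 1)"
    by (simp only: norm_mult norm_minus_commute)
  also have "\<dots> \<le> norm (qq / 2) * k" using D_normalised[OF c] by (rule mult_left_mono) simp
  finally have "norm P * norm (qq / 2 - 1) * norm (1 / z) \<le> norm P * (norm (qq / 2) * k) * norm (1 / z)"
    by (intro mult_right_mono mult_left_mono) auto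
  then have "norm (partial_zbar F z) \<le> k * norm (partial_z F z)"
    unfolding pz pzb norm_mult complex_mod_cnj by (simp add: mult_ac)
  with d(1) show ?thesis by simp
qed

text \<open>
  All factors of \<open>V\<^sub>w\<close> except \<open>\<Psi>\<close> are bounded for bounded times.
\<close>

lemma V_w_bound:
  obtains K where "0 < K" "\<And>w t. \<lbrakk>(w, t) \<in> wedge; t \<le> T; norm w < 1\<rbrakk> \<Longrightarrow> norm (V_w (w, t)) \<le> K * (1 - norm w) powr (- k)"
proof -
  obtain K0 where K0: "0 < K0" "\<And>w. norm w < 1 \<Longrightarrow> norm (\<Psi> w) \<le> K0 * (1 - norm w) powr (- k)"
    using Psi_growth by blast
  let ?W = "wedge \<inter> {p. snd p \<le> T}"
  let ?f = "\<lambda>p. exp (Lam p / \<alpha>) * of_real (exp (\<mu> * snd p)) / (\<alpha> * A_ext p)"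
  have "wedge = {p. 0 \<le> snd p} \<inter> {p. norm (fst p) \<le> exp (- snd p)}" by (auto simp: wedge_def)
  moreover have "closed ({p. 0 \<le> snd p} \<inter> {p::complex \<times> real. norm (fst p) \<le> exp (- snd p)})"
    by (intro closed_Int closed_Collect_le continuous_intros)
  ultimately have "closed wedge" by simp
  then have "closed ?W" by (intro closed_Int closed_Collect_le continuous_intros)
  moreover have "?W \<subseteq> cball 0 1 \<times> {0..T}" by (auto simp: wedge_iff dest: wedge_norm_le)
  moreover have "bounded (cball (0::complex) 1 \<times> {0..T})" by (intro bounded_Times) auto
  ultimately have "compact ?W" using bounded_subset compact_eq_bounded_closed by blast
  moreover have "continuous_on ?W ?f"
    by (intro continuous_intros continuous_on_subset[OF Lam(1)] continuous_on_subset[OF continuous_on_A_ext])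
       (auto simp: alpha_nz A_ext_nz)
  ultimately have "bounded (?f ` ?W)" by (intro compact_imp_bounded compact_continuous_image)
  then obtain M where M: "0 < M" "\<And>p. p \<in> ?W \<Longrightarrow> norm (?f p) \<le> M"
    unfolding bounded_pos by auto
  show thesis
  proof (rule that[of "M * K0 * \<mu>"])
    show "0 < M * K0 * \<mu>" using M K0 mu by simp
    fix w t assume h: "(w, t) \<in> wedge" "t \<le> T" "norm w < 1"
    have "norm (D t w) \<le> norm (D t w - of_real (\<mu> / 2)) + norm (complex_of_real (\<mu> / 2))"
      using norm_triangle_sub[of "D t w" "of_real (\<mu> / 2)"] by (simp add: add.commute)
    also have "norm (D t w - of_real (\<mu> / 2)) \<le> k * (\<mu> / 2)" using D_bound h by (simp add: wedge_iff)
    also have "k * (\<mu> / 2) \<le> 1 * (\<mu> / 2)" using k mu by (intro mult_right_mono) auto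
    finally have Dm: "norm (D t w) \<le> \<mu>" using mu by simp
    have "V_w (w, t) = ?f (w, t) * \<Psi> w * D t w" using h by (simp add: V_w_def A_ext_eq)
    then have "norm (V_w (w, t)) = norm (?f (w, t)) * norm (\<Psi> w) * norm (D t w)" by (simp only: norm_mult)
    also have "\<dots> \<le> M * (K0 * (1 - norm w) powr (- k)) * \<mu>"
      using M(2)[of "(w, t)"] h K0 Dm M(1) by (intro mult_mono) auto
    finally show "norm (V_w (w, t)) \<le> M * K0 * \<mu> * (1 - norm w) powr (- k)" by (simp add: mult_ac)
  qed
qed

lemma F_derivative_bound:
  assumes R: "1 \<le> R"
  obtains K where "0 < K" "\<And>z. \<lbrakk>norm z \<le> R; norm z \<noteq> 1\<rbrakk> \<Longrightarrow>
    \<exists>F'. (F has_derivative F') (at z) \<and> (\<forall>v. norm (F' v) \<le> K * \<bar>norm z - 1\<bar> powr (- k) * norm v)"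
proof -
  obtain K where K: "0 < K" "\<And>w t. \<lbrakk>(w, t) \<in> wedge; t \<le> ln R; norm w < 1\<rbrakk> \<Longrightarrow> norm (V_w (w, t)) \<le> K * (1 - norm w) powr (- k)"
    using V_w_bound by blast
  have Rk: "1 \<le> R powr k" using R k by (simp add: ge_one_powr_ge_zero)
  have KC: "K \<le> K * (C + 1) * R powr k"
    using mult_mono[of 1 "C + 1" 1 "R powr k"] C_pos Rk K(1) by (simp add: mult.assoc)
  show thesis
  proof (rule that[of "K * (C + 1) * R powr k"])
    show "0 < K * (C + 1) * R powr k" using K(1) KC by linarith
    fix z :: complex assume z: "norm z \<le> R" "norm z \<noteq> 1"
    show "\<exists>F'. (F has_derivative F') (at z) \<and> (\<forall>v. norm (F' v) \<le> K * (C + 1) * R powr k * \<bar>norm z - 1\<bar> powr (- k) * norm v)"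
    proof (cases "norm z < 1")
      case True
      have "norm (V_w (z, 0)) \<le> K * (1 - norm z) powr (- k)"
        using R True by (intro K(2)) (auto simp: wedge_iff)
      also have "\<dots> \<le> K * (C + 1) * R powr k * (1 - norm z) powr (- k)"
        using KC by (rule mult_right_mono) simp
      finally have "norm (V_w (z, 0) * v) \<le> K * (C + 1) * R powr k * \<bar>norm z - 1\<bar> powr (- k) * norm v" for v
        using True unfolding norm_mult by (intro mult_right_mono) (auto simp: abs_minus_commute)
      then show ?thesis using F_derivative_inner[OF True] by blast
    next
      case False
      then have z1: "1 < norm z" using z by simp
      define w t where "w = 1 / cnj z" and "t = ln (norm z)"
      have "ln (norm z) \<le> ln R" using z z1 R by (intro ln_mono) auto
      then have c: "(w, t) \<in> wedge" "0 \<le> t" "norm w \<le> exp (- t)" "norm w < 1" "t \<le> ln R"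
        using outer_point[of z] z1 ln_gt_zero[OF z1] by (auto simp: w_def t_def wedge_iff norm_divide)
      have "norm (V_w (w, t)) \<le> K * (1 - norm w) powr (- k)" using K(2) c by blast
      also have "(1 - norm w) powr (- k) \<le> ((norm z - 1) / R) powr (- k)"
      proof (rule powr_mono2')
        have "(norm z - 1) / R \<le> (norm z - 1) / norm z" using z z1 R by (intro divide_left_mono mult_pos_pos) auto
        also have "\<dots> = 1 - norm w" using z1 by (auto simp: w_def norm_divide diff_divide_distrib)
        finally show "(norm z - 1) / R \<le> 1 - norm w" .
      qed (use z1 R k in auto)
      also have "((norm z - 1) / R) powr (- k) = R powr k * \<bar>norm z - 1\<bar> powr (- k)"
        using z1 R by (simp add: powr_divide powr_minus divide_simps)
      finally have Vb: "norm (V_w (w, t)) \<le> K * (R powr k * \<bar>norm z - 1\<bar> powr (- k))"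
        using K(1) by simp
      have "norm (V_w (w, t) * w * (q t w * of_real (Re (v / z)) - cnj (v / z)))
          \<le> K * (C + 1) * R powr k * \<bar>norm z - 1\<bar> powr (- k) * norm v" for v
      proof -
        have "norm (q t w * of_real (Re (v / z)) - cnj (v / z)) \<le> norm (q t w) * \<bar>Re (v / z)\<bar> + norm (v / z)"
          using norm_triangle_ineq4[of "q t w * of_real (Re (v / z))" "cnj (v / z)"]
          by (simp only: norm_mult norm_of_real complex_mod_cnj)
        also have "\<dots> \<le> C * norm (v / z) + norm (v / z)"
          using norm_q[OF c(2-4)] abs_Re_le_cmod[of "v / z"] C_pos by (intro add_mono mult_mono) auto
        also have "\<dots> \<le> (C + 1) * norm v"
        proof -
          have "norm v / norm z \<le> norm v / 1" using z1 by (intro divide_left_mono) auto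
          then have "norm (v / z) \<le> norm v" by (simp add: norm_divide)
          then have "(C + 1) * norm (v / z) \<le> (C + 1) * norm v" using C_pos by (intro mult_left_mono) auto
          then show ?thesis by (simp add: algebra_simps)
        qed
        finally have b: "norm (q t w * of_real (Re (v / z)) - cnj (v / z)) \<le> (C + 1) * norm v" .
        have "norm (V_w (w, t) * w * (q t w * of_real (Re (v / z)) - cnj (v / z)))
           = norm (V_w (w, t)) * norm w * norm (q t w * of_real (Re (v / z)) - cnj (v / z))"
          by (simp only: norm_mult)
        also have "\<dots> \<le> K * (R powr k * \<bar>norm z - 1\<bar> powr (- k)) * 1 * ((C + 1) * norm v)"
          using Vb c(4) b K(1) C_pos by (intro mult_mono) auto
        finally show ?thesis by (simp add: mult_ac)
      qed
      then show ?thesis using F_derivative_outer[OF z1] unfolding w_def t_def by blast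
    qed
  qed
qed

lemma F_abs_continuous_on_line:
  assumes \<gamma>: "\<And>s. (\<gamma> has_vector_derivative v) (at s)" and v: "norm v = 1"
    and n: "\<And>s. (norm (\<gamma> s))\<^sup>2 = s\<^sup>2 + y\<^sup>2" and y: "y\<^sup>2 \<noteq> 1"
  shows "abs_continuous_on_interval a b (\<lambda>s. F (\<gamma> s))"
proof -
  define c where "c = 1 - y\<^sup>2"
  have c: "c \<noteq> 0" using y by (simp add: c_def)
  define R where "R = \<bar>a\<bar> + \<bar>b\<bar> + \<bar>y\<bar> + 1"
  have R: "1 \<le> R" by (simp add: R_def)
  obtain K where K: "0 < K" "\<And>z. \<lbrakk>norm z \<le> R; norm z \<noteq> 1\<rbrakk> \<Longrightarrow>
    \<exists>F'. (F has_derivative F') (at z) \<and> (\<forall>v. norm (F' v) \<le> K * \<bar>norm z - 1\<bar> powr (- k) * norm v)"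
    using F_derivative_bound[OF R] by metis
  obtain g where g: "g integrable_on {a..b}" "\<And>x. 0 \<le> g x" "\<And>x. x\<^sup>2 \<noteq> c \<Longrightarrow> \<bar>x\<^sup>2 - c\<bar> powr (- k) \<le> g x"
    using quadratic_singularity_majorant[OF k c, of a b] by blast
  have cont\<gamma>: "continuous_on UNIV \<gamma>"
    using \<gamma> has_vector_derivative_continuous by (blast intro: continuous_at_imp_continuous_on)
  show ?thesis
  proof (rule abs_continuous_if_derivative_dominated[of _ _ _ "{s. s\<^sup>2 = c}" "\<lambda>s. K * (R + 1) powr k * g s"])
    show "continuous_on {a..b} (\<lambda>s. F (\<gamma> s))"
      by (intro continuous_on_compose2[OF continuous_on_F] continuous_on_subset[OF cont\<gamma>]) auto
    have "{s. s\<^sup>2 = c} \<subseteq> {sqrt c, - sqrt c}"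
    proof
      fix s assume "s \<in> {s. s\<^sup>2 = c}"
      then have "sqrt c = \<bar>s\<bar>" by auto
      then show "s \<in> {sqrt c, - sqrt c}" by auto
    qed
    then show "finite {s. s\<^sup>2 = c}" by (rule finite_subset) simp
    show "(\<lambda>s. K * (R + 1) powr k * g s) integrable_on {a..b}" by (intro integrable_on_mult_right g)
    show "0 \<le> K * (R + 1) powr k * g s" for s using K(1) g(2)[of s] by simp
    fix s assume s: "s \<in> {a<..<b} - {s. s\<^sup>2 = c}"
    have nR: "norm (\<gamma> s) \<le> R"
    proof (rule power2_le_imp_le)
      have "\<bar>s\<bar> \<le> \<bar>a\<bar> + \<bar>b\<bar>" using s by auto
      then have "s\<^sup>2 \<le> (\<bar>a\<bar> + \<bar>b\<bar>)\<^sup>2" by (metis abs_ge_zero abs_of_nonneg add_nonneg_nonneg power2_abs power_mono)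
      then have "s\<^sup>2 + y\<^sup>2 \<le> (\<bar>a\<bar> + \<bar>b\<bar>)\<^sup>2 + \<bar>y\<bar>\<^sup>2" by simp
      also have "\<dots> \<le> (\<bar>a\<bar> + \<bar>b\<bar> + \<bar>y\<bar>)\<^sup>2" by (simp add: power2_sum)
      also have "\<dots> \<le> R\<^sup>2" unfolding R_def by (intro power_mono) auto
      finally show "(norm (\<gamma> s))\<^sup>2 \<le> R\<^sup>2" by (simp add: n)
    qed (use R in auto)
    have n1: "norm (\<gamma> s) \<noteq> 1"
      using s n[of s] by (auto simp: c_def)
    obtain F' where F': "(F has_derivative F') (at (\<gamma> s))"
      "norm (F' v) \<le> K * \<bar>norm (\<gamma> s) - 1\<bar> powr (- k) * norm v"
      using K(2)[OF nR n1] by blast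
    have der: "((\<lambda>s. F (\<gamma> s)) has_vector_derivative F' v) (at s)"
      using vector_derivative_diff_chain_within[of \<gamma> v s UNIV F F'] \<gamma>[of s] has_derivative_at_withinI[OF F'(1)]
      by (simp add: o_def)
    have "\<bar>s\<^sup>2 - c\<bar> = \<bar>norm (\<gamma> s) - 1\<bar> * (norm (\<gamma> s) + 1)"
    proof -
      have "s\<^sup>2 - c = (norm (\<gamma> s) - 1) * (norm (\<gamma> s) + 1)"
        using n[of s] by (simp add: c_def power2_eq_square algebra_simps)
      then show ?thesis by (simp add: abs_mult)
    qed
    also have "\<dots> \<le> \<bar>norm (\<gamma> s) - 1\<bar> * (R + 1)" using nR by (intro mult_left_mono) auto
    finally have "\<bar>s\<^sup>2 - c\<bar> / (R + 1) \<le> \<bar>norm (\<gamma> s) - 1\<bar>" using R by (simp add: field_simps)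
    then have "\<bar>norm (\<gamma> s) - 1\<bar> powr (- k) \<le> (\<bar>s\<^sup>2 - c\<bar> / (R + 1)) powr (- k)"
      using s R k by (intro powr_mono2') auto
    also have "\<dots> = (R + 1) powr k * \<bar>s\<^sup>2 - c\<bar> powr (- k)"
      using R by (simp add: powr_divide powr_minus divide_simps)
    also have "\<dots> \<le> (R + 1) powr k * g s" using g(3)[of s] s by (intro mult_left_mono) auto
    finally have "K * \<bar>norm (\<gamma> s) - 1\<bar> powr (- k) \<le> K * ((R + 1) powr k * g s)" using K(1) by simp
    then have "norm (F' v) \<le> K * (R + 1) powr k * g s" using F'(2) v by (simp add: mult.assoc)
    with der show "\<exists>d. ((\<lambda>s. F (\<gamma> s)) has_vector_derivative d) (at s) \<and> norm d \<le> K * (R + 1) powr k * g s"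
      by blast
  qed
qed

lemma ACL_F: "ACL_on UNIV F"
proof -
  have h: "abs_continuous_on_interval x1 x2 (\<lambda>x. F (Complex x y))" if "y \<noteq> 1" "y \<noteq> -1" for x1 x2 y
  proof (rule F_abs_continuous_on_line[where v = 1 and y = y])
    have "Complex s y = of_real s + \<i> * of_real y" for s by (simp add: Complex_eq)
    then show "((\<lambda>x. Complex x y) has_vector_derivative 1) (at s)" for s
      by (auto intro!: derivative_eq_intros simp: has_vector_derivative_def scaleR_conv_of_real)
  qed (use that in \<open>auto simp: cmod_power2 power2_eq_1_iff\<close>)
  have v: "abs_continuous_on_interval y1 y2 (\<lambda>y. F (Complex x y))" if "x \<noteq> 1" "x \<noteq> -1" for y1 y2 x
  proof (rule F_abs_continuous_on_line[where v = \<i> and y = x])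
    have "Complex x = (\<lambda>s. of_real x + \<i> * of_real s)" by (simp add: Complex_eq fun_eq_iff)
    moreover have "((\<lambda>s. of_real x + \<i> * of_real s) has_vector_derivative \<i>) (at s)" for s
      by (auto intro!: derivative_eq_intros simp: has_vector_derivative_def scaleR_conv_of_real mult.commute)
    ultimately show "(Complex x has_vector_derivative \<i>) (at s)" for s by simp
  qed (use that in \<open>auto simp: cmod_power2 power2_eq_1_iff add.commute\<close>)
  have ae: "AE x in lborel. x \<noteq> 1 \<and> x \<noteq> (-1::real)"
    using AE_lborel_singleton[of 1] AE_lborel_singleton[of "-1"] by eventually_elim simp
  show ?thesis unfolding ACL_on_def
  proof (intro allI impI conjI)
    fix x1 x2 y1 y2 :: real
    show "AE y\<in>{y1..y2} in lborel. abs_continuous_on_interval x1 x2 (\<lambda>x. F (Complex x y))"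
      using ae by eventually_elim (use h in blast)
    show "AE x\<in>{x1..x2} in lborel. abs_continuous_on_interval y1 y2 (\<lambda>y. F (Complex x y))"
      using ae by eventually_elim (use v in blast)
  qed
qed

lemma F_0: "F 0 = 0" by (simp add: F_def V_def)

text \<open>
  Since \<open>F\<close> is injective, centre and radius of the circle can be moved continuously to 0 and 1/2
  without the image curve meeting the image of the centre. Near 0 the factor \<open>exp(Lam/\<alpha>)\<close> in
  \<open>F(z) = z exp(Lam(z,0)/\<alpha>)\<close> is then contracted to 1.
\<close>

lemma sense_preserving_F: "sense_preserving_on UNIV F"
  unfolding sense_preserving_on_def
proof (intro allI impI)
  fix z :: complex and r :: real assume "0 < r \<and> cball z r \<subseteq> UNIV"
  then have r: "0 < r" by simp
  let ?e = "\<lambda>x::real. exp (2 * of_real pi * \<i> * of_real x)"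
  have e1: "norm (?e x) = 1" for x by simp
  have eloop: "?e 1 = ?e 0" by simp
  define H1 where "H1 p = F (of_real (1 - fst p) * z + of_real ((1 - fst p) * r + fst p / 2) * ?e (snd p))
      - F (of_real (1 - fst p) * z)" for p :: "real \<times> real"
  define H2 where "H2 p = of_real (1/2) * ?e (snd p) * exp (of_real (1 - fst p) * (Lam (of_real (1/2) * ?e (snd p), 0) / \<alpha>))" for p :: "real \<times> real"
  have "homotopic_loops (- {0}) (\<lambda>x. F (z + of_real r * ?e x) - F z) (\<lambda>x. F (of_real (1/2) * ?e x) - F 0)"
    unfolding homotopic_loops
  proof (intro exI[of _ H1] conjI ballI)
    show "continuous_on ({0..1} \<times> {0..1}) H1" unfolding H1_def
      by (intro continuous_intros continuous_on_compose2[OF continuous_on_F]) auto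
    show "H1 \<in> {0..1} \<times> {0..1} \<rightarrow> - {0}"
    proof
      fix p :: "real \<times> real" assume p: "p \<in> {0..1} \<times> {0..1}"
      have "0 < (1 - fst p) * r + fst p / 2"
      proof (cases "fst p = 0")
        case False
        then have "0 < fst p / 2" "0 \<le> (1 - fst p) * r" using p r by auto
        then show ?thesis by linarith
      qed (use r in simp)
      then have "complex_of_real ((1 - fst p) * r + fst p / 2) * ?e (snd p) \<noteq> 0" by (simp del: of_real_add of_real_mult)
      then show "H1 p \<in> - {0}" using injD[OF inj_F] by (fastforce simp: H1_def simp del: of_real_add of_real_mult)
    qed
  qed (auto simp: H1_def pathfinish_def pathstart_def eloop)
  then have "winding_number (\<lambda>x. F (z + of_real r * ?e x) - F z) 0 = winding_number (\<lambda>x. F (of_real (1/2) * ?e x) - F 0) 0"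
    by (rule winding_number_homotopic_loops)
  also have "homotopic_loops (- {0}) (\<lambda>x. F (of_real (1/2) * ?e x) - F 0) (circlepath 0 (1/2))"
    unfolding homotopic_loops
  proof (intro exI[of _ H2] conjI ballI)
    show "continuous_on ({0..1} \<times> {0..1}) H2" unfolding H2_def
      by (intro continuous_intros continuous_on_compose2[OF Lam(1)]) (auto simp: wedge_iff norm_mult alpha_nz)
  qed (auto simp: H2_def F_0 F_def V_def norm_mult circlepath pathfinish_def pathstart_def eloop)
  then have "winding_number (\<lambda>x. F (of_real (1/2) * ?e x) - F 0) 0 = winding_number (circlepath 0 (1/2)) 0"
    by (rule winding_number_homotopic_loops)
  also have "\<dots> = 1" by (rule winding_number_circlepath_centre) simp
  finally show "winding_number (F \<circ> circlepath z r) (F z) = 1"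
    by (subst winding_number_offset) (simp add: o_def circlepath)
qed

theorem quasiconformal_F: "quasiconformal_on k UNIV F"
  unfolding quasiconformal_on_def
proof (intro conjI)
  show "\<exists>F'. homeomorphism UNIV (F ` UNIV) F F'"
    using invariance_of_domain_homeomorphism[OF open_UNIV continuous_on_F _ inj_F] by auto
  have "sphere (0::complex) 1 \<in> null_sets lebesgue"
    using negligible_sphere by (simp add: negligible_iff_null_sets)
  then have "AE z in lebesgue. z \<notin> sphere (0::complex) 1" by (rule AE_not_in)
  then show "AE z\<in>UNIV in lebesgue. has_partials_at F z \<and> norm (partial_zbar F z) \<le> k * norm (partial_z F z)"
    by eventually_elim (use F_dilatation in auto)
qed (use k ACL_F sense_preserving_F in auto)

lemma holomorphic_F: "F holomorphic_on \<U>"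
  unfolding holomorphic_on_def
proof
  fix z :: complex assume "z \<in> \<U>"
  then have "(F has_field_derivative V_w (z, 0)) (at z)"
    using F_derivative_inner[of z] by (simp add: has_field_derivative_def)
  then show "F field_differentiable at z within \<U>"
    using field_differentiable_at_within field_differentiable_def by blast
qed

text \<open>
  \<open>Lam\<close> vanishes at \<open>(0,0)\<close>, so near 0 it is the principal logarithm of \<open>\<phi>\<close>.
\<close>

lemma F_near_0: "\<forall>\<^sub>F z in nhds 0. F z = z * \<phi> z powr (1 / \<alpha>)"
proof -
  have "continuous_on \<U> (\<lambda>z. Lam (z, 0))"
    by (intro continuous_on_compose2[OF Lam(1)] continuous_intros) (auto simp: wedge_iff)
  then have "isCont (\<lambda>z. Lam (z, 0)) 0" by (simp add: continuous_on_eq_continuous_at)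
  then have "((\<lambda>z. norm (Lam (z, 0))) \<longlongrightarrow> norm (Lam (0, 0))) (nhds 0)"
    by (intro tendsto_norm) (simp add: isCont_def tendsto_at_iff_tendsto_nhds[of "\<lambda>z. Lam (z, 0)" 0])
  then have "\<forall>\<^sub>F z in nhds 0. norm (Lam (z, 0)) < pi"
    by (rule order_tendstoD) (simp add: Lam(3))
  moreover have "\<forall>\<^sub>F z in nhds 0. z \<in> \<U>" by (intro eventually_nhds_in_open) auto
  ultimately show ?thesis
  proof eventually_elim
    case (elim z)
    then have z: "norm z < 1" by simp
    have e: "exp (Lam (z, 0)) = \<phi> z" using z by (simp add: Lam(2) wedge_iff A_ext_eq A_def)
    have "\<bar>Im (Lam (z, 0))\<bar> < pi" using elim abs_Im_le_cmod[of "Lam (z, 0)"] by linarith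
    then have "Ln (\<phi> z) = Lam (z, 0)" unfolding e[symmetric] by (intro Ln_exp) auto
    moreover have "\<phi> z \<noteq> 0" using e by (metis exp_not_eq_zero)
    ultimately show ?case using z by (simp add: F_def V_def powr_def)
  qed
qed

end

section \<open>The pair belonging to the integral operator\<close>

text \<open>
  The \<open>n\<close>-th Taylor coefficient of \<open>\<phi>\<close> is that of \<open>\<theta>\<close> times \<open>\<alpha>/(\<alpha> + n)\<close>, and these factors are bounded.
\<close>

lemma euler_equation_solution:
  assumes hol: "\<theta> holomorphic_on \<U>" and \<alpha>: "0 < Re \<alpha>"
  obtains \<phi> where "\<phi> holomorphic_on \<U>" "\<And>w. norm w < 1 \<Longrightarrow> \<alpha> * \<phi> w + w * deriv \<phi> w = \<alpha> * \<theta> w"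
proof -
  have U: "eball 0 1 = \<U>" by (auto simp: eball_def one_ereal_def)
  define X where "X = fps_expansion \<theta> 0"
  have X: "1 \<le> fps_conv_radius X" "\<And>z. norm z < 1 \<Longrightarrow> eval_fps X z = \<theta> z"
    using conv_radius_fps_expansion[of \<theta> 0 1] eval_fps_expansion'[of \<theta> 0 1] hol
    by (auto simp: U X_def one_ereal_def)
  define Y where "Y = Abs_fps (\<lambda>n. \<alpha> * fps_nth X n / (\<alpha> + of_nat n))"
  have den: "Re \<alpha> \<le> norm (\<alpha> + of_nat n)" for n
    using complex_Re_le_cmod[of "\<alpha> + of_nat n"] by simp
  have nz: "\<alpha> + of_nat n \<noteq> 0" for n using den[of n] \<alpha> by auto
  have Y: "1 \<le> fps_conv_radius Y"
    unfolding fps_conv_radius_def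
  proof (rule conv_radius_geI_ex)
    fix r :: real assume r: "0 < r" "ereal r < 1"
    have "ereal (norm (of_real r :: complex)) < fps_conv_radius X"
      using less_le_trans[OF r(2) X(1)] r(1) by simp
    then have "summable (\<lambda>n. norm (fps_nth X n * of_real r ^ n))" by (rule norm_summable_fps)
    then have s: "summable (\<lambda>n. norm \<alpha> / Re \<alpha> * norm (fps_nth X n * of_real r ^ n))" by (rule summable_mult)
    have "summable (\<lambda>n. fps_nth Y n * of_real r ^ n)"
    proof (rule summable_comparison_test'[OF s, of 0])
      fix n :: nat
      have "norm (fps_nth Y n * of_real r ^ n) = norm \<alpha> / norm (\<alpha> + of_nat n) * norm (fps_nth X n * of_real r ^ n)"
        by (simp add: Y_def norm_mult norm_divide)
      also have "\<dots> \<le> norm \<alpha> / Re \<alpha> * norm (fps_nth X n * of_real r ^ n)"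
        using den[of n] \<alpha> nz[of n] by (intro mult_right_mono divide_left_mono mult_pos_pos) auto
      finally show "norm (fps_nth Y n * of_real r ^ n) \<le> norm \<alpha> / Re \<alpha> * norm (fps_nth X n * of_real r ^ n)" .
    qed
    then show "\<exists>z::complex. norm z = r \<and> summable (\<lambda>n. fps_nth Y n * z ^ n)"
      using r by (intro exI[of _ "of_real r"]) auto
  qed
  have fps_eq: "fps_const \<alpha> * Y + fps_X * fps_deriv Y = fps_const \<alpha> * X"
  proof (rule fps_ext)
    fix n
    have "fps_nth (fps_const \<alpha> * Y + fps_X * fps_deriv Y) n = (\<alpha> + of_nat n) * fps_nth Y n"
      by (cases n) (auto simp: algebra_simps)
    also have "\<dots> = fps_nth (fps_const \<alpha> * X) n" using nz[of n] by (simp add: Y_def)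
    finally show "fps_nth (fps_const \<alpha> * Y + fps_X * fps_deriv Y) n = fps_nth (fps_const \<alpha> * X) n" .
  qed
  show thesis
  proof (rule that[of "eval_fps Y"])
    show "eval_fps Y holomorphic_on \<U>"
      by (intro holomorphic_on_eval_fps) (auto simp: eball_def one_ereal_def intro!: less_le_trans[OF _ Y])
    fix w :: complex assume w: "norm w < 1"
    then have "ereal (norm w) < 1" by simp
    then have wY: "ereal (norm w) < fps_conv_radius Y" and wX: "ereal (norm w) < fps_conv_radius X"
      using less_le_trans[OF _ Y] less_le_trans[OF _ X(1)] by blast+
    have wd: "ereal (norm w) < fps_conv_radius (fps_deriv Y)"
      using wY fps_conv_radius_deriv[of Y] by (rule less_le_trans)
    have wp: "ereal (norm w) < fps_conv_radius (fps_const \<alpha> * Y)" "ereal (norm w) < fps_conv_radius (fps_X * fps_deriv Y)"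
      using wY wd fps_conv_radius_mult[of "fps_const \<alpha>" Y] fps_conv_radius_mult[of fps_X "fps_deriv Y"]
      by (auto intro: less_le_trans)
    have "deriv (eval_fps Y) w = eval_fps (fps_deriv Y) w"
      using has_field_derivative_eval_fps[OF wY] by (rule DERIV_imp_deriv)
    then have "\<alpha> * eval_fps Y w + w * deriv (eval_fps Y) w = eval_fps (fps_const \<alpha> * Y + fps_X * fps_deriv Y) w"
      using wY wd wp by (simp add: eval_fps_add eval_fps_mult)
    also have "\<dots> = \<alpha> * \<theta> w" unfolding fps_eq using wX w by (simp add: eval_fps_mult X(2))
    finally show "\<alpha> * eval_fps Y w + w * deriv (eval_fps Y) w = \<alpha> * \<theta> w" .
  qed
qed

text \<open>
  By the differential equation, \<open>t\<^sup>\<alpha> \<phi>(tw)\<close> is a primitive of \<open>\<alpha> t\<^sup>\<alpha>\<^sup>-\<^sup>1 \<theta>(tw)\<close>; it vanishes at \<open>t = 0\<close>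
  because \<open>Re \<alpha> > 0\<close>.
\<close>

lemma euler_equation_integral:
  assumes hol: "\<phi> holomorphic_on \<U>" and \<alpha>: "0 < Re \<alpha>"
    and ode: "\<And>w. norm w < 1 \<Longrightarrow> \<alpha> * \<phi> w + w * deriv \<phi> w = \<alpha> * \<theta> w" and w: "norm w < 1"
  shows "\<alpha> * integral {0..1} (\<lambda>t. of_real t powr (\<alpha> - 1) * \<theta> (of_real t * w)) = \<phi> w"
proof -
  let ?f = "\<lambda>t::real. of_real t powr \<alpha> * \<phi> (of_real t * w)"
  have disc: "norm (of_real t * w) < 1" if "0 \<le> t" "t \<le> 1" for t
    using that w mult_left_le_one_le[of "norm w" t] by (simp add: norm_mult)
  have "((\<lambda>t. \<alpha> * (of_real t powr (\<alpha> - 1) * \<theta> (of_real t * w))) has_integral (?f 1 - ?f 0)) {0..1}"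
  proof (rule fundamental_theorem_of_calculus_interior)
    show "continuous_on {0..1} ?f"
      using disc \<alpha> by (intro continuous_on_mult continuous_on_powr_complex continuous_intros
          continuous_on_compose2[OF holomorphic_on_imp_continuous_on[OF hol]]) auto
    fix t :: real assume t: "t \<in> {0<..<1}"
    have d: "norm (of_real t * w) < 1" using disc t by auto
    have "(\<phi> has_field_derivative deriv \<phi> (of_real t * w)) (at (of_real t * w))"
      using holomorphic_derivI[OF hol open_ball] d by simp
    then have 1: "((\<lambda>z. \<phi> (z * w)) has_field_derivative (deriv \<phi> (of_real t * w) * w)) (at (of_real t))"
      by (rule DERIV_chain2) (auto intro!: derivative_eq_intros)
    have 2: "((\<lambda>z. z powr \<alpha>) has_field_derivative \<alpha> * of_real t powr (\<alpha> - 1)) (at (of_real t))"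
      using t by (intro has_field_derivative_powr) (auto simp: complex_nonpos_Reals_iff)
    have D: "((\<lambda>z. z powr \<alpha> * \<phi> (z * w)) has_field_derivative
       (\<alpha> * of_real t powr (\<alpha> - 1) * \<phi> (of_real t * w) + deriv \<phi> (of_real t * w) * w * of_real t powr \<alpha>)) (at (of_real t))"
      using DERIV_mult[OF 2 1] .
    have "\<alpha> * of_real t powr (\<alpha> - 1) * \<phi> (of_real t * w) + deriv \<phi> (of_real t * w) * w * of_real t powr \<alpha>
        = of_real t powr (\<alpha> - 1) * (\<alpha> * \<phi> (of_real t * w) + (of_real t * w) * deriv \<phi> (of_real t * w))"
      using t by (simp add: powr_diff field_simps)
    also have "\<alpha> * \<phi> (of_real t * w) + (of_real t * w) * deriv \<phi> (of_real t * w) = \<alpha> * \<theta> (of_real t * w)"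
      by (rule ode[OF d])
    also have "of_real t powr (\<alpha> - 1) * (\<alpha> * \<theta> (of_real t * w)) = \<alpha> * (of_real t powr (\<alpha> - 1) * \<theta> (of_real t * w))"
      by (rule mult.left_commute)
    finally have "((\<lambda>z. z powr \<alpha> * \<phi> (z * w)) has_field_derivative
       \<alpha> * (of_real t powr (\<alpha> - 1) * \<theta> (of_real t * w))) (at (of_real t))"
      by (rule DERIV_cong[OF D])
    then show "(?f has_vector_derivative \<alpha> * (of_real t powr (\<alpha> - 1) * \<theta> (of_real t * w))) (at t)"
      by (rule has_vector_derivative_real_field)
  qed simp
  then have "integral {0..1} (\<lambda>t. \<alpha> * (of_real t powr (\<alpha> - 1) * \<theta> (of_real t * w))) = ?f 1 - ?f 0"
    by (rule integral_unique)
  then show ?thesis unfolding integral_mult_right by simp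
qed

lemma holomorphic_div_id:
  assumes "g \<in> \<A>"
  shows "div_id g holomorphic_on \<U>"
proof -
  have g: "g holomorphic_on \<U>" "g 0 = 0" "deriv g 0 = 1" using assms by (auto simp: class_A_def)
  have "(\<lambda>z. if z = 0 then deriv g 0 else g z / z - g 0 / (z - 0)) holomorphic_on \<U>"
    by (rule pole_theorem[OF g(1)]) auto
  moreover have "(\<lambda>z. if z = 0 then deriv g 0 else g z / z - g 0 / (z - 0)) = div_id g"
    by (auto simp: div_id_def g)
  ultimately show ?thesis by simp
qed

text \<open>
  A holomorphic version on the whole disc of the power in the definition of \<open>G_phi\<close>, whose principal
  value is the right one near 0 only. For \<open>\<alpha> = 1\<close> it is the constant 1, since then \<open>g\<close> may have zeros.
\<close>

lemma power_branch:
  assumes g: "g \<in> \<A>" and nz: "\<alpha> \<noteq> 1 \<longrightarrow> (\<forall>z\<in>\<U> - {0}. g z \<noteq> 0)"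
  obtains p where "p holomorphic_on \<U>" "\<And>w. norm w < 1 \<Longrightarrow> p w \<noteq> 0"
    "\<And>w. norm w < 1 \<Longrightarrow> w * deriv p w = (\<alpha> - 1) * (log_deriv_quot g w - 1) * p w"
    "\<forall>\<^sub>F u in nhds 0. p u = div_id g u powr (\<alpha> - 1)"
proof -
  have hd: "div_id g holomorphic_on \<U>" by (rule holomorphic_div_id[OF g])
  have d0: "div_id g 0 = 1" by (simp add: div_id_def)
  have lim: "(f \<longlongrightarrow> f 0) (nhds 0)" if "f holomorphic_on \<U>" for f :: "complex \<Rightarrow> complex"
  proof -
    have "isCont f 0" using holomorphic_on_imp_continuous_on[OF that] by (simp add: continuous_on_eq_continuous_at)
    then show ?thesis by (simp add: isCont_def tendsto_at_iff_tendsto_nhds)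
  qed
  show thesis
  proof (cases "\<alpha> = 1")
    case True
    have "\<forall>\<^sub>F u in nhds 0. div_id g u \<noteq> 0"
      using tendsto_imp_eventually_ne[OF lim[OF hd], of 0] d0 by simp
    then have "\<forall>\<^sub>F u in nhds 0. 1 = div_id g u powr (\<alpha> - 1)"
      by eventually_elim (simp add: True powr_def)
    then show thesis using True by (intro that[of "\<lambda>_. 1"]) auto
  next
    case False
    have dnz: "div_id g w \<noteq> 0" if "w \<in> \<U>" for w using nz False that by (auto simp: div_id_def)
    obtain l0 where l0: "l0 holomorphic_on \<U>" "\<And>w. w \<in> \<U> \<Longrightarrow> div_id g w = exp (l0 w)"
      using contractible_imp_holomorphic_log[OF hd convex_imp_contractible[OF convex_ball]] dnz by metis
    define l where "l w = l0 w - l0 0" for w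
    have l: "l holomorphic_on \<U>" "l 0 = 0" unfolding l_def by (auto intro!: holomorphic_intros l0)
    have el: "exp (l w) = div_id g w" if "norm w < 1" for w
      using l0(2)[of w] l0(2)[of 0] that d0 by (simp add: l_def exp_diff)
    have dl: "(l has_field_derivative deriv l w) (at w)" if "norm w < 1" for w
      using holomorphic_derivI[OF l(1) open_ball] that by simp
    have ldq: "w * deriv l w = log_deriv_quot g w - 1" if w: "norm w < 1" for w
    proof (cases "w = 0")
      case False
      have "((\<lambda>w. exp (l w)) has_field_derivative exp (l w) * deriv l w) (at w)"
        using dl[OF w] by (auto intro!: derivative_eq_intros)
      then have "((\<lambda>w. g w / w) has_field_derivative exp (l w) * deriv l w) (at w)"
        by (rule has_field_derivative_transform_within_open[of _ _ _ "\<U> - {0}"])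
           (use w False el in \<open>auto simp: div_id_def\<close>)
      moreover have "(g has_field_derivative deriv g w) (at w)"
        using holomorphic_derivI[of g \<U> w] g w by (auto simp: class_A_def)
      then have "((\<lambda>w. g w / w) has_field_derivative (deriv g w * w - g w) / w\<^sup>2) (at w)"
        using False by (auto intro!: derivative_eq_intros simp: power2_eq_square)
      ultimately have e: "exp (l w) * deriv l w = (deriv g w * w - g w) / w\<^sup>2" by (rule DERIV_unique)
      have gw: "exp (l w) = g w / w" "g w \<noteq> 0" using el[OF w] False dnz[of w] w by (auto simp: div_id_def)
      have "g w * (w * deriv l w) = w\<^sup>2 * (exp (l w) * deriv l w)"
        using False by (simp add: gw(1) power2_eq_square)
      also have "\<dots> = deriv g w * w - g w" unfolding e using False by simp
      finally show ?thesis using gw(2) False by (simp add: log_deriv_quot_def field_simps)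
    qed (simp add: log_deriv_quot_def)
    let ?p = "\<lambda>w. exp ((\<alpha> - 1) * l w)"
    show thesis
    proof (rule that[of ?p])
      show "?p holomorphic_on \<U>" by (intro holomorphic_intros l)
      fix w :: complex assume w: "norm w < 1"
      have "(?p has_field_derivative ?p w * ((\<alpha> - 1) * deriv l w)) (at w)"
        using dl[OF w] by (auto intro!: derivative_eq_intros)
      then have "deriv ?p w = ?p w * ((\<alpha> - 1) * deriv l w)" by (rule DERIV_imp_deriv)
      then have "w * deriv ?p w = (\<alpha> - 1) * (w * deriv l w) * ?p w" by (simp add: mult_ac)
      then show "w * deriv ?p w = (\<alpha> - 1) * (log_deriv_quot g w - 1) * ?p w" by (simp only: ldq[OF w])
    next
      have "((\<lambda>w. norm (l w)) \<longlongrightarrow> norm (l 0)) (nhds 0)" by (intro tendsto_norm lim l)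
      then have "\<forall>\<^sub>F w in nhds 0. norm (l w) < pi" by (rule order_tendstoD) (simp add: l)
      moreover have "\<forall>\<^sub>F w in nhds 0. w \<in> \<U>" by (intro eventually_nhds_in_open) auto
      ultimately show "\<forall>\<^sub>F u in nhds 0. ?p u = div_id g u powr (\<alpha> - 1)"
      proof eventually_elim
        case (elim u)
        then have "\<bar>Im (l u)\<bar> < pi" using abs_Im_le_cmod[of "l u"] by linarith
        then have "Ln (exp (l u)) = l u" by (intro Ln_exp) auto
        then have "Ln (div_id g u) = l u" using el elim by simp
        then show ?case using dnz[of u] elim by (simp add: powr_def)
      qed
    qed auto
  qed
qed

lemma quasiconformal_on_mono:
  assumes "quasiconformal_on k S F" "k \<le> K" "K < 1"
  shows "quasiconformal_on K S F"
proof -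
  have "AE z\<in>S in lebesgue. has_partials_at F z \<and> norm (partial_zbar F z) \<le> k * norm (partial_z F z)"
    using assms(1) by (simp add: quasiconformal_on_def)
  then have "AE z\<in>S in lebesgue. has_partials_at F z \<and> norm (partial_zbar F z) \<le> K * norm (partial_z F z)"
  proof eventually_elim
    case (elim z)
    have "k * norm (partial_z F z) \<le> K * norm (partial_z F z)" using assms(2) by (rule mult_right_mono) simp
    with elim show ?case by (auto intro: order_trans)
  qed
  with assms show ?thesis by (auto simp: quasiconformal_on_def)
qed

text \<open>
  With \<open>r = |s - 1| / |s + 1| < 1\<close> the constant is \<open>(r + k)/(1 + rk)\<close>, the hyperbolic sum of \<open>r\<close> and
  \<open>k\<close>.
\<close>

lemma dilatation_bounds:
  fixes s :: complex
  assumes s: "0 < Re s" "s \<noteq> 1" and k: "0 \<le> k" "k < 1"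
  defines "K \<equiv> (norm (s - 1) ^ 2 + k * norm (cnj s ^ 2 - 1)) / (norm (cnj s ^ 2 - 1) + k * norm (s - 1) ^ 2)"
  shows "k \<le> K" "K < 1"
proof -
  define a b where "a = norm (s - 1)" and "b = norm (s + 1)"
  have a: "0 < a" using s by (simp add: a_def)
  have ab: "a < b"
  proof (rule power2_less_imp_less)
    show "a\<^sup>2 < b\<^sup>2" using s(1) unfolding a_def b_def cmod_power2 by (simp add: power2_eq_square algebra_simps)
  qed (simp add: b_def)
  have "cnj s ^ 2 - 1 = cnj ((s - 1) * (s + 1))" by (simp add: power2_eq_square algebra_simps)
  then have "norm (cnj s ^ 2 - 1) = a * b" by (simp only: complex_mod_cnj norm_mult a_def b_def)
  then have "K = (a * (a + k * b)) / (a * (b + k * a))"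
    by (simp add: K_def power2_eq_square algebra_simps flip: a_def)
  then have K: "K = (a + k * b) / (b + k * a)" using a by simp
  have den: "0 < b + k * a" using a ab k by (simp add: add_pos_nonneg)
  have "k * k * a \<le> 1 * a" using k a by (intro mult_right_mono mult_le_one) auto
  then show "k \<le> K" unfolding K using den by (simp add: pos_le_divide_eq algebra_simps)
  have "(1 - k) * a < (1 - k) * b" using ab k by simp
  then show "K < 1" unfolding K using den by (simp add: algebra_simps)
qed

theorem theorem4p1:
  fixes \<alpha> c s h0 :: complex and a b m k :: real
    and f g h :: "complex \<Rightarrow> complex"
  assumes c: "c \<notin> \<real>\<^sub>\<ge>\<^sub>0"
    and s: "s = Complex a b" and a: "a > 0"
    and m: "m > 0" and k: "0 \<le> k" "k < 1"
    and f: "f \<in> \<A>" and g: "g \<in> \<A>"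
    and h: "h holomorphic_on \<U>" "h 0 = h0" and h0: "h0 \<notin> \<real>\<^sub>\<le>\<^sub>0"
    and h_nz: "\<forall>z\<in>\<U>. h z \<noteq> 0"
    and f'_nz: "\<forall>z\<in>\<U>. deriv f z \<noteq> 0"
    and g_nz: "\<alpha> \<noteq> 1 \<longrightarrow> (\<forall>z\<in>\<U> - {0}. g z \<noteq> 0)"
    and ineq1: "norm (\<alpha> - of_real (m / (2 * a))) < m / (2 * a)"
    and ineq2: "\<forall>z\<in>\<U>. norm (c * \<alpha> / h z + of_real (m / 2)) < k * (m / 2)"
    and ineq3: "\<forall>z\<in>\<U>.
       norm (- c * \<alpha> / (of_real a * h z) * of_real (norm z powr (m / a))
             + (1 - of_real (norm z powr (m / a)))
                 * ((\<alpha> - 1) * log_deriv_quot g z + 1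
                    + z * deriv (deriv f) z / deriv f z + z * deriv h z / h z)
             - of_real (m / (2 * a)))
         \<le> k * (m / (2 * a))"
  shows "\<exists>G. is_G_alpha \<alpha> f g G \<and>
             has_quasiconformal_extension
               (if s = 1 then k
                else (norm (s - 1) ^ 2 + k * norm (cnj s ^ 2 - 1))
                     / (norm (cnj s ^ 2 - 1) + k * norm (s - 1) ^ 2)) G"
proof -
  define \<mu> where "\<mu> = m / a"
  have mu: "0 < \<mu>" "m / (2 * a) = \<mu> / 2" using m a by (auto simp: \<mu>_def)
  have c0: "c \<noteq> 0" using c by auto
  have "\<mu> / 2 - Re \<alpha> \<le> norm (\<alpha> - of_real (\<mu> / 2))"
    using complex_Re_le_cmod[of "of_real (\<mu> / 2) - \<alpha>"] by (simp add: norm_minus_commute)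
  then have Re\<alpha>: "0 < Re \<alpha>" using ineq1 unfolding mu by linarith
  then have \<alpha>0: "\<alpha> \<noteq> 0" by auto
  obtain p where p: "p holomorphic_on \<U>" "\<And>w. norm w < 1 \<Longrightarrow> p w \<noteq> 0"
    "\<And>w. norm w < 1 \<Longrightarrow> w * deriv p w = (\<alpha> - 1) * (log_deriv_quot g w - 1) * p w"
    "\<forall>\<^sub>F u in nhds 0. p u = div_id g u powr (\<alpha> - 1)"
    using power_branch[OF g g_nz] by blast
  have f_hol: "f holomorphic_on \<U>" and f'0: "deriv f 0 = 1" using f by (auto simp: class_A_def)
  have f'_hol: "deriv f holomorphic_on \<U>" using f_hol by (intro holomorphic_deriv) auto
  have p0: "p 0 = 1" using eventually_nhds_x_imp_x[OF p(4)] by (simp add: div_id_def)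
  define \<theta> where "\<theta> w = p w * deriv f w" for w
  have \<theta>: "\<theta> holomorphic_on \<U>" unfolding \<theta>_def by (intro holomorphic_intros p f'_hol)
  have \<theta>nz: "\<theta> w \<noteq> 0" if "norm w < 1" for w using p(2) f'_nz that by (simp add: \<theta>_def)
  obtain \<phi> where \<phi>: "\<phi> holomorphic_on \<U>" "\<And>w. norm w < 1 \<Longrightarrow> \<alpha> * \<phi> w + w * deriv \<phi> w = \<alpha> * \<theta> w"
    using euler_equation_solution[OF \<theta> Re\<alpha>] by blast
  \<comment> \<open>With this factor \<open>euler_quot \<alpha> \<phi> \<Psi>\<close> becomes \<open>- c * \<alpha> / (a * h)\<close>.\<close>
  define d where "d = - (of_real a / c)"
  have d0: "d \<noteq> 0" using a c0 by (simp add: d_def)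
  define \<Psi> where "\<Psi> w = d * (\<theta> w * h w)" for w
  have \<Psi>nz: "\<Psi> w \<noteq> 0" if "norm w < 1" for w using \<theta>nz[OF that] h_nz that d0 by (simp add: \<Psi>_def)
  have B: "euler_quot \<alpha> \<phi> \<Psi> w = - c * \<alpha> / (of_real a * h w)" if w: "norm w < 1" for w
  proof -
    have "h w \<noteq> 0" using h_nz w by simp
    then show ?thesis
      using \<phi>(2)[OF w] \<theta>nz[OF w] a c0 by (simp add: euler_quot_def \<Psi>_def d_def field_simps)
  qed
  have Q: "euler_quot \<alpha> \<Psi> \<Psi> w = (\<alpha> - 1) * log_deriv_quot g w + 1
                    + w * deriv (deriv f) w / deriv f w + w * deriv h w / h w" if w: "norm w < 1" for w
  proof -
    have dp: "(p has_field_derivative deriv p w) (at w)" using holomorphic_derivI[OF p(1) open_ball] w by simp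
    have df: "(deriv f has_field_derivative deriv (deriv f) w) (at w)" using holomorphic_derivI[OF f'_hol open_ball] w by simp
    have dh: "(h has_field_derivative deriv h w) (at w)" using holomorphic_derivI[OF h(1) open_ball] w by simp
    have "(\<Psi> has_field_derivative d * ((deriv p w * deriv f w + deriv (deriv f) w * p w) * h w + deriv h w * (p w * deriv f w))) (at w)"
      unfolding \<Psi>_def \<theta>_def by (intro DERIV_cmult DERIV_mult dp df dh)
    then have "deriv \<Psi> w = d * ((deriv p w * deriv f w + deriv (deriv f) w * p w) * h w + deriv h w * (p w * deriv f w))"
      by (rule DERIV_imp_deriv)
    then have "w * deriv \<Psi> w = d * (((w * deriv p w) * deriv f w + w * deriv (deriv f) w * p w) * h w + w * deriv h w * (p w * deriv f w))"
      by (simp add: algebra_simps)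
    also have "w * deriv p w = (\<alpha> - 1) * (log_deriv_quot g w - 1) * p w" by (rule p(3)[OF w])
    also have "d * (((\<alpha> - 1) * (log_deriv_quot g w - 1) * p w * deriv f w + w * deriv (deriv f) w * p w) * h w + w * deriv h w * (p w * deriv f w))
       = ((\<alpha> - 1) * (log_deriv_quot g w - 1) + w * deriv (deriv f) w / deriv f w + w * deriv h w / h w) * \<Psi> w"
      using h_nz f'_nz w by (simp add: \<Psi>_def \<theta>_def field_simps)
    finally have "w * deriv \<Psi> w / \<Psi> w = (\<alpha> - 1) * (log_deriv_quot g w - 1) + w * deriv (deriv f) w / deriv f w + w * deriv h w / h w"
      using \<Psi>nz[OF w] by simp
    then show ?thesis using \<Psi>nz[OF w] by (simp add: euler_quot_def add_divide_distrib algebra_simps)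
  qed
  interpret loewner_pair \<alpha> \<mu> k \<phi> \<Psi>
  proof
    show "\<Psi> holomorphic_on \<U>" unfolding \<Psi>_def by (intro holomorphic_intros \<theta> h)
    show "\<phi> 0 = 1" using \<phi>(2)[of 0] \<alpha>0 by (simp add: \<theta>_def p0 f'0)
    fix w :: complex assume w: "norm w < 1"
    have "euler_quot \<alpha> \<phi> \<Psi> w - of_real (\<mu> / 2) = - ((c * \<alpha> / h w + of_real (m / 2)) / of_real a)"
      unfolding B[OF w] \<mu>_def using a h_nz w by (simp add: field_simps)
    then have "norm (euler_quot \<alpha> \<phi> \<Psi> w - of_real (\<mu> / 2)) = norm (c * \<alpha> / h w + of_real (m / 2)) / a"
      using a by (simp only: norm_minus_cancel norm_divide norm_of_real abs_of_pos)
    also have "\<dots> \<le> k * (m / 2) / a" using ineq2 w a by (intro divide_right_mono) (auto intro: less_imp_le)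
    finally show "norm (euler_quot \<alpha> \<phi> \<Psi> w - of_real (\<mu> / 2)) \<le> k * (\<mu> / 2)" by (simp add: \<mu>_def)
    show "norm (of_real (norm w powr \<mu>) * euler_quot \<alpha> \<phi> \<Psi> w
            + (1 - of_real (norm w powr \<mu>)) * euler_quot \<alpha> \<Psi> \<Psi> w - of_real (\<mu> / 2)) \<le> k * (\<mu> / 2)"
      using ineq3[rule_format, of w] w unfolding B[OF w] Q[OF w] mu by (simp add: mult.commute flip: \<mu>_def)
  qed (use mu k \<phi> \<Psi>nz in auto)
  have "is_G_alpha \<alpha> f g F"
    unfolding is_G_alpha_def
  proof
    show "F holomorphic_on \<U>" by (rule holomorphic_F)
    obtain r where r: "0 < r" "\<And>u. norm u < r \<Longrightarrow> p u = div_id g u powr (\<alpha> - 1)"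
      using p(4) unfolding eventually_nhds_metric by (auto simp: dist_norm)
    have "\<forall>\<^sub>F z in nhds 0. z \<in> ball 0 (min r 1)" using r(1) by (intro eventually_nhds_in_open) auto
    with F_near_0 show "\<forall>\<^sub>F z in nhds 0. F z = z * G_phi \<alpha> f g z powr (1 / \<alpha>)"
    proof eventually_elim
      case (elim z)
      then have z: "norm z < r" "norm z < 1" by auto
      have "G_phi \<alpha> f g z = \<alpha> * integral {0..1} (\<lambda>t. of_real t powr (\<alpha> - 1) * \<theta> (of_real t * z))"
        unfolding G_phi_def
      proof (intro arg_cong[of _ _ "\<lambda>x. \<alpha> * x"] integral_cong)
        fix t :: real assume t: "t \<in> {0..1}"
        then have "norm (of_real t * z) < r"
          using z(1) mult_left_le_one_le[of "norm z" t] by (simp add: norm_mult)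
        then show "of_real t powr (\<alpha> - 1) * div_id g (of_real t * z) powr (\<alpha> - 1) * deriv f (of_real t * z)
           = of_real t powr (\<alpha> - 1) * \<theta> (of_real t * z)" by (simp add: \<theta>_def r(2))
      qed
      also have "\<dots> = \<phi> z" by (rule euler_equation_integral[OF \<phi>(1) Re\<alpha> \<phi>(2) z(2)])
      finally show ?case using elim(1) by simp
    qed
  qed
  moreover let ?K = "if s = 1 then k
                else (norm (s - 1) ^ 2 + k * norm (cnj s ^ 2 - 1))
                     / (norm (cnj s ^ 2 - 1) + k * norm (s - 1) ^ 2)"
  have "quasiconformal_on ?K UNIV F"
    using quasiconformal_on_mono[OF quasiconformal_F] quasiconformal_F dilatation_bounds[OF _ _ k, of s] s a by simp
  then have "has_quasiconformal_extension ?K F" unfolding has_quasiconformal_extension_def by blast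
  ultimately show ?thesis by blast
qed

end
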